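(* Let $(X,\lambda)$ be a standard $\sigma$-finite space and let $\mathbb{G}\leqslant\mathrm{Aut}(X,\lambda)$ be an ergodic full group. Let $V$ be a symmetric countably syndetic subset of $\mathbb{G}$. Then $V^{114}$ contains an open neighbourhood of $\mathrm{id}_X$ for the uniform topology $\tau_u$. In particular, $(\mathbb{G},\tau_u)$ is $114$-Steinhaus.
   Context: A standard $\sigma$-finite space $(X,\lambda)$ is a standard Borel space $X$ with an atomless $\sigma$-finite Borel measure $\lambda$ such that $\lambda(X)=+\infty$. $\mathrm{Aut}(X,\lambda)$ is the group of Borel bijections $T$ of $X$ with $\lambda(T(A))=\lambda(T^{-1}(A))=\lambda(A)$ for every Borel $A$, where two bijections are identified when they coincide on a conull set. A full group is a subgroup $\mathbb{G}\leqslant\mathrm{Aut}(X,\lambda)$ stable under cutting and pasting: if $T\in\mathrm{Aut}(X,\lambda)$ and there are a countable partition $(A_n)$ of $X$ and elements $T_n\in\mathbb{G}$ with $T_{\restriction A_n}=T_{n\restriction A_n}$ for all $n$, then $T\in\mathbb{G}$. It is ergodic if every Borel $A\subseteq X$ with $\lambda(T(A)\Delta A)=0$ for all $T\in\mathbb{G}$ is null or conull. The uniform topology $\tau_u$ is the group topology induced by the pseudometrics $d_{u,C}(S,T)=\lambda(\{x\in C: S(x)\neq T(x)\})$, $C$ ranging over Borel sets of finite measure; on $\mathbb{G}$ one takes the induced topology. A subset $V$ of a group $G$ is symmetric if $V=V^{-1}$, and countably syndetic if there is a sequence $(g_n)$ in $G$ with $\bigcup_n g_nV=G$. $V^n$ is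 the set of products of $n$ elements of $V$. A topological group $G$ is $n$-Steinhaus if for every symmetric countably syndetic $V\subseteq G$, $V^n$ contains an open neighbourhood of $e_G$. *)

theory Defs
  imports "HOL-Analysis.Analysis" "HOL-Algebra.Coset" "HOL-Algebra.Bij"
begin

section \<open>Standard sigma-finite spaces\<close>

definition standard_borel :: "'a measure \<Rightarrow> bool" where
  "standard_borel M \<longleftrightarrow>
     (\<exists>\<tau>. topspace \<tau> = space M \<and> completely_metrizable_space \<tau> \<and> second_countable \<tau> \<and>
          sets M = sigma_sets (space M) {U. openin \<tau> U})"

definition atomless :: "'a measure \<Rightarrow> bool" where
  "atomless M \<longleftrightarrow>
     (\<forall>A \<in> sets M. emeasure M A > 0 \<longrightarrow>
        (\<exists>B \<in> sets M. B \<subseteq> A \<and> 0 < emeasure M B \<and> emeasure M B < emeasure M A))"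

definition standard_sigma_finite_space :: "'a measure \<Rightarrow> bool" where
  "standard_sigma_finite_space M \<longleftrightarrow>
     standard_borel M \<and> atomless M \<and> sigma_finite_measure M \<and> emeasure M (space M) = \<infinity>"


section \<open>The group of measure-preserving bijections modulo null sets\<close>

text \<open>Maps are normalised to be \<open>extensional\<close> (through \<open>Bij\<close>), so that their values outside the
  space are irrelevant.\<close>

definition mp_bij :: "'a measure \<Rightarrow> ('a \<Rightarrow> 'a) set" where
  "mp_bij M =
     {T \<in> Bij (space M). \<forall>A \<in> sets M.
        T ` A \<in> sets M \<and> T -` A \<inter> space M \<in> sets M \<and>
        emeasure M (T ` A) = emeasure M A \<and> emeasure M (T -` A \<inter> space M) = emeasure M A}"

definition ae_rel :: "'a measure \<Rightarrow> (('a \<Rightarrow> 'a) \<times> ('a \<Rightarrow> 'a)) set" where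
  "ae_rel M = {(S, T). S \<in> mp_bij M \<and> T \<in> mp_bij M \<and> (AE x in M. S x = T x)}"

definition Aut :: "'a measure \<Rightarrow> ('a \<Rightarrow> 'a) set monoid" where
  "Aut M =
     \<lparr>carrier = mp_bij M // ae_rel M,
      mult = (\<lambda>P Q. \<Union>S\<in>P. \<Union>T\<in>Q. ae_rel M `` {compose (space M) S T}),
      one = ae_rel M `` {\<lambda>x\<in>space M. x}\<rparr>"

lemma mp_bijD:
  assumes "T \<in> mp_bij M"
  shows "T \<in> Bij (space M)" "T \<in> space M \<rightarrow> space M" "T \<in> extensional (space M)" "T \<in> measurable M M"
    "A \<in> sets M \<Longrightarrow> T ` A \<in> sets M" "A \<in> sets M \<Longrightarrow> T -` A \<inter> space M \<in> sets M"
    "A \<in> sets M \<Longrightarrow> emeasure M (T ` A) = emeasure M A"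
    "A \<in> sets M \<Longrightarrow> emeasure M (T -` A \<inter> space M) = emeasure M A"
proof -
  show B: "T \<in> Bij (space M)" using assms by (simp add: mp_bij_def)
  show F: "T \<in> space M \<rightarrow> space M" using B by (rule Bij_imp_funcset)
  show "T \<in> measurable M M" using assms F by (intro measurableI) (auto simp: mp_bij_def)
qed (use assms in \<open>auto simp: mp_bij_def Bij_imp_extensional\<close>)

lemma mp_bij_id: "(\<lambda>x\<in>space M. x) \<in> mp_bij M"
proof -
  have "(\<lambda>x\<in>space M. x) ` A = A" "(\<lambda>x\<in>space M. x) -` A \<inter> space M = A" if "A \<in> sets M" for A
    using sets.sets_into_space[OF that] by (auto simp: image_iff subset_iff)
  then show ?thesis by (simp add: mp_bij_def id_Bij)
qed

lemma mp_bij_compose: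
  assumes "S \<in> mp_bij M" "T \<in> mp_bij M"
  shows "compose (space M) S T \<in> mp_bij M"
proof -
  have "compose (space M) S T ` A = S ` (T ` A)"
    "compose (space M) S T -` A \<inter> space M = T -` (S -` A \<inter> space M) \<inter> space M"
    if "A \<in> sets M" for A
    using sets.sets_into_space[OF that] mp_bijD(2)[OF assms(2)]
    by (auto simp: compose_def image_iff subset_iff Pi_iff) 
  moreover have "compose (space M) S T \<in> Bij (space M)"
    using assms by (intro compose_Bij) (auto dest: mp_bijD)
  ultimately show ?thesis
    unfolding mp_bij_def using assms by (auto simp: mp_bijD simp del: vimage_Int)
qed

lemma mp_bij_inv:
  assumes "T \<in> mp_bij M"
  shows "(\<lambda>x\<in>space M. inv_into (space M) T x) \<in> mp_bij M" (is "?I \<in> _")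
proof -
  have b: "bij_betw T (space M) (space M)" using mp_bijD(1)[OF assms] by (simp add: Bij_def)
  have "?I ` A = T -` A \<inter> space M" "?I -` A \<inter> space M = T ` A" if "A \<in> sets M" for A
  proof -
    have A: "A \<subseteq> space M" using sets.sets_into_space[OF that] .
    show "?I ` A = T -` A \<inter> space M"
    proof (intro equalityI subsetI)
      fix y assume "y \<in> ?I ` A"
      then obtain x where "x \<in> A" "y = inv_into (space M) T x" using A by auto
      moreover have "x \<in> T ` space M" using \<open>x \<in> A\<close> A b by (auto simp: bij_betw_def)
      ultimately show "y \<in> T -` A \<inter> space M" by (auto simp: f_inv_into_f inv_into_into)
    next
      fix y assume y: "y \<in> T -` A \<inter> space M"
      then have "?I (T y) = y" using b A by (auto simp: bij_betw_def inv_into_f_f)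
      then show "y \<in> ?I ` A" using y by (metis IntD1 imageI vimageD)
    qed
    show "?I -` A \<inter> space M = T ` A"
    proof (intro equalityI subsetI)
      fix y assume y: "y \<in> ?I -` A \<inter> space M"
      then have "T (inv_into (space M) T y) = y" using b by (auto simp: bij_betw_def f_inv_into_f)
      then show "y \<in> T ` A" using y by (auto intro!: image_eqI[where x="inv_into (space M) T y"])
    next
      fix y assume "y \<in> T ` A"
      then show "y \<in> ?I -` A \<inter> space M" using b A
        by (auto simp: bij_betw_def inv_into_f_f subset_iff)
    qed
  qed
  then show ?thesis
    using mp_bijD(1)[OF assms] by (auto simp: mp_bij_def restrict_inv_into_Bij mp_bijD[OF assms])
qed

lemma equiv_ae_rel: "equiv (mp_bij M) (ae_rel M)"
proof (rule equivI)
  show "refl_on (mp_bij M) (ae_rel M)" by (auto simp: refl_on_def ae_rel_def)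
  show "sym (ae_rel M)" by (auto simp: sym_def ae_rel_def elim: eventually_mono)
  show "trans (ae_rel M)" by (auto simp: trans_def ae_rel_def)
  show "ae_rel M \<subseteq> mp_bij M \<times> mp_bij M" by (auto simp: ae_rel_def)
qed

lemma ae_rel_compose:
  assumes "(S, S') \<in> ae_rel M" "(T, T') \<in> ae_rel M"
  shows "(compose (space M) S T, compose (space M) S' T') \<in> ae_rel M"
proof -
  have m: "S \<in> mp_bij M" "S' \<in> mp_bij M" "T \<in> mp_bij M" "T' \<in> mp_bij M"
    and S: "AE x in M. S x = S' x" and T: "AE x in M. T x = T' x"
    using assms by (auto simp: ae_rel_def)
  obtain N where N: "N \<in> null_sets M" "{x\<in>space M. S x \<noteq> S' x} \<subseteq> N"
    using S by (auto simp: eventually_ae_filter)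
  have "T -` N \<inter> space M \<in> null_sets M"
    using N(1) mp_bijD(6,8)[OF m(3)] by (auto simp: null_sets_def)
  then have "AE x in M. S (T x) = S' (T x)"
    by (rule AE_I'[where P="\<lambda>x. S (T x) = S' (T x)"]) (use N mp_bijD(2)[OF m(3)] in auto)
  then have "AE x in M. compose (space M) S T x = compose (space M) S' T' x"
    using T AE_space by eventually_elim (simp add: compose_def)
  then show ?thesis using m by (simp add: ae_rel_def mp_bij_compose)
qed

lemma Aut_mult:
  assumes "S \<in> mp_bij M" "T \<in> mp_bij M"
  shows "(ae_rel M `` {S}) \<otimes>\<^bsub>Aut M\<^esub> (ae_rel M `` {T}) = ae_rel M `` {compose (space M) S T}"
proof -
  have "congruent2 (ae_rel M) (ae_rel M) (\<lambda>S T. ae_rel M `` {compose (space M) S T})"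
    by (rule congruent2I[OF equiv_ae_rel equiv_ae_rel])
      (meson ae_rel_compose equiv_class_eq[OF equiv_ae_rel] equiv_ae_rel eq_equiv_class_iff
        equiv_def refl_onD)+
  then show ?thesis
    using UN_equiv_class2[OF equiv_ae_rel equiv_ae_rel _ assms] by (simp add: Aut_def)
qed

lemma group_Aut: "group (Aut M)"
proof (rule groupI)
  have c: "carrier (Aut M) = (\<lambda>T. ae_rel M `` {T}) ` mp_bij M"
    by (auto simp: Aut_def quotient_def)
  have o: "\<one>\<^bsub>Aut M\<^esub> = ae_rel M `` {\<lambda>x\<in>space M. x}" by (simp add: Aut_def)
  show "\<one>\<^bsub>Aut M\<^esub> \<in> carrier (Aut M)" by (auto simp: c o mp_bij_id)
  show "x \<otimes>\<^bsub>Aut M\<^esub> y \<in> carrier (Aut M)" if "x \<in> carrier (Aut M)" "y \<in> carrier (Aut M)" for x y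
    using that by (auto simp: c Aut_mult mp_bij_compose)
  show "x \<otimes>\<^bsub>Aut M\<^esub> y \<otimes>\<^bsub>Aut M\<^esub> z = x \<otimes>\<^bsub>Aut M\<^esub> (y \<otimes>\<^bsub>Aut M\<^esub> z)"
    if "x \<in> carrier (Aut M)" "y \<in> carrier (Aut M)" "z \<in> carrier (Aut M)" for x y z
    using that by (auto simp: c Aut_mult mp_bij_compose compose_assoc[OF mp_bijD(2)])
  show "\<one>\<^bsub>Aut M\<^esub> \<otimes>\<^bsub>Aut M\<^esub> x = x" if "x \<in> carrier (Aut M)" for x
    using that by (auto simp: c o Aut_mult mp_bij_id Id_compose mp_bijD)
  show "\<exists>y\<in>carrier (Aut M). y \<otimes>\<^bsub>Aut M\<^esub> x = \<one>\<^bsub>Aut M\<^esub>" if x: "x \<in> carrier (Aut M)" for x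
  proof -
    obtain T where T: "T \<in> mp_bij M" "x = ae_rel M `` {T}" using x by (auto simp: c)
    show ?thesis
      by (rule bexI[of _ "ae_rel M `` {\<lambda>x\<in>space M. inv_into (space M) T x}"])
        (auto simp: T(2) c o Aut_mult[OF mp_bij_inv[OF T(1)] T(1)]
           Bij_compose_restrict_eq[OF mp_bijD(1)[OF T(1)]] intro: mp_bij_inv[OF T(1)])
  qed
qed

text \<open>A representative of a class. The notions below do not depend on its choice: another one
  changes the sets involved by null sets only.\<close>

definition rep :: "('a \<Rightarrow> 'a) set \<Rightarrow> 'a \<Rightarrow> 'a" where
  "rep P = (SOME T. T \<in> P)"


section \<open>Full groups\<close>

text \<open>Some of the pieces \<open>A n\<close> may be empty, so finite partitions are included.\<close>

definition full_group :: "'a measure \<Rightarrow> ('a \<Rightarrow> 'a) set set \<Rightarrow> bool" where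
  "full_group M G \<longleftrightarrow>
     subgroup G (Aut M) \<and>
     (\<forall>T \<in> carrier (Aut M). \<forall>(A :: nat \<Rightarrow> 'a set) \<theta>.
        range A \<subseteq> sets M \<and> disjoint_family A \<and> (\<Union>n. A n) = space M \<and>
        (\<forall>n. \<theta> n \<in> G \<and> (AE x in M. x \<in> A n \<longrightarrow> rep T x = rep (\<theta> n) x))
        \<longrightarrow> T \<in> G)"

definition ergodic :: "'a measure \<Rightarrow> ('a \<Rightarrow> 'a) set set \<Rightarrow> bool" where
  "ergodic M G \<longleftrightarrow>
     (\<forall>A \<in> sets M. (\<forall>T \<in> G. emeasure M (sym_diff (rep T ` A) A) = 0) \<longrightarrow>
        A \<in> null_sets M \<or> space M - A \<in> null_sets M)"


section \<open>The uniform topology\<close>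

definition unif_dist :: "'a measure \<Rightarrow> 'a set \<Rightarrow> ('a \<Rightarrow> 'a) set \<Rightarrow> ('a \<Rightarrow> 'a) set \<Rightarrow> real" where
  "unif_dist M C S T = measure M {x \<in> C. rep S x \<noteq> rep T x}"

text \<open>Disagreement sets are measurable, so \<open>measure\<close> is not applied to a non-measurable set in
  \<open>unif_dist\<close>.\<close>

lemma sets_neq:
  assumes M: "standard_borel M" and f: "f \<in> measurable M M" and g: "g \<in> measurable M M"
  shows "{x\<in>space M. f x \<noteq> g x} \<in> sets M"
proof -
  obtain \<tau> where t: "topspace \<tau> = space M" "completely_metrizable_space \<tau>" "second_countable \<tau>"
     "sets M = sigma_sets (space M) {U. openin \<tau> U}" using M by (auto simp: standard_borel_def)
  obtain B where B: "countable B" "\<And>V. V \<in> B \<Longrightarrow> openin \<tau> V"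
    "\<And>U x. openin \<tau> U \<Longrightarrow> x \<in> U \<Longrightarrow> \<exists>V \<in> B. x \<in> V \<and> V \<subseteq> U"
    using t(3) unfolding second_countable_def by metis
  have h: "Hausdorff_space \<tau>"
    by (simp add: t completely_metrizable_imp_metrizable_space metrizable_imp_Hausdorff_space)
  have BM: "V \<in> sets M" if "V \<in> B" for V using B(2)[OF that] t(4) by (auto intro: sigma_sets.Basic)
  let ?P = "{p \<in> B \<times> B. fst p \<inter> snd p = {}}"
  have "{x\<in>space M. f x \<noteq> g x} = (\<Union>p\<in>?P. (f -` fst p \<inter> space M) \<inter> (g -` snd p \<inter> space M))"
    (is "?L = ?R")
  proof (intro equalityI subsetI)
    fix x assume x: "x \<in> ?L"
    have s: "f x \<in> topspace \<tau>" "g x \<in> topspace \<tau>" using x f g t by (auto dest: measurable_space)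
    then obtain U V where "openin \<tau> U" "openin \<tau> V" "f x \<in> U" "g x \<in> V" "disjnt U V"
      using h x unfolding Hausdorff_space_def by blast
    moreover obtain U' V' where "U' \<in> B" "V' \<in> B" "f x \<in> U'" "g x \<in> V'" "U' \<subseteq> U" "V' \<subseteq> V"
      using B(3) calculation by metis
    ultimately have "(U', V') \<in> ?P" "x \<in> (f -` fst (U', V') \<inter> space M) \<inter> (g -` snd (U', V') \<inter> space M)"
      using x by (auto simp: disjnt_def)
    then show "x \<in> ?R" by blast
  qed auto
  moreover have "countable ?P" using B(1) by (auto intro: countable_subset[of _ "B \<times> B"])
  ultimately show ?thesis
    using BM f g by (auto intro!: sets.countable_UN' sets.Int measurable_sets)
qed

definition uniform_topology :: "'a measure \<Rightarrow> ('a \<Rightarrow> 'a) set topology" where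
  "uniform_topology M = topology_generated_by
     {{S \<in> carrier (Aut M). unif_dist M C T S < \<epsilon>} | C T \<epsilon>.
        C \<in> sets M \<and> emeasure M C < \<infinity> \<and> T \<in> carrier (Aut M) \<and> \<epsilon> > 0}"


section \<open>Steinhaus groups\<close>

definition topological_group :: "('g, 'b) monoid_scheme \<Rightarrow> 'g topology \<Rightarrow> bool" where
  "topological_group G \<tau> \<longleftrightarrow>
     group G \<and> topspace \<tau> = carrier G \<and>
     continuous_map (prod_topology \<tau> \<tau>) \<tau> (\<lambda>(x, y). x \<otimes>\<^bsub>G\<^esub> y) \<and>
     continuous_map \<tau> \<tau> (\<lambda>x. inv\<^bsub>G\<^esub> x)"

definition symmetric_subset :: "('g, 'b) monoid_scheme \<Rightarrow> 'g set \<Rightarrow> bool" where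
  "symmetric_subset G V \<longleftrightarrow> V \<subseteq> carrier G \<and> V = set_inv\<^bsub>G\<^esub> V"

definition countably_syndetic :: "('g, 'b) monoid_scheme \<Rightarrow> 'g set \<Rightarrow> bool" where
  "countably_syndetic G V \<longleftrightarrow>
     V \<subseteq> carrier G \<and> (\<exists>g :: nat \<Rightarrow> 'g. range g \<subseteq> carrier G \<and> (\<Union>n. g n <#\<^bsub>G\<^esub> V) = carrier G)"

primrec set_power :: "('g, 'b) monoid_scheme \<Rightarrow> 'g set \<Rightarrow> nat \<Rightarrow> 'g set" where
  "set_power G V 0 = {\<one>\<^bsub>G\<^esub>}"
| "set_power G V (Suc n) = set_power G V n <#>\<^bsub>G\<^esub> V"

definition contains_open_nbhd :: "'g topology \<Rightarrow> 'g \<Rightarrow> 'g set \<Rightarrow> bool" where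
  "contains_open_nbhd \<tau> x W \<longleftrightarrow> (\<exists>U. openin \<tau> U \<and> x \<in> U \<and> U \<subseteq> W)"

definition Steinhaus :: "nat \<Rightarrow> ('g, 'b) monoid_scheme \<Rightarrow> 'g topology \<Rightarrow> bool" where
  "Steinhaus n G \<tau> \<longleftrightarrow>
     topological_group G \<tau> \<and>
     (\<forall>V. symmetric_subset G V \<and> countably_syndetic G V \<longrightarrow>
        contains_open_nbhd \<tau> \<one>\<^bsub>G\<^esub> (set_power G V n))"

end

theory Submission
  imports Defs
begin

text \<open>
  Work with honest bijections and almost everywhere equality. Ergodicity makes any two sets of
  infinite measure equidecomposable by pieces of elements of the group. Write \<open>V ^ n\<close> for the set of
  products of \<open>n\<close> elements of \<open>V\<close>.

  A diagonal argument gives an infinite, co-infinite \<open>A\<close> such that every element supported in \<open>A\<close> agrees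
  on \<open>A\<close> with an element of \<open>V ^ 2\<close>; conjugation inside \<open>A\<close> thus costs \<open>4\<close>. An uncountable family of
  commuting involutions gives one infinite, co-infinite swap of two halves in \<open>V ^ 2\<close>, hence all such swaps in
  \<open>A\<close> lie in \<open>V ^ 6\<close>, and a swindle puts every element whose support is co-infinite in \<open>A\<close> into \<open>V ^ 24\<close>.
  An uncountable almost disjoint family gives \<open>w\<close> in \<open>V ^ 2\<close> such that \<open>A \<union> B\<close>, \<open>B = w ` A\<close>, misses only a set \<open>C\<close> of
  finite measure and \<open>A \<inter> B\<close> is infinite. Swaps in \<open>B\<close> cost \<open>10\<close>, so an element that fixes \<open>C\<close> and an infinite
  part of \<open>A \<inter> B\<close> lies in \<open>V ^ (10 + 24 + 10)\<close>, and an element that only fixes \<open>C\<close> lies in \<open>V ^ (10 + 10 + 44)\<close>.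
  By another diagonal argument, elements of sufficiently small support can be moved off \<open>C\<close> by \<open>V\<close> and lie in
  \<open>V ^ 46\<close>. An element close to the identity on \<open>C\<close> is a product of one of small support and one that
  fixes \<open>C\<close>, hence lies in \<open>V ^ 110\<close>, which is contained in \<open>V ^ 114\<close>.
\<close>

text \<open>Syndeticity is used in two ways. Counting: of uncountably many elements, two lie in one
  translate \<open>k n \<circ> V\<close>, and \<open>k n\<close> cancels in their quotient.
  Diagonalisation: if every n failed some requirement, the failures would assemble into a single
  element that no translate can contain. Either way, the element obtained is prescribed only on a
  part of the space. It is therefore used in conjugations, where its unknown part meets only the
  identity and cancels. Infinite measure supplies the room: infinite subsets of \<open>A\<close>
  with infinite complement in \<open>A\<close> are all equivalent inside \<open>A\<close>, so one
  swap yields all others by conjugation, and infinitely many copies of a map fit beside it. A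
  remainder of finite measure is never equivalent to an infinite set, so this method does not reach
  it; that is why the neighbourhood is described by \<open>C\<close>. Exponents grow in even steps:
  \<open>V\<close> need not contain the identity, but products of two elements of \<open>V\<close>
  include it.\<close>

text \<open>The prefix notation \<open>inv\<close> is taken by the group inverse of HOL-Algebra.\<close>

abbreviation finv :: "('a \<Rightarrow> 'b) \<Rightarrow> 'b \<Rightarrow> 'a" where "finv f \<equiv> inv_into UNIV f"

section \<open>Piecewise maps and equidecomposability\<close>

text \<open>Zorn's lemma replaces a countable exhaustion; countability of the family comes
  afterwards, from sigma-finiteness. Maximality is phrased as membership because a new piece that
  belongs to \<open>F\<close> is covered by the union of \<open>F\<close>, which contradicts its
  choice in the remainder.\<close>

lemma maximal_pairwise:
  assumes sym: "\<And>p q. R p q \<Longrightarrow> R q p"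
  obtains F where "F \<subseteq> S" "pairwise R F"
    "\<And>p. p \<in> S \<Longrightarrow> (\<And>q. q \<in> F \<Longrightarrow> R p q) \<Longrightarrow> p \<in> F"
proof -
  let ?A = "{F. F \<subseteq> S \<and> pairwise R F}"
  have "\<exists>F\<in>?A. \<forall>X\<in>?A. F \<subseteq> X \<longrightarrow> X = F"
  proof (rule subset_Zorn_nonempty)
    show "?A \<noteq> {}" by (auto intro: exI[of _ "{}"])
    fix C assume C: "C \<noteq> {}" "subset.chain ?A C"
    have "pairwise R (\<Union>C)"
    proof (rule pairwiseI)
      fix x y assume "x \<in> \<Union>C" "y \<in> \<Union>C" "x \<noteq> y"
      then obtain X Y where "X \<in> C" "Y \<in> C" "x \<in> X" "y \<in> Y" by auto
      moreover from this C(2) have "X \<subseteq> Y \<or> Y \<subseteq> X" "pairwise R X" "pairwise R Y"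
        by (auto simp: subset_chain_def)
      ultimately show "R x y" using \<open>x \<noteq> y\<close> by (auto simp: pairwise_def)
    qed
    then show "\<Union>C \<in> ?A" using C(2) by (auto simp: subset_chain_def)
  qed
  then obtain F where F: "F \<subseteq> S" "pairwise R F"
    and mx: "\<And>X. X \<subseteq> S \<Longrightarrow> pairwise R X \<Longrightarrow> F \<subseteq> X \<Longrightarrow> X = F"
    by (smt (verit, best) mem_Collect_eq)
  show ?thesis
  proof (rule that[OF F])
    fix p assume p: "p \<in> S" "\<And>q. q \<in> F \<Longrightarrow> R p q"
    have "insert p F = F"
      using F p sym by (intro mx) (auto simp: pairwise_insert)
    then show "p \<in> F" by auto
  qed
qed

text \<open>Cutting by the sets \<open>X i\<close> of finite measure gives families of reals with
  bounded partial sums, since the pieces inside \<open>X i\<close> are disjoint. A summable family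
  of reals has countable support, and each nonnull set meets some \<open>X i\<close> in positive
  measure.\<close>

lemma (in sigma_finite_measure) countable_disjoint_nonnull:
  assumes "\<And>A. A \<in> \<F> \<Longrightarrow> A \<in> sets M" "\<And>A. A \<in> \<F> \<Longrightarrow> emeasure M A \<noteq> 0"
    and dj: "pairwise disjnt \<F>"
  shows "countable \<F>"
proof -
  obtain X :: "nat \<Rightarrow> 'a set" where X: "range X \<subseteq> sets M" "(\<Union>i. X i) = space M"
    "\<And>i. emeasure M (X i) \<noteq> \<infinity>" using sigma_finite by blast
  have c: "countable {A \<in> \<F>. measure M (A \<inter> X i) \<noteq> 0}" for i
  proof -
    have Xi: "X i \<in> sets M" using X(1) by auto
    have Xf: "emeasure M (X i) < \<infinity>" using X(3) by (simp add: top.not_eq_extremum)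
    have fm: "A \<inter> X i \<in> sets M" "emeasure M (A \<inter> X i) < \<infinity>" if "A \<in> sets M" for A
      using le_less_trans[OF emeasure_mono[of "A \<inter> X i" "X i" M] Xf] that Xi by auto
    have "sum (\<lambda>A. measure M (A \<inter> X i)) F \<le> measure M (X i)" if "finite F" "F \<subseteq> \<F>" for F
    proof -
      have FM: "A \<in> sets M" if "A \<in> F" for A using that \<open>F \<subseteq> \<F>\<close> assms(1) by auto
      have "disjoint_family_on (\<lambda>A. A \<inter> X i) F"
        using \<open>F \<subseteq> \<F>\<close> dj unfolding disjoint_family_on_def pairwise_def disjnt_def by blast
      then have "measure M (\<Union>A\<in>F. A \<inter> X i) = sum (\<lambda>A. measure M (A \<inter> X i)) F"
        by (intro measure_finite_Union \<open>finite F\<close>) (use fm FM in \<open>force+\<close>)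
      then have "sum (\<lambda>A. measure M (A \<inter> X i)) F = measure M (\<Union>A\<in>F. A \<inter> X i)" by simp
      also have "\<dots> \<le> measure M (X i)"
        by (rule measure_mono_fmeasurable) (use fm FM Xi Xf \<open>finite F\<close> in \<open>auto intro!: fmeasurableI sets.finite_UN sets.Int simp del: UN_simps\<close>)
      finally show ?thesis .
    qed
    then have "(\<lambda>A. measure M (A \<inter> X i)) summable_on \<F>"
      by (intro nonneg_bdd_above_summable_on) (auto simp: bdd_above_def)
    then show ?thesis by (rule summable_countable_real)
  qed
  have "\<F> \<subseteq> (\<Union>i. {A \<in> \<F>. measure M (A \<inter> X i) \<noteq> 0})"
  proof
    fix A assume A: "A \<in> \<F>"
    have "\<exists>i. measure M (A \<inter> X i) \<noteq> 0"
    proof (rule ccontr)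
      assume "\<not> ?thesis"
      then have "A \<inter> X i \<in> null_sets M" for i
        using A assms(1) X emeasure_eq_ennreal_measure[of M "A \<inter> X i"]
        by (auto simp: null_sets_def) (metis emeasure_mono inf_le2 range_subsetD top.extremum_unique)
      then have "(\<Union>i. A \<inter> X i) \<in> null_sets M" by (intro null_sets_UN)
      moreover have "(\<Union>i. A \<inter> X i) = A" using X sets.sets_into_space[OF assms(1)[OF A]] by auto
      ultimately show False using assms(2)[OF A] by (auto simp: null_sets_def)
    qed
    then show "A \<in> (\<Union>i. {A \<in> \<F>. measure M (A \<inter> X i) \<noteq> 0})" using A by auto
  qed
  then show ?thesis using c by (meson countable_UN countableI_type countable_subset)
qed

text \<open>The value is unspecified off the union of the pieces and where pieces overlap; the uses
  concern points of disjoint families.\<close>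

definition glue :: "('i \<Rightarrow> 'a set) \<Rightarrow> ('i \<Rightarrow> 'a \<Rightarrow> 'b) \<Rightarrow> 'a \<Rightarrow> 'b" where
  "glue A f x = f (THE i. x \<in> A i) x"

lemma glue_eq: "disjoint_family A \<Longrightarrow> x \<in> A i \<Longrightarrow> glue A f x = f i x"
  unfolding glue_def
  by (rule arg_cong[of _ _ "\<lambda>i. f i x"], rule the_equality) (auto simp: disjoint_family_on_def)

text \<open>The domains \<open>D i\<close> may be smaller than the pieces because isomorphisms are
  given only up to null sets. Disjoint targets allow the index to be recovered from the value, which
  yields injectivity.\<close>

lemma inj_on_glue:
  assumes "disjoint_family A" "disjoint_family B" "\<And>i. D i \<subseteq> A i" "\<And>i. f i ` D i \<subseteq> B i"
    "\<And>i. inj_on (f i) (D i)"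
  shows "inj_on (glue A f) (\<Union>i. D i)" "glue A f ` (\<Union>i. D i) = (\<Union>i. f i ` D i)"
proof -
  have eq: "glue A f x = f i x" if "x \<in> D i" for x i using that assms(1,3) by (auto intro: glue_eq)
  show "inj_on (glue A f) (\<Union>i. D i)"
  proof (rule inj_onI)
    fix x y assume "x \<in> (\<Union>i. D i)" "y \<in> (\<Union>i. D i)" and e: "glue A f x = glue A f y"
    then obtain i j where ij: "x \<in> D i" "y \<in> D j" by auto
    then have "f i x = f j y" using eq e by auto
    moreover have "f i x \<in> B i" "f j y \<in> B j" using assms(4)[of i] assms(4)[of j] ij by auto
    ultimately have "f i x \<in> B i" "f i x \<in> B j" "f i x = f j y" by auto
    then have "i = j" using assms(2) by (auto simp: disjoint_family_on_def)
    then show "x = y" using ij eq e assms(5)[of i] by (auto simp: inj_on_def)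
  qed
  show "glue A f ` (\<Union>i. D i) = (\<Union>i. f i ` D i)" using eq by force
qed

text \<open>Elements are bijections of the whole type that are the identity off the space, so
  inverse and composition carry no domain conditions. The last assumption is where standard Borel
  spaces enter, through \<open>sets_neq\<close>.\<close>

locale mp_group =
  fixes M :: "'a measure" and H :: "('a \<Rightarrow> 'a) set"
  assumes sf: "sigma_finite_measure M"
    and bij: "T \<in> H \<Longrightarrow> bij T"
    and off: "T \<in> H \<Longrightarrow> x \<notin> space M \<Longrightarrow> T x = x"
    and img: "T \<in> H \<Longrightarrow> A \<in> sets M \<Longrightarrow> T ` A \<in> sets M"
    and emi: "T \<in> H \<Longrightarrow> A \<in> sets M \<Longrightarrow> emeasure M (T ` A) = emeasure M A"
    and one: "id \<in> H" and comp: "S \<in> H \<Longrightarrow> T \<in> H \<Longrightarrow> S \<circ> T \<in> H" and invc: "T \<in> H \<Longrightarrow> finv T \<in> H"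
    and neq: "S \<in> H \<Longrightarrow> T \<in> H \<Longrightarrow> {x\<in>space M. S x \<noteq> T x} \<in> sets M"
begin

sublocale sigma_finite_measure M by (rule sf)

text \<open>This says that the image of \<open>P\<close> is \<open>Q\<close> modulo null sets
  (\<open>sends_iff_null\<close>). The pointwise form combines directly with other almost everywhere
  statements.\<close>

definition sends :: "('a \<Rightarrow> 'a) \<Rightarrow> 'a set \<Rightarrow> 'a set \<Rightarrow> bool" where
  "sends T P Q \<longleftrightarrow> (AE x in M. x \<in> P \<longleftrightarrow> T x \<in> Q)"

definition fx :: "('a \<Rightarrow> 'a) \<Rightarrow> 'a set \<Rightarrow> bool" where
  "fx T A \<longleftrightarrow> (AE x in M. x \<in> A \<longrightarrow> T x = x)"

lemma injH: "T \<in> H \<Longrightarrow> T x = T y \<longleftrightarrow> x = y"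
  using bij by (auto simp: bij_def inj_def)

lemma invL [simp]: "T \<in> H \<Longrightarrow> finv T (T x) = x" using bij by (simp add: bij_def)
lemma invR [simp]: "T \<in> H \<Longrightarrow> T (finv T x) = x" using bij by (simp add: bij_def surj_f_inv_f)
lemma inv_invH [simp]: "T \<in> H \<Longrightarrow> finv (finv T) = T" using bij by (simp add: inv_inv_eq)
lemma inv_eqI: "T \<in> H \<Longrightarrow> T x = y \<Longrightarrow> finv T y = x" by auto

lemma image_inv: "T \<in> H \<Longrightarrow> finv T ` A = T -` A" 
  by (simp add: bij_vimage_eq_inv_image[OF bij])

lemma vimage_inv: "T \<in> H \<Longrightarrow> finv T -` A = T ` A"
  using image_inv[of "finv T"] invc by simp

lemma img': "T \<in> H \<Longrightarrow> A \<in> sets M \<Longrightarrow> T -` A \<in> sets M"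
  using img[OF invc] image_inv by metis

lemma emi': "T \<in> H \<Longrightarrow> A \<in> sets M \<Longrightarrow> emeasure M (T -` A) = emeasure M A"
  using emi[OF invc] image_inv by metis

lemma spaceH: "T \<in> H \<Longrightarrow> T x \<in> space M \<longleftrightarrow> x \<in> space M"
  by (metis off injH)

lemma null_img: "T \<in> H \<Longrightarrow> N \<in> null_sets M \<Longrightarrow> T ` N \<in> null_sets M"
  by (auto simp: null_sets_def img emi)

lemma null_img': "T \<in> H \<Longrightarrow> N \<in> null_sets M \<Longrightarrow> T -` N \<in> null_sets M"
  by (auto simp: null_sets_def img' emi')

lemma AE_H:
  assumes T: "T \<in> H" and P: "AE x in M. P x"
  shows "AE x in M. P (T x)"
proof -
  obtain N where N: "N \<in> null_sets M" "{x\<in>space M. \<not> P x} \<subseteq> N"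
    using P by (auto simp: eventually_ae_filter)
  show ?thesis
    by (rule AE_I'[OF null_img'[OF T N(1)]]) (use N(2) spaceH[OF T] in auto)
qed

lemma sends_iff_null:
  assumes "T \<in> H" "P \<in> sets M" "Q \<in> sets M"
  shows "sends T P Q \<longleftrightarrow> sym_diff (T ` P) Q \<in> null_sets M"
proof -
  have eq: "sym_diff (T ` P) Q = T ` {x\<in>space M. \<not> (x \<in> P \<longleftrightarrow> T x \<in> Q)}"
  proof (rule Set.set_eqI)
    fix y
    obtain x where "y = T x" using invR[OF assms(1)] by metis
    then show "y \<in> sym_diff (T ` P) Q \<longleftrightarrow> y \<in> T ` {x\<in>space M. \<not> (x \<in> P \<longleftrightarrow> T x \<in> Q)}"
      using sets.sets_into_space[OF assms(2)] sets.sets_into_space[OF assms(3)] spaceH[OF assms(1), of x]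
      by (auto simp: inj_image_mem_iff[OF bij_is_inj[OF bij[OF assms(1)]]])
  qed
  have ms: "{x\<in>space M. \<not> (x \<in> P \<longleftrightarrow> T x \<in> Q)} \<in> sets M"
  proof -
    have "{x\<in>space M. \<not> (x \<in> P \<longleftrightarrow> T x \<in> Q)} = sym_diff P (T -` Q)"
      using sets.sets_into_space[OF assms(2)] sets.sets_into_space[OF img'[OF assms(1,3)]] by auto
    then show ?thesis using assms img' by auto
  qed
  have "sends T P Q \<longleftrightarrow> {x\<in>space M. \<not> (x \<in> P \<longleftrightarrow> T x \<in> Q)} \<in> null_sets M"
    unfolding sends_def by (rule AE_iff_null[OF ms])
  also have "\<dots> \<longleftrightarrow> T ` {x\<in>space M. \<not> (x \<in> P \<longleftrightarrow> T x \<in> Q)} \<in> null_sets M"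
    using ms assms(1) by (auto simp: null_sets_def img emi)
  finally show ?thesis by (simp only: eq)
qed

section \<open>The pseudogroup of countably piecewise maps\<close>

definition pieces :: "('a \<Rightarrow> 'a) \<Rightarrow> 'a set \<Rightarrow> ('a set \<times> ('a \<Rightarrow> 'a)) set \<Rightarrow> bool" where
  "pieces \<phi> D K \<longleftrightarrow> countable K \<and> D = (\<Union>p\<in>K. fst p) \<and>
     (\<forall>p\<in>K. fst p \<in> sets M \<and> snd p \<in> H \<and> (\<forall>x\<in>fst p. \<phi> x = snd p x))"

text \<open>Membership in the pseudogroup generated by \<open>H\<close>, injectivity being asked for
  separately. The pieces may overlap: \<open>\<phi>\<close> is a given function, so no compatibility
  between them has to be imposed.\<close>

definition pw :: "('a \<Rightarrow> 'a) \<Rightarrow> 'a set \<Rightarrow> bool" where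
  "pw \<phi> D \<longleftrightarrow> (\<exists>K. pieces \<phi> D K)"

lemma piecesD:
  assumes "pieces \<phi> D K"
  shows "countable K" "D = (\<Union>p\<in>K. fst p)" "\<And>p. p \<in> K \<Longrightarrow> fst p \<in> sets M"
    "\<And>p. p \<in> K \<Longrightarrow> snd p \<in> H" "\<And>p x. p \<in> K \<Longrightarrow> x \<in> fst p \<Longrightarrow> \<phi> x = snd p x"
  using assms unfolding pieces_def by blast+

lemma pwI:
  assumes "countable I" "D = (\<Union>i\<in>I. C i)" "\<And>i. i \<in> I \<Longrightarrow> C i \<in> sets M" "\<And>i. i \<in> I \<Longrightarrow> T i \<in> H"
    "\<And>i x. i \<in> I \<Longrightarrow> x \<in> C i \<Longrightarrow> \<phi> x = T i x"
  shows "pw \<phi> D"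
  unfolding pw_def pieces_def using assms by (intro exI[of _ "(\<lambda>i. (C i, T i)) ` I"]) auto

lemma pw_sets: "pw \<phi> D \<Longrightarrow> D \<in> sets M"
  unfolding pw_def pieces_def by (auto intro!: sets.countable_UN')

lemma pw_H: "T \<in> H \<Longrightarrow> D \<in> sets M \<Longrightarrow> pw T D"
  by (rule pwI[of "{()}" _ "\<lambda>_. D" "\<lambda>_. T"]) auto

lemma pw_cong: "pw \<phi> D \<Longrightarrow> (\<And>x. x \<in> D \<Longrightarrow> \<psi> x = \<phi> x) \<Longrightarrow> pw \<psi> D"
  unfolding pw_def pieces_def by (elim exE conjE, rename_tac K, rule_tac x=K in exI) (metis UN_I)

lemma pw_sub:
  assumes "pw \<phi> D" "E \<in> sets M" "E \<subseteq> D"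
  shows "pw \<phi> E"
proof -
  from assms(1) obtain K where "pieces \<phi> D K" unfolding pw_def by blast
  note K = piecesD[OF this]
  show ?thesis
    by (rule pwI[of K _ "\<lambda>p. fst p \<inter> E" snd]) (use K assms in auto)
qed

lemma pw_UN:
  assumes "countable I" "\<And>i. i \<in> I \<Longrightarrow> pw \<phi> (D i)"
  shows "pw \<phi> (\<Union>i\<in>I. D i)"
proof -
  have "\<forall>i\<in>I. \<exists>K. countable K \<and> D i = (\<Union>p\<in>K. fst p) \<and>
     (\<forall>p\<in>K. fst p \<in> sets M \<and> snd p \<in> H \<and> (\<forall>x\<in>fst p. \<phi> x = snd p x))"
    using assms(2) unfolding pw_def pieces_def by auto
  then obtain K where K: "\<And>i. i \<in> I \<Longrightarrow> countable (K i) \<and> D i = (\<Union>p\<in>K i. fst p) \<and>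
     (\<forall>p\<in>K i. fst p \<in> sets M \<and> snd p \<in> H \<and> (\<forall>x\<in>fst p. \<phi> x = snd p x))"
    by metis
  show ?thesis
    by (rule pwI[of "\<Union>i\<in>I. K i" _ fst snd]) (use K assms(1) in auto)
qed

lemma pw_Un: "pw \<phi> D \<Longrightarrow> pw \<phi> E \<Longrightarrow> pw \<phi> (D \<union> E)"
  using pw_UN[of "{D, E}" \<phi> "\<lambda>b. b"] by auto

lemma pw_comp:
  assumes "pw \<phi> D" "pw \<psi> E" "\<phi> ` D \<subseteq> E"
  shows "pw (\<lambda>x. \<psi> (\<phi> x)) D"
proof -
  from assms(1) obtain K where "pieces \<phi> D K" unfolding pw_def by blast
  note K = piecesD[OF this]
  from assms(2) obtain L where "pieces \<psi> E L" unfolding pw_def by blast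
  note L = piecesD[OF this]
  show ?thesis
  proof (rule pwI[of "K \<times> L" _ "\<lambda>(p,q). fst p \<inter> snd p -` fst q" "\<lambda>(p,q). snd q \<circ> snd p"])
    show "D = (\<Union>i\<in>K \<times> L. case i of (p, q) \<Rightarrow> fst p \<inter> snd p -` fst q)"
    proof (intro equalityI subsetI)
      fix x assume "x \<in> D"
      then obtain p where p: "p \<in> K" "x \<in> fst p" using K(2) by auto
      have "\<phi> x \<in> E" using \<open>x \<in> D\<close> assms(3) by auto
      then obtain q where q: "q \<in> L" "snd p x \<in> fst q" using L(2) K(5)[OF p] by auto
      show "x \<in> (\<Union>i\<in>K \<times> L. case i of (p, q) \<Rightarrow> fst p \<inter> snd p -` fst q)"
        by (rule UN_I[of "(p, q)"]) (use p q in auto)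
    qed (use K(2) in auto)
  qed (use K L in \<open>auto intro!: img' comp sets.Int\<close>)
qed

lemma pw_img: assumes "pw \<phi> D" shows "\<phi> ` D \<in> sets M"
proof -
  from assms(1) obtain K where "pieces \<phi> D K" unfolding pw_def by blast
  note K = piecesD[OF this]
  have "\<phi> ` D = (\<Union>p\<in>K. snd p ` fst p)" using K(2,5) by force
  then show ?thesis using K img by auto
qed

lemma pw_vimage: assumes "pw \<phi> D" "E \<in> sets M" shows "{x\<in>D. \<phi> x \<in> E} \<in> sets M"
proof -
  from assms(1) obtain K where "pieces \<phi> D K" unfolding pw_def by blast
  note K = piecesD[OF this]
  have "{x\<in>D. \<phi> x \<in> E} = (\<Union>p\<in>K. fst p \<inter> snd p -` E)" using K(2,5) by force
  then show ?thesis using K img' assms by auto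
qed

lemma pw_inv:
  assumes "pw \<phi> D" "inj_on \<phi> D" shows "pw (inv_into D \<phi>) (\<phi> ` D)"
proof -
  from assms(1) obtain K where "pieces \<phi> D K" unfolding pw_def by blast
  note K = piecesD[OF this]
  show ?thesis
  proof (rule pwI[of K _ "\<lambda>p. snd p ` fst p" "\<lambda>p. finv (snd p)"])
    show "\<phi> ` D = (\<Union>p\<in>K. snd p ` fst p)" using K(2,5) by force
    fix p x assume p: "p \<in> K" "x \<in> snd p ` fst p"
    then obtain y where y: "y \<in> fst p" "x = snd p y" by auto
    then have "x = \<phi> y" "y \<in> D" using K p by auto
    then show "inv_into D \<phi> x = finv (snd p) x" using assms(2) y K(4)[OF p(1)] by (metis inv_into_f_f invL)
  qed (use K img invc in auto)
qed

lemma pw_emeasure: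
  assumes "pw \<phi> D" "inj_on \<phi> D" shows "emeasure M (\<phi> ` D) = emeasure M D"
proof (cases "D = {}")
  case False
  from assms(1) obtain K where "pieces \<phi> D K" unfolding pw_def by blast
  note K = piecesD[OF this]
  then have "K \<noteq> {}" using False by auto
  define p where "p = from_nat_into K"
  have pK: "p n \<in> K" for n using \<open>K \<noteq> {}\<close> by (simp add: p_def from_nat_into)
  have rp: "range p = K" using \<open>K \<noteq> {}\<close> K(1) by (simp add: p_def range_from_nat_into)
  \<comment> \<open>The pieces may overlap. Making them disjoint keeps each one inside an original
    piece, so the same element of \<open>H\<close> still represents \<open>\<phi>\<close> on
    it.\<close>
  define E where "E = disjointed (\<lambda>n. fst (p n))"
  have "range (\<lambda>n. fst (p n)) \<subseteq> sets M" using pK K(3) by blast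
  from sets.range_disjointed_sets[OF this] have E: "E n \<in> sets M" "E n \<subseteq> fst (p n)" for n
    using disjointed_subset[of "\<lambda>n. fst (p n)"] by (auto simp: E_def)
  have D: "D = (\<Union>n. E n)"
    unfolding E_def UN_disjointed_eq K(2) rp[symmetric] by simp
  have dj: "disjoint_family E" unfolding E_def by (rule disjoint_family_disjointed)
  have im: "\<phi> ` E n = snd (p n) ` E n" for n
    using E(2)[of n] K(5)[OF pK] by (intro image_cong) auto
  have dj': "disjoint_family (\<lambda>n. \<phi> ` E n)"
    unfolding disjoint_family_on_def
  proof (intro ballI impI)
    fix m n :: nat assume "m \<noteq> n"
    then have "\<phi> ` E m \<inter> \<phi> ` E n = \<phi> ` (E m \<inter> E n)" using D by (intro inj_on_image_Int[OF assms(2), symmetric]) auto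
    then show "\<phi> ` E m \<inter> \<phi> ` E n = {}" using dj \<open>m \<noteq> n\<close> by (auto simp: disjoint_family_on_def)
  qed
  have "emeasure M (\<phi> ` D) = emeasure M (\<Union>n. \<phi> ` E n)" by (simp add: D image_UN)
  also have "\<dots> = (\<Sum>n. emeasure M (\<phi> ` E n))"
    using E K(4)[OF pK] dj' by (intro suminf_emeasure[symmetric]) (auto simp: im img)
  also have "\<dots> = (\<Sum>n. emeasure M (E n))" by (simp add: im emi E K(4)[OF pK])
  also have "\<dots> = emeasure M D" using E dj by (simp add: D suminf_emeasure image_subset_iff)
  finally show ?thesis .
qed simp

lemma pw_null:
  assumes "pw \<phi> D" "N \<in> null_sets M" shows "\<phi> ` (N \<inter> D) \<in> null_sets M" "{x\<in>D. \<phi> x \<in> N} \<in> null_sets M"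
proof -
  from assms(1) obtain K where "pieces \<phi> D K" unfolding pw_def by blast
  note K = piecesD[OF this]
  have "(\<Union>p\<in>K. snd p ` (N \<inter> fst p)) \<in> null_sets M"
    by (rule null_sets_UN'[OF K(1)]) (rule null_img[OF K(4)], assumption, rule null_set_Int2[OF assms(2) K(3)])
  moreover have "\<phi> ` (N \<inter> fst p) = snd p ` (N \<inter> fst p)" if "p \<in> K" for p
    using K(5)[OF that] by (intro image_cong) auto
  then have "\<phi> ` (N \<inter> D) = (\<Union>p\<in>K. snd p ` (N \<inter> fst p))" unfolding K(2) by blast
  ultimately show "\<phi> ` (N \<inter> D) \<in> null_sets M" by simp
  have "(\<Union>p\<in>K. fst p \<inter> snd p -` N) \<in> null_sets M"
    by (rule null_sets_UN'[OF K(1)]) (rule null_set_Int1[OF null_img'[OF K(4) assms(2)] K(3)])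
  moreover have "{x\<in>D. \<phi> x \<in> N} = (\<Union>p\<in>K. fst p \<inter> snd p -` N)" using K(2,5) by force
  ultimately show "{x\<in>D. \<phi> x \<in> N} \<in> null_sets M" by simp
qed

end

section \<open>Ergodicity and the comparison of sets\<close>

locale ergodic_full = mp_group +
  assumes inf: "emeasure M (space M) = \<infinity>"
    and paste: "bij T \<Longrightarrow> (\<And>x. x \<notin> space M \<Longrightarrow> T x = x) \<Longrightarrow> countable K \<Longrightarrow>
       (\<And>C S. (C,S) \<in> K \<Longrightarrow> C \<in> sets M \<and> S \<in> H \<and> (\<forall>x\<in>C. T x = S x)) \<Longrightarrow>
       space M \<subseteq> (\<Union>p\<in>K. fst p) \<Longrightarrow> T \<in> H"
    and erg: "A \<in> sets M \<Longrightarrow> (\<And>T. T \<in> H \<Longrightarrow> sym_diff (T ` A) A \<in> null_sets M) \<Longrightarrow>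
       A \<in> null_sets M \<or> space M - A \<in> null_sets M"
begin

text \<open>By ergodicity the saturation of \<open>A\<close> is conull, hence meets
  \<open>B\<close>. A union over all of \<open>H\<close> could be uncountable, so the saturation is
  built as the union of a maximal disjoint family of nonnull subsets of translates: it is countable
  and contains every translate up to a null set.\<close>

lemma nonnull_meets:
  assumes A: "A \<in> sets M" "emeasure M A \<noteq> 0" and B: "B \<in> sets M" "emeasure M B \<noteq> 0"
  obtains T where "T \<in> H" "emeasure M (T ` A \<inter> B) \<noteq> 0"
proof -
  let ?S = "{C. C \<in> sets M \<and> emeasure M C \<noteq> 0 \<and> (\<exists>T\<in>H. C \<subseteq> T ` A)}"
  obtain F where F: "F \<subseteq> ?S" "pairwise disjnt F"
    and mx: "\<And>p. p \<in> ?S \<Longrightarrow> (\<And>q. q \<in> F \<Longrightarrow> disjnt p q) \<Longrightarrow> p \<in> F"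
    by (rule maximal_pairwise[of disjnt ?S]) (auto simp: disjnt_sym)
  have cF: "countable F" by (rule countable_disjoint_nonnull) (use F in auto)
  let ?Y = "\<Union>F"
  have Y: "?Y \<in> sets M" using cF F by auto
  have sub: "T ` A - ?Y \<in> null_sets M" if T: "T \<in> H" for T
  proof (rule ccontr)
    assume n: "\<not> ?thesis"
    have m: "T ` A - ?Y \<in> sets M" using img[OF T A(1)] Y by auto
    have "T ` A - ?Y \<in> F"
      by (rule mx) (use n m T in \<open>auto simp: null_sets_def disjnt_def\<close>)
    then have "T ` A - ?Y = {}" by auto
    then show False using n by (metis null_sets.empty_sets)
  qed
  have inv1: "T ` ?Y - ?Y \<in> null_sets M" if T: "T \<in> H" for T
  proof -
    have "T ` C - ?Y \<in> null_sets M" if C: "C \<in> F" for C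
    proof -
      obtain S where S: "S \<in> H" "C \<subseteq> S ` A" using F(1) C by auto
      have "T ` C - ?Y \<subseteq> (T \<circ> S) ` A - ?Y" using S(2) by auto
      moreover have "T ` C - ?Y \<in> sets M" using F(1) C Y img[OF T] by auto
      ultimately show ?thesis using sub[OF comp[OF T S(1)]] by (meson null_sets_subset)
    qed
    then have "(\<Union>C\<in>F. T ` C - ?Y) \<in> null_sets M" using cF by (intro null_sets_UN') auto
    moreover have "(\<Union>C\<in>F. T ` C - ?Y) = T ` ?Y - ?Y" by auto
    ultimately show ?thesis by simp
  qed
  have "sym_diff (T ` ?Y) ?Y \<in> null_sets M" if T: "T \<in> H" for T
  proof -
    \<comment> \<open>The other inclusion for \<open>T\<close> is the image under \<open>T\<close>
      of the inclusion already known for its inverse.\<close>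
    have "T ` (finv T ` ?Y - ?Y) = ?Y - T ` ?Y"
      by (simp add: image_set_diff[OF bij_is_inj[OF bij[OF T]]] image_comp comp_def T)
    then show ?thesis
      using inv1[OF T] null_img[OF T inv1[OF invc[OF T]]] by auto
  qed
  then consider "?Y \<in> null_sets M" | "space M - ?Y \<in> null_sets M" using erg[OF Y] by blast
  then show ?thesis
  proof cases
    case 1
    have "id ` A - ?Y \<in> null_sets M" by (rule sub[OF one])
    then have "(id ` A - ?Y) \<union> ?Y \<in> null_sets M" using 1 by (rule null_sets.Un)
    then have "A \<in> null_sets M" by (rule null_sets_subset) (use A in auto)
    then show ?thesis using A by (auto simp: null_sets_def)
  next
    case 2
    have "\<exists>C\<in>F. emeasure M (C \<inter> B) \<noteq> 0"
    proof (rule ccontr)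
      assume n: "\<not> ?thesis"
      have "(\<Union>C\<in>F. C \<inter> B) \<in> null_sets M"
        using n F(1) B cF by (intro null_sets_UN') (auto simp: null_sets_def)
      then have "(\<Union>C\<in>F. C \<inter> B) \<union> (space M - ?Y) \<in> null_sets M" using 2 by (rule null_sets.Un)
      then have "B \<in> null_sets M"
        by (rule null_sets_subset) (use B sets.sets_into_space[OF B(1)] in auto)
      then show False using B by (auto simp: null_sets_def)
    qed
    then obtain C where C: "C \<in> F" "emeasure M (C \<inter> B) \<noteq> 0" by auto
    then obtain T where T: "T \<in> H" "C \<subseteq> T ` A" using F(1) by auto
    have "emeasure M (C \<inter> B) \<le> emeasure M (T ` A \<inter> B)"
      using T A B img by (intro emeasure_mono) auto
    then show ?thesis using that[OF T(1)] C(2) by (metis le_zero_eq)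
  qed
qed

text \<open>Pasting demands a genuine bijection and pieces that cover the whole space exactly. Maps
  given only almost everywhere must therefore be corrected on a null set first, as in
  \<open>piso_realize\<close>.\<close>

lemma pw_paste:
  assumes "bij T" "\<And>x. x \<notin> space M \<Longrightarrow> T x = x" "pw T (space M)" shows "T \<in> H"
proof -
  from assms(3) obtain K where "pieces T (space M) K" unfolding pw_def by blast
  note K = piecesD[OF this]
  show ?thesis by (rule paste[OF assms(1,2) K(1)]) (use K in force)+
qed

definition pinj :: "('a \<Rightarrow> 'a) \<Rightarrow> 'a set \<Rightarrow> 'a set \<Rightarrow> 'a set \<Rightarrow> bool" where
  "pinj \<phi> D A B \<longleftrightarrow> A \<in> sets M \<and> B \<in> sets M \<and> pw \<phi> D \<and> inj_on \<phi> D \<and> D \<subseteq> A \<and> \<phi> ` D \<subseteq> B"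

text \<open>An isomorphism from \<open>A\<close> to \<open>B\<close> modulo null sets. The exact
  domain is hidden under the quantifier, since constructions keep changing it by null sets.\<close>

definition piso :: "('a \<Rightarrow> 'a) \<Rightarrow> 'a set \<Rightarrow> 'a set \<Rightarrow> bool" where
  "piso \<phi> A B \<longleftrightarrow> (\<exists>D. pinj \<phi> D A B \<and> A - D \<in> null_sets M \<and> B - \<phi> ` D \<in> null_sets M)"

text \<open>Comparison by exhaustion: take a maximal family of pairs with disjoint domains and
  disjoint images. If both remainders were nonnull, \<open>nonnull_meets\<close> would carry part of
  one into the other, and this further pair would contradict maximality.\<close>

lemma ex_maximal_pinj:
  assumes "A \<in> sets M" "B \<in> sets M"
  obtains \<phi> D where "pinj \<phi> D A B" "A - D \<in> null_sets M \<or> B - \<phi> ` D \<in> null_sets M"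
proof -
  let ?S = "{(C, T). C \<in> sets M \<and> C \<subseteq> A \<and> T \<in> H \<and> T ` C \<subseteq> B \<and> emeasure M C \<noteq> 0}"
  let ?R = "\<lambda>p q. disjnt (fst p) (fst q) \<and> disjnt (snd p ` fst p) (snd q ` fst q)"
  obtain F where F: "F \<subseteq> ?S" "pairwise ?R F"
    and mx: "\<And>p. p \<in> ?S \<Longrightarrow> (\<And>q. q \<in> F \<Longrightarrow> ?R p q) \<Longrightarrow> p \<in> F"
    by (rule maximal_pairwise[of ?R ?S]) (auto simp: disjnt_sym)
  have FD: "C \<in> sets M" "C \<subseteq> A" "T \<in> H" "T ` C \<subseteq> B" "emeasure M C \<noteq> 0" if "(C,T) \<in> F" for C T
    using that F(1) by auto
  have F1: "p = q" if "p \<in> F" "q \<in> F" "x \<in> fst p" "x \<in> fst q" for p q x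
    using pairwiseD[OF F(2) that(1,2)] that(3,4) unfolding disjnt_iff by blast
  have F2: "p = q" if "p \<in> F" "q \<in> F" "x \<in> snd p ` fst p" "x \<in> snd q ` fst q" for p q x
    using pairwiseD[OF F(2) that(1,2)] that(3,4) unfolding disjnt_iff by blast
  \<comment> \<open>\<open>countable_disjoint_nonnull\<close> speaks about sets; distinct pairs have
    disjoint nonnull domains, so countability passes back from the domains to the pairs.\<close>
  have injF: "inj_on fst F"
  proof (rule inj_onI, rule ccontr)
    fix p q assume pq: "p \<in> F" "q \<in> F" "fst p = fst q" "p \<noteq> q"
    then have "disjnt (fst p) (fst q)" using pairwiseD[OF F(2) pq(1,2,4)] by simp
    then have "fst p = {}" using pq(3) by (simp add: disjnt_def)
    moreover have "emeasure M (fst p) \<noteq> 0" by (rule FD(5)[of _ "snd p"]) (simp add: pq(1))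
    ultimately show False by simp
  qed
  have "countable (fst ` F)"
  proof (rule countable_disjoint_nonnull)
    show "pairwise disjnt (fst ` F)" using F(2) by (auto simp: pairwise_def)
  qed (use FD in auto)
  then have cF: "countable F" using countable_image_inj_on injF by blast
  define D where "D = (\<Union>p\<in>F. fst p)"
  define \<phi> where "\<phi> x = snd (THE p. p \<in> F \<and> x \<in> fst p) x" for x
  have \<phi>: "\<phi> x = snd p x" if "p \<in> F" "x \<in> fst p" for p x
  proof -
    have "(THE p. p \<in> F \<and> x \<in> fst p) = p"
      by (rule the_equality) (use that F1 in blast)+
    then show ?thesis by (simp add: \<phi>_def)
  qed
  have pw: "pw \<phi> D"
    by (rule pwI[OF cF D_def]) (use FD \<phi> in auto)
  have inj: "inj_on \<phi> D"
  proof (rule inj_onI)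
    fix x y assume "x \<in> D" "y \<in> D" and e: "\<phi> x = \<phi> y"
    then obtain p q where pq: "p \<in> F" "x \<in> fst p" "q \<in> F" "y \<in> fst q" by (auto simp: D_def)
    then have "snd p x = snd q y" using \<phi> e by auto
    then have "p = q" using F2[OF pq(1,3), of "\<phi> x"] pq by (metis \<phi> imageI)
    moreover have "snd p \<in> H" by (rule FD(3)[of "fst p"]) (simp add: pq(1))
    ultimately show "x = y" using \<open>snd p x = snd q y\<close> injH by auto
  qed
  have im: "\<phi> ` D = (\<Union>p\<in>F. snd p ` fst p)" using \<phi> unfolding D_def by force
  have FA: "fst p \<subseteq> A" "snd p ` fst p \<subseteq> B" if "p \<in> F" for p
    using FD(2)[of "fst p" "snd p"] FD(4)[of "fst p" "snd p"] that by simp_all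
  have sub: "D \<subseteq> A" unfolding D_def using FA(1) by blast
  have sub': "\<phi> ` D \<subseteq> B" unfolding im using FA(2) by blast
  have "A - D \<in> null_sets M \<or> B - \<phi> ` D \<in> null_sets M"
  proof (rule ccontr)
    assume n: "\<not> ?thesis"
    have m: "A - D \<in> sets M" "B - \<phi> ` D \<in> sets M" using assms pw pw_sets pw_img by auto
    obtain T where T: "T \<in> H" "emeasure M (T ` (A - D) \<inter> (B - \<phi> ` D)) \<noteq> 0"
      by (rule nonnull_meets[OF m(1) _ m(2)]) (use n m in \<open>auto simp: null_sets_def\<close>)
    let ?C = "(A - D) \<inter> T -` (B - \<phi> ` D)"
    have Tm: "T ` ?C = T ` (A - D) \<inter> (B - \<phi> ` D)" by auto
    have Cm: "?C \<in> sets M" using m img' T by auto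
    have C0: "emeasure M ?C \<noteq> 0" using emi[OF T(1) Cm] T(2) unfolding Tm by simp
    have "(?C, T) \<in> F"
    proof (rule mx)
      show "(?C, T) \<in> ?S" using Cm C0 T by auto
      fix q assume q: "q \<in> F"
      have "fst q \<subseteq> D" unfolding D_def using q by blast
      moreover have "snd q ` fst q \<subseteq> \<phi> ` D" unfolding im using q by blast
      ultimately show "?R (?C, T) q" by (auto simp: disjnt_iff)
    qed
    then have "?C \<subseteq> D" by (auto simp: D_def)
    then have "?C = {}" by auto
    then show False using C0 by (metis emeasure_empty)
  qed
  then show ?thesis using that[of \<phi> D] assms pw inj sub sub' by (auto simp: pinj_def)
qed


lemma pisoI:
  assumes "A \<in> sets M" "B \<in> sets M" "pw \<phi> D" "inj_on \<phi> D" "D \<subseteq> A" "\<phi> ` D \<subseteq> B"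
    "A - D \<in> null_sets M" "B - \<phi> ` D \<in> null_sets M"
  shows "piso \<phi> A B"
  using assms unfolding piso_def pinj_def by blast

lemma pisoD:
  assumes "piso \<phi> A B"
  shows "A \<in> sets M" "B \<in> sets M"
    "\<exists>D. pw \<phi> D \<and> inj_on \<phi> D \<and> D \<subseteq> A \<and> \<phi> ` D \<subseteq> B \<and> A - D \<in> null_sets M \<and> B - \<phi> ` D \<in> null_sets M"
  using assms unfolding piso_def pinj_def by blast+

lemma emeasure_null_diff:
  assumes "A \<in> sets M" "D \<in> sets M" "D \<subseteq> A" "A - D \<in> null_sets M"
  shows "emeasure M D = emeasure M A"
proof -
  have "emeasure M A = emeasure M (A - (A - D))" using assms by (intro emeasure_Diff_null_set[symmetric])
  also have "A - (A - D) = D" using assms by auto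
  finally show ?thesis ..
qed

lemma pinj_emeasure: "pinj \<phi> D A B \<Longrightarrow> emeasure M (\<phi> ` D) = emeasure M D"
  by (auto simp: pinj_def intro: pw_emeasure)

lemma piso_emeasure: "piso \<phi> A B \<Longrightarrow> emeasure M A = emeasure M B"
  unfolding piso_def
  by (metis emeasure_null_diff pinj_def pinj_emeasure pw_img pw_sets)

text \<open>Exhausting \<open>B\<close> instead would give it the measure of a subset of
  \<open>A\<close>, which is finite.\<close>

lemma ex_pinj_finite:
  assumes "A \<in> sets M" "B \<in> sets M" "emeasure M A < \<infinity>" "emeasure M B = \<infinity>"
  shows "\<exists>\<phi> D. pinj \<phi> D A B \<and> A - D \<in> null_sets M"
proof -
  obtain \<phi> D where p: "pinj \<phi> D A B" "A - D \<in> null_sets M \<or> B - \<phi> ` D \<in> null_sets M"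
    using ex_maximal_pinj[OF assms(1,2)] .
  have "B - \<phi> ` D \<notin> null_sets M"
  proof
    assume "B - \<phi> ` D \<in> null_sets M"
    then have "emeasure M (\<phi> ` D) = emeasure M B"
      using p(1) by (intro emeasure_null_diff) (auto simp: pinj_def pw_img)
    moreover have "emeasure M (\<phi> ` D) = emeasure M D" "emeasure M D \<le> emeasure M A"
      using p(1) assms(1) by (auto simp: pinj_emeasure pinj_def intro: emeasure_mono)
    ultimately show False using assms(3,4) by auto
  qed
  then show ?thesis using p by auto
qed

section \<open>Subdividing sets of infinite measure\<close>

lemma ex_blocks:
  assumes "A \<in> sets M" "emeasure M A = \<infinity>"
  obtains Y :: "nat \<Rightarrow> 'a set" where "\<And>n. Y n \<in> sets M" "disjoint_family Y" "\<And>n. Y n \<subseteq> A"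
    "\<And>n. 1 \<le> emeasure M (Y n)" "\<And>n. emeasure M (Y n) < \<infinity>"
proof -
  let ?P = "\<lambda>n::nat. \<lambda>X. X \<in> sets M \<and> X \<subseteq> A \<and> emeasure M X < \<infinity>"
  let ?Q = "\<lambda>n::nat. \<lambda>X X'. X \<subseteq> X' \<and> 1 \<le> emeasure M (X' - X)"
  have "\<exists>X. \<forall>n. ?P n (X n) \<and> ?Q n (X n) (X (Suc n))"
  proof (rule dependent_nat_choice)
    show "\<exists>X. ?P 0 X" by (intro exI[of _ "{}"]) auto
    fix X and n :: nat assume X: "?P n X"
    have "emeasure M (A - X) = \<infinity>" 
      using emeasure_Diff[of M X A] X assms by (simp add: top.not_eq_extremum ennreal_top_minus)
    then obtain Z where Z: "Z \<in> sets M" "Z \<subseteq> A - X" "emeasure M Z < \<infinity>" "emeasure M Z > ennreal 1"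
      using approx_PInf_emeasure_with_finite[of "A - X" 1] X assms(1) by auto
    have "X \<union> Z - X = Z" using Z by auto
    moreover have "emeasure M (X \<union> Z) < \<infinity>"
      using emeasure_subadditive[of X M Z] X Z by (auto simp: less_top[symmetric] top_unique)
    ultimately show "\<exists>X'. ?P (Suc n) X' \<and> ?Q n X X'"
      using X Z by (intro exI[of _ "X \<union> Z"]) auto
  qed
  then obtain X where X: "\<And>n. X n \<in> sets M" "\<And>n. X n \<subseteq> A" "\<And>n. emeasure M (X n) < \<infinity>"
    "\<And>n. X n \<subseteq> X (Suc n)" "\<And>n. 1 \<le> emeasure M (X (Suc n) - X n)" by blast
  have inc: "incseq X" using X(4) by (rule incseq_SucI)
  show ?thesis
  proof (rule that[of "\<lambda>n. X (Suc n) - X n"])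
    show "disjoint_family (\<lambda>n. X (Suc n) - X n)"
      using X(4) by (rule disjoint_family_Suc)
    show "emeasure M (X (Suc n) - X n) < \<infinity>" for n
      using le_less_trans[OF emeasure_mono X(3)[of "Suc n"]] X(1)[of "Suc n"] by auto
  qed (use X in auto)
qed

text \<open>The lower bound 1 makes every infinite union of blocks infinite, while finite unions of
  the blocks from \<open>ex_blocks\<close> stay finite. Sets of indices thus control whether a
  measure is infinite.\<close>

lemma emeasure_UN_blocks:
  assumes "infinite I" "\<And>n. Y n \<in> sets M" "disjoint_family (Y :: nat \<Rightarrow> 'a set)" "\<And>n. 1 \<le> emeasure M (Y n)"
  shows "emeasure M (\<Union>i\<in>I. Y i) = \<infinity>"
proof -
  have "of_nat k \<le> emeasure M (\<Union>i\<in>I. Y i)" for k :: nat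
  proof -
    obtain F where F: "F \<subseteq> I" "finite F" "card F = k"
      using infinite_arbitrarily_large[OF assms(1)] by metis
    have "of_nat k = (\<Sum>i\<in>F. (1::ennreal))" using F by simp
    also have "\<dots> \<le> (\<Sum>i\<in>F. emeasure M (Y i))" by (rule sum_mono) (rule assms)
    also have "\<dots> = emeasure M (\<Union>i\<in>F. Y i)"
      using assms F by (intro sum_emeasure) (auto simp: disjoint_family_on_def)
    also have "\<dots> \<le> emeasure M (\<Union>i\<in>I. Y i)" using assms F by (intro emeasure_mono) auto
    finally show ?thesis .
  qed
  then show ?thesis
    by (metis ennreal_Ex_less_of_nat infinity_ennreal_def not_le top.not_eq_extremum)
qed

lemma split_infinite:
  assumes "A \<in> sets M" "emeasure M A = \<infinity>"
  obtains Z :: "nat \<Rightarrow> 'a set" where "\<And>n. Z n \<in> sets M" "disjoint_family Z" "(\<Union>n. Z n) = A"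
    "\<And>n. emeasure M (Z n) = \<infinity>"
proof -
  obtain Y :: "nat \<Rightarrow> 'a set" where Y: "\<And>n. Y n \<in> sets M" "disjoint_family Y" "\<And>n. Y n \<subseteq> A"
    "\<And>n. 1 \<le> emeasure M (Y n)" "\<And>n. emeasure M (Y n) < \<infinity>" using ex_blocks[OF assms] by metis
  define W where "W i = (\<Union>j\<in>range (\<lambda>j. prod_encode (i, j)). Y j)" for i
  have "inj (\<lambda>j. prod_encode (i, j))" for i by (auto simp: inj_def)
  then have ir: "infinite (range (\<lambda>j. prod_encode (i, j)))" for i using range_inj_infinite by blast
  have W: "W i \<in> sets M" "emeasure M (W i) = \<infinity>" "W i \<subseteq> A" for i
    using Y emeasure_UN_blocks[OF ir Y(1,2,4)] by (auto simp: W_def)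
  have dW: "disjoint_family W"
    unfolding disjoint_family_on_def
  proof (intro ballI impI)
    fix m n :: nat assume "m \<noteq> n"
    then have "Y (prod_encode (m, i)) \<inter> Y (prod_encode (n, j)) = {}" for i j
      using disjoint_family_onD[OF Y(2)] by simp
    then show "W m \<inter> W n = {}" unfolding W_def by blast
  qed
  \<comment> \<open>Besides \<open>W 0\<close>, the first set receives the part of \<open>A\<close>
    that lies in no block, so that the sets exhaust \<open>A\<close>.\<close>
  define Z where "Z n = (if n = 0 then A - (\<Union>i\<in>{0<..}. W i) else W n)" for n
  have "W 0 \<inter> W i = {}" if "i > 0" for i using disjoint_family_onD[OF dW, of 0 i] that by simp
  then have W0: "W 0 \<subseteq> Z 0" using W(3)[of 0] unfolding Z_def by (simp, blast)
  have Zm: "Z n \<in> sets M" for n using W assms by (auto simp: Z_def)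
  show ?thesis
  proof (rule that[of Z])
    show "disjoint_family Z" using dW unfolding disjoint_family_on_def Z_def by auto
    show "(\<Union>n. Z n) = A"
    proof (intro equalityI subsetI)
      fix x assume "x \<in> A"
      then have "x \<in> Z 0 \<or> (\<exists>i>0. x \<in> W i)" by (auto simp: Z_def)
      then show "x \<in> (\<Union>n. Z n)" by (metis UN_I UNIV_I Z_def less_not_refl)
    qed (use W(3) in \<open>auto simp: Z_def split: if_splits\<close>)
    show "emeasure M (Z n) = \<infinity>" for n
    proof (cases "n = 0")
      case True
      then show ?thesis using emeasure_mono[OF W0 Zm[of 0]] W(2)[of 0] by (simp add: top_unique)
    qed (use W in \<open>auto simp: Z_def\<close>)
  qed (rule Zm)
qed

lemma pw_glue:
  assumes "disjoint_family (A :: nat \<Rightarrow> 'a set)" "\<And>i. pw (f i) (D i)" "\<And>i. D i \<subseteq> A i"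
  shows "pw (glue A f) (\<Union>i. D i)"
proof (rule pw_UN)
  show "pw (glue A f) (D i)" for i
    by (rule pw_cong[OF assms(2)]) (use assms(3) in \<open>auto intro!: glue_eq[OF assms(1)]\<close>)
qed auto

lemma piso_glue:
  assumes "\<And>i. piso (f i) (A i) (B i)" "disjoint_family (A :: nat \<Rightarrow> 'a set)" "disjoint_family B"
  shows "piso (glue A f) (\<Union>i. A i) (\<Union>i. B i)"
proof -
  have "\<forall>i. \<exists>D. pw (f i) D \<and> inj_on (f i) D \<and> D \<subseteq> A i \<and> f i ` D \<subseteq> B i \<and> A i - D \<in> null_sets M \<and> B i - f i ` D \<in> null_sets M"
    using pisoD(3)[OF assms(1)] by blast
  then obtain D where D: "\<And>i. pw (f i) (D i) \<and> inj_on (f i) (D i) \<and> D i \<subseteq> A i \<and> f i ` D i \<subseteq> B i \<and>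
    A i - D i \<in> null_sets M \<and> B i - f i ` D i \<in> null_sets M" by metis
  have n: "(\<Union>i. A i - D i) \<in> null_sets M" "(\<Union>i. B i - f i ` D i) \<in> null_sets M"
    using D by (auto intro: null_sets_UN)
  have AB: "A i \<in> sets M" "B i \<in> sets M" "D i \<in> sets M" "f i ` D i \<in> sets M" for i
    using pisoD(1,2)[OF assms(1)] D pw_sets pw_img by blast+
  note g = inj_on_glue[OF assms(2,3), of D f]
  have g: "inj_on (glue A f) (\<Union>i. D i)" "glue A f ` (\<Union>i. D i) = (\<Union>i. f i ` D i)"
    by (rule g; use D in blast)+
  show ?thesis
  proof (rule pisoI[where D = "\<Union>i. D i"])
    show "pw (glue A f) (\<Union>i. D i)" using D by (intro pw_glue[OF assms(2)]) blast+
    show "(\<Union>i. A i) - (\<Union>i. D i) \<in> null_sets M"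
      by (rule null_sets_subset[OF n(1)]) (use AB in auto)
    show "(\<Union>i. B i) - glue A f ` (\<Union>i. D i) \<in> null_sets M"
      unfolding g(2) by (rule null_sets_subset[OF n(2)]) (use AB in auto)
    show "(\<Union>i. D i) \<subseteq> (\<Union>i. A i)" "glue A f ` (\<Union>i. D i) \<subseteq> (\<Union>i. B i)"
      unfolding g(2) using D by blast+
  qed (use AB g in auto)
qed

lemma pinj_glue:
  assumes "\<And>i. pinj (f i) (D i) (A i) (B i)" "\<And>i. A i - D i \<in> null_sets M"
    "disjoint_family (A :: nat \<Rightarrow> 'a set)" "disjoint_family B"
  shows "pinj (glue A f) (\<Union>i. D i) (\<Union>i. A i) (\<Union>i. B i)" "(\<Union>i. A i) - (\<Union>i. D i) \<in> null_sets M"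
proof -
  have D: "\<And>i. pw (f i) (D i)" "\<And>i. inj_on (f i) (D i)" "\<And>i. D i \<subseteq> A i" "\<And>i. f i ` D i \<subseteq> B i"
    "\<And>i. A i \<in> sets M" "\<And>i. B i \<in> sets M"
    using assms(1) unfolding pinj_def by blast+
  note g = inj_on_glue[OF assms(3,4) D(3,4,2)]
  have "pw (glue A f) (\<Union>i. D i)" using D by (intro pw_glue[OF assms(3)]) blast+
  then show "pinj (glue A f) (\<Union>i. D i) (\<Union>i. A i) (\<Union>i. B i)"
    unfolding pinj_def g(2) using g(1) D by (auto; blast)
  have "(\<Union>i. A i - D i) \<in> null_sets M" using assms(2) by (rule null_sets_UN)
  then show "(\<Union>i. A i) - (\<Union>i. D i) \<in> null_sets M"
    by (rule null_sets_subset) (use D pw_sets in auto)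
qed

text \<open>For infinite \<open>A\<close> the dichotomy of \<open>ex_maximal_pinj\<close> does not
  tell which side is exhausted. Each piece of \<open>A\<close> of finite measure is therefore
  injected into an infinite part of \<open>B\<close> of its own.\<close>

lemma ex_pinj_infinite:
  assumes "A \<in> sets M" "B \<in> sets M" "emeasure M B = \<infinity>"
  shows "\<exists>\<phi> D. pinj \<phi> D A B \<and> A - D \<in> null_sets M"
proof -
  obtain X :: "nat \<Rightarrow> 'a set" where X: "range X \<subseteq> sets M" "(\<Union>i. X i) = space M"
    "\<And>i. emeasure M (X i) \<noteq> \<infinity>" "disjoint_family X" using sigma_finite_disjoint by blast
  obtain Z :: "nat \<Rightarrow> 'a set" where Z: "\<And>n. Z n \<in> sets M" "disjoint_family Z" "(\<Union>n. Z n) = B"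
    "\<And>n. emeasure M (Z n) = \<infinity>" using split_infinite[OF assms(2,3)] by blast
  let ?A = "\<lambda>i. A \<inter> X i"
  have A: "?A i \<in> sets M" for i using assms X by auto
  have "emeasure M (?A i) \<le> emeasure M (X i)" for i using X by (intro emeasure_mono) auto
  then have f: "emeasure M (?A i) < \<infinity>" for i using X(3)[of i] by (metis infinity_ennreal_def le_less_trans top.not_eq_extremum)
  have "\<forall>i. \<exists>\<phi> D. pinj \<phi> D (?A i) (Z i) \<and> ?A i - D \<in> null_sets M"
    using ex_pinj_finite[OF A Z(1) f Z(4)] by blast
  then obtain f D where f: "\<And>i. pinj (f i) (D i) (?A i) (Z i)" "\<And>i. ?A i - D i \<in> null_sets M" by metis
  have dA: "disjoint_family ?A" using X(4) by (auto simp: disjoint_family_on_def)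
  have "(\<Union>i. ?A i) = A" using X(2) sets.sets_into_space[OF assms(1)] by auto
  then show ?thesis using pinj_glue[OF f dA Z(2)] Z(3) by auto
qed

text \<open>Schroeder--Bernstein, applied to partial injections in both directions.\<close>

lemma piso_infinite:
  assumes "A \<in> sets M" "emeasure M A = \<infinity>" "B \<in> sets M" "emeasure M B = \<infinity>"
  shows "\<exists>\<phi>. piso \<phi> A B"
proof -
  obtain \<phi> D where p: "pinj \<phi> D A B" "A - D \<in> null_sets M" using ex_pinj_infinite[OF assms(1,3,4)] by auto
  obtain \<psi> E where q: "pinj \<psi> E B A" "B - E \<in> null_sets M" using ex_pinj_infinite[OF assms(3,1,2)] by auto
  have pD: "pw \<phi> D" "inj_on \<phi> D" "D \<subseteq> A" "\<phi> ` D \<subseteq> B" using p by (auto simp: pinj_def)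
  have qE: "pw \<psi> E" "inj_on \<psi> E" "E \<subseteq> B" "\<psi> ` E \<subseteq> A" using q by (auto simp: pinj_def)
  \<comment> \<open>\<open>S 0\<close> is the part of \<open>A\<close> outside the image of
    \<open>\<psi>\<close>, and each step pushes it through \<open>\<phi>\<close> and then
    \<open>\<psi>\<close>, as far as the partial maps are defined. On the union \<open>U\<close> the
    bijection follows \<open>\<phi>\<close>, elsewhere the inverse of \<open>\<psi>\<close>.\<close>
  define S where "S = rec_nat (A - \<psi> ` E) (\<lambda>_ S. \<psi> ` (\<phi> ` (S \<inter> D) \<inter> E))"
  have S0: "S 0 = A - \<psi> ` E" and SS: "S (Suc n) = \<psi> ` (\<phi> ` (S n \<inter> D) \<inter> E)" for n by (auto simp: S_def)
  have Sm: "S n \<in> sets M" for n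
  proof (induction n)
    case 0 show ?case using assms pw_img[OF qE(1)] by (auto simp: S0)
  next
    case (Suc n)
    have "pw \<phi> (S n \<inter> D)" using Suc pw_sets[OF pD(1)] by (intro pw_sub[OF pD(1)]) auto
    from pw_img[OF this] have "pw \<psi> (\<phi> ` (S n \<inter> D) \<inter> E)" using pw_sets[OF qE(1)]
      by (intro pw_sub[OF qE(1)]) auto
    from pw_img[OF this] show ?case by (simp add: SS)
  qed
  define U where "U = (\<Union>n. S n)"
  have Um: "U \<in> sets M" using Sm by (auto simp: U_def)
  define \<theta> where "\<theta> x = (if x \<in> U then \<phi> x else inv_into E \<psi> x)" for x
  have AU: "A - U \<subseteq> \<psi> ` E" using S0 by (auto simp: U_def)
  let ?D = "(U \<inter> D) \<union> (A - U)"
  have p1: "pw \<theta> (U \<inter> D)"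
    by (rule pw_cong[where \<phi>=\<phi>]) (use pw_sub[OF pD(1)] Um pw_sets[OF pD(1)] in \<open>auto simp: \<theta>_def\<close>)
  have p2: "pw \<theta> (A - U)"
    by (rule pw_cong[where \<phi>="inv_into E \<psi>"])
      (use pw_sub[OF pw_inv[OF qE(1,2)] _ AU] Um assms in \<open>auto simp: \<theta>_def\<close>)
  have \<psi>\<theta>: "\<theta> x \<in> E" "\<psi> (\<theta> x) = x" if "x \<in> A - U" for x
  proof -
    have "x \<in> \<psi> ` E" using that AU by auto
    then show "\<theta> x \<in> E" "\<psi> (\<theta> x) = x"
      using that by (auto simp: \<theta>_def inv_into_into f_inv_into_f)
  qed
  have mix: False if x: "x \<in> U \<inter> D" and y: "y \<in> A - U" and e: "\<theta> x = \<theta> y" for x y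
  proof -
    obtain n where "x \<in> S n" using x by (auto simp: U_def)
    then have "\<phi> x \<in> \<phi> ` (S n \<inter> D)" using x by auto
    moreover have "\<phi> x = \<theta> y" using x e by (auto simp: \<theta>_def)
    ultimately have "\<psi> (\<theta> y) \<in> S (Suc n)" using \<psi>\<theta>[OF y] unfolding SS by (metis IntI imageI)
    then show False using \<psi>\<theta>[OF y] y by (auto simp: U_def)
  qed
  have inj: "inj_on \<theta> ?D"
  proof (rule inj_onI)
    fix x y assume "x \<in> ?D" "y \<in> ?D" and e: "\<theta> x = \<theta> y"
    then consider "x \<in> U \<inter> D" "y \<in> U \<inter> D" | "x \<in> A - U" "y \<in> A - U"
      using mix[of x y] mix[of y x] by auto
    then show "x = y"
    proof cases
      case 1 then show ?thesis using e pD(2) by (auto simp: \<theta>_def inj_on_def)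
    next
      case 2 then show ?thesis using e \<psi>\<theta> by metis
    qed
  qed
  have onto: "E \<subseteq> \<theta> ` ?D"
  proof
    fix b assume b: "b \<in> E"
    show "b \<in> \<theta> ` ?D"
    proof (cases "\<psi> b \<in> U")
      case False
      then have "\<psi> b \<in> A - U" "\<theta> (\<psi> b) = b" using b qE by (auto simp: \<theta>_def)
      then show ?thesis by (metis UnI2 imageI)
    next
      case True
      then obtain n where n: "\<psi> b \<in> S n" by (auto simp: U_def)
      with b have "n \<noteq> 0" using S0 by (metis DiffD2 imageI)
      then obtain m where "n = Suc m" using not0_implies_Suc by blast
      then obtain c where c: "c \<in> S m \<inter> D" "\<phi> c \<in> E" "\<psi> b = \<psi> (\<phi> c)" using n by (auto simp: SS)
      then have "b = \<phi> c" using b qE(2) by (auto simp: inj_on_def)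
      moreover have "c \<in> U \<inter> D" using c by (auto simp: U_def)
      ultimately show ?thesis by (auto simp: \<theta>_def image_iff)
    qed
  qed
  have "piso \<theta> A B"
  proof (rule pisoI[OF assms(1,3) pw_Un[OF p1 p2] inj])
    show "\<theta> ` ?D \<subseteq> B" using \<psi>\<theta>(1) qE(3) pD(4) by (auto simp: \<theta>_def)
    show "A - ?D \<in> null_sets M"
      by (rule null_sets_subset[OF p(2)]) (use assms Um pw_sets[OF pD(1)] in auto)
    show "B - \<theta> ` ?D \<in> null_sets M"
      by (rule null_sets_subset[OF q(2)]) (use assms pw_img[OF pw_Un[OF p1 p2]] onto in auto)
  qed (use pD in auto)
  then show ?thesis by auto
qed


section \<open>From isomorphisms modulo null sets to elements of the group\<close>

lemma piso_Un:
  assumes f: "piso f A B" and g: "piso g A' B'" and dA: "A \<inter> A' = {}" and dB: "B \<inter> B' = {}"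
  shows "piso (\<lambda>x. if x \<in> A then f x else g x) (A \<union> A') (B \<union> B')"
proof -
  obtain D where D: "pw f D" "inj_on f D" "D \<subseteq> A" "f ` D \<subseteq> B" "A - D \<in> null_sets M" "B - f ` D \<in> null_sets M"
    using pisoD(3)[OF f] by blast
  obtain E where E: "pw g E" "inj_on g E" "E \<subseteq> A'" "g ` E \<subseteq> B'" "A' - E \<in> null_sets M" "B' - g ` E \<in> null_sets M"
    using pisoD(3)[OF g] by blast
  define h where "h x = (if x \<in> A then f x else g x)" for x
  have hD: "h x = f x" if "x \<in> D" for x using that D(3) by (auto simp: h_def)
  have hE: "h x = g x" if "x \<in> E" for x using that E(3) dA by (auto simp: h_def)
  have hi: "h ` (D \<union> E) = f ` D \<union> g ` E" using hD hE by (auto simp: image_Un image_iff)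
  have "piso h (A \<union> A') (B \<union> B')"
  proof (rule pisoI[where D="D \<union> E"])
    show "pw h (D \<union> E)" using pw_cong[OF D(1) hD] pw_cong[OF E(1) hE] by (rule pw_Un)
    show "inj_on h (D \<union> E)"
    proof (rule inj_onI)
      fix x y assume x: "x \<in> D \<union> E" and y: "y \<in> D \<union> E" and e: "h x = h y"
      have *: False if "u \<in> D" "v \<in> E" "h u = h v" for u v
        using that hD hE D(4) E(4) dB by (metis disjoint_iff imageI subsetD)
      consider "x \<in> D" "y \<in> D" | "x \<in> E" "y \<in> E" using x y * e by (metis UnE)
      then show "x = y" using e hD hE D(2) E(2) by cases (auto simp: inj_on_def)
    qed
    have "(A - D) \<union> (A' - E) \<in> null_sets M" using D(5) E(5) by (rule null_sets.Un)
    then show "A \<union> A' - (D \<union> E) \<in> null_sets M"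
      by (rule null_sets_subset) (use pisoD[OF f] pisoD[OF g] pw_sets D E in auto)
    have "(B - f ` D) \<union> (B' - g ` E) \<in> null_sets M" using D(6) E(6) by (rule null_sets.Un)
    then show "B \<union> B' - h ` (D \<union> E) \<in> null_sets M" unfolding hi
      by (rule null_sets_subset) (use pisoD[OF f] pisoD[OF g] pw_img D E in auto)
  qed (use pisoD[OF f] pisoD[OF g] D(3,4) E(3,4) hi in auto)
  then show ?thesis by (simp add: h_def[abs_def])
qed

lemma piso_H:
  assumes "T \<in> H" "P \<in> sets M" "Q \<in> sets M" "sends T P Q"
  shows "piso T P Q"
proof (rule pisoI[where D="P \<inter> T -` Q"])
  have n: "sym_diff (T ` P) Q \<in> null_sets M" using assms sends_iff_null by auto
  have m: "P \<inter> T -` Q \<in> sets M" using assms img' by auto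
  show "pw T (P \<inter> T -` Q)" by (rule pw_H[OF assms(1) m])
  show "inj_on T (P \<inter> T -` Q)" using injH[OF assms(1)] by (auto simp: inj_on_def)
  have "T -` (sym_diff (T ` P) Q) \<in> null_sets M" by (rule null_img'[OF assms(1) n])
  then show "P - P \<inter> T -` Q \<in> null_sets M"
    by (rule null_sets_subset) (use assms m in auto)
  show "Q - T ` (P \<inter> T -` Q) \<in> null_sets M"
    by (rule null_sets_subset[OF n]) (use assms m img in auto)
qed (use assms in auto)

lemma sends_id: "T \<in> H \<Longrightarrow> sends T P (T ` P)"
  unfolding sends_def by (auto simp: image_iff injH)

lemma piso_id: "A \<in> sets M \<Longrightarrow> piso (\<lambda>x. x) A A"
  using piso_H[OF one, of A A] sends_id[OF one, of A] by (simp add: id_def)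

text \<open>Closing a null set countably often under images and preimages keeps it null. Off the
  resulting set \<open>N\<close>, the map \<open>\<phi>\<close> never enters
  \<open>N\<close>.\<close>

lemma pw_saturate:
  assumes "pw \<phi> D" "N0 \<in> null_sets M"
  obtains N where "N \<in> null_sets M" "N0 \<subseteq> N" "\<And>x. x \<in> D \<Longrightarrow> \<phi> x \<in> N \<longleftrightarrow> x \<in> N"
proof -
  define S where "S = rec_nat N0 (\<lambda>_ N. N \<union> \<phi> ` (N \<inter> D) \<union> {x\<in>D. \<phi> x \<in> N})"
  have S0: "S 0 = N0" and SS: "S (Suc n) = S n \<union> \<phi> ` (S n \<inter> D) \<union> {x\<in>D. \<phi> x \<in> S n}" for n
    by (auto simp: S_def)
  have "S n \<in> null_sets M" for n
    by (induction n) (use assms pw_null in \<open>auto simp: S0 SS intro!: null_sets.Un\<close>)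
  then have "(\<Union>n. S n) \<in> null_sets M" by (rule null_sets_UN)
  moreover have "\<phi> x \<in> (\<Union>n. S n) \<longleftrightarrow> x \<in> (\<Union>n. S n)" if "x \<in> D" for x
  proof
    assume "\<phi> x \<in> (\<Union>n. S n)"
    then obtain n where "\<phi> x \<in> S n" by auto
    then have "x \<in> S (Suc n)" using that by (simp add: SS)
    then show "x \<in> (\<Union>n. S n)" by blast
  next
    assume "x \<in> (\<Union>n. S n)"
    then obtain n where "x \<in> S n" by auto
    then have "\<phi> x \<in> S (Suc n)" using that by (auto simp: SS)
    then show "\<phi> x \<in> (\<Union>n. S n)" by blast
  qed
  moreover have "N0 \<subseteq> (\<Union>n. S n)" using S0 by blast
  ultimately show ?thesis using that by blast
qed

text \<open>An invariant null set containing everything outside the domain or the range is cut out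
  and given the identity. What remains is an exact bijection, as pasting requires.\<close>

lemma piso_realize:
  assumes "piso \<phi> (space M) (space M)"
  obtains T where "T \<in> H" "AE x in M. T x = \<phi> x"
proof -
  obtain D where D: "pw \<phi> D" "inj_on \<phi> D" "D \<subseteq> space M" "\<phi> ` D \<subseteq> space M"
    "space M - D \<in> null_sets M" "space M - \<phi> ` D \<in> null_sets M"
    using pisoD(3)[OF assms] by blast
  have "(space M - D) \<union> (space M - \<phi> ` D) \<in> null_sets M" using D(5,6) by (rule null_sets.Un)
  then obtain N where N: "N \<in> null_sets M" "(space M - D) \<union> (space M - \<phi> ` D) \<subseteq> N"
    "\<And>x. x \<in> D \<Longrightarrow> \<phi> x \<in> N \<longleftrightarrow> x \<in> N" using pw_saturate[OF D(1)] by metis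
  have Nm: "N \<in> sets M" using N by auto
  define T where "T x = (if x \<in> space M - N then \<phi> x else x)" for x
  have sD: "space M - N \<subseteq> D" using N(2) by auto
  have T1: "T x = \<phi> x \<and> T x \<in> space M - N" if "x \<in> space M - N" for x
    using that sD N(3)[of x] D(4) by (auto simp: T_def)
  have T2: "T x = x" if "x \<notin> space M - N" for x using that by (simp add: T_def del: Diff_iff)
  have "bij T"
  proof (rule bijI)
    show "inj T"
    proof (rule injI)
      fix x y assume e: "T x = T y"
      show "x = y"
      proof (cases "x \<in> space M - N \<longleftrightarrow> y \<in> space M - N")
        case True
        show ?thesis
        proof (cases "x \<in> space M - N")
          case x: True
          then have "\<phi> x = \<phi> y" "x \<in> D" "y \<in> D" using True T1[of x] T1[of y] e sD by auto
          then show ?thesis by (rule inj_onD[OF D(2)])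
        next
          case False
          moreover have "y \<notin> space M - N" using True False by (simp only: simp_thms)
          ultimately show ?thesis using e T2[of x] T2[of y] by (simp only: simp_thms not_False_eq_True)
        qed
      next
        case False
        then show ?thesis using e T1[of x] T1[of y] T2[of x] T2[of y] by metis
      qed
    qed
    show "surj T"
      unfolding surj_def
    proof
      fix y
      show "\<exists>x. y = T x"
      proof (cases "y \<in> space M - N")
        case True
        then have "y \<in> \<phi> ` D" using N(2) by auto
        then obtain x where x: "x \<in> D" "y = \<phi> x" by auto
        then have "x \<in> space M - N" using N(3)[of x] True D(3) by auto
        then show ?thesis using T1[of x] x by metis
      qed (use T2 in metis)
    qed
  qed
  moreover have "pw T (space M)"
  proof -
    have "pw T (space M - N)"
      using T1 by (intro pw_cong[OF pw_sub[OF D(1) _ sD]]) (use Nm in auto)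
    moreover have "pw T N" 
      by (rule pw_cong[OF pw_H[OF one Nm]]) (simp add: T_def)
    ultimately have "pw T ((space M - N) \<union> N)" by (rule pw_Un)
    moreover have "(space M - N) \<union> N = space M" using sets.sets_into_space[OF Nm] by auto
    ultimately show ?thesis by simp
  qed
  ultimately have "T \<in> H" using pw_paste[of T] T2 by auto
  moreover have "AE x in M. T x = \<phi> x"
    by (rule AE_I'[OF N(1)]) (use T1 in auto)
  ultimately show ?thesis using that by blast
qed

text \<open>On the countable union of the pieces the involution is exact, so no null set has to be removed.\<close>

lemma piso_swap:
  assumes p: "piso \<phi> P Q" and PQ: "P \<inter> Q = {}"
  obtains s where "s \<in> H" "\<And>x. s (s x) = x" "\<And>x. x \<notin> P \<union> Q \<Longrightarrow> s x = x" "sends s P Q"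
    "AE x in M. x \<in> P \<longrightarrow> s x = \<phi> x"
proof -
  note PQm = pisoD(1,2)[OF p]
  obtain D where D: "pw \<phi> D" "inj_on \<phi> D" "D \<subseteq> P" "\<phi> ` D \<subseteq> Q" "P - D \<in> null_sets M" "Q - \<phi> ` D \<in> null_sets M"
    using pisoD(3)[OF p] by blast
  define s where "s x = (if x \<in> D then \<phi> x else if x \<in> \<phi> ` D then inv_into D \<phi> x else x)" for x
  have s1: "s x = \<phi> x" if "x \<in> D" for x using that by (simp add: s_def)
  have s2: "s (\<phi> x) = x" if "x \<in> D" for x
  proof -
    have "\<phi> x \<notin> D" using that D(3,4) PQ by auto
    then show ?thesis using that D(2) by (simp add: s_def)
  qed
  have s3: "s x = x" if "x \<notin> D" "x \<notin> \<phi> ` D" for x using that by (simp add: s_def)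
  have ss: "s (s x) = x" for x
    by (cases "x \<in> D"; cases "x \<in> \<phi> ` D") (auto simp: s1 s2 s3)
  have pws: "pw s (space M)"
  proof -
    let ?R = "space M - D - \<phi> ` D"
    have "pw s D" by (rule pw_cong[OF D(1) s1])
    moreover have "pw s (\<phi> ` D)"
      by (rule pw_cong[OF pw_inv[OF D(1,2)]]) (use D(2) s2 in auto)
    moreover have "pw s ?R"
      by (rule pw_cong[OF pw_H[OF one]]) (use pw_sets[OF D(1)] pw_img[OF D(1)] s3 in auto)
    ultimately have "pw s (D \<union> \<phi> ` D \<union> ?R)" by (intro pw_Un)
    moreover have "D \<union> \<phi> ` D \<union> ?R = space M"
      using sets.sets_into_space[OF pw_sets[OF D(1)]] sets.sets_into_space[OF pw_img[OF D(1)]] by auto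
    ultimately show ?thesis by simp
  qed
  have "bij s" by (rule o_bij[of s]) (auto simp: ss)
  moreover have "s x = x" if "x \<notin> space M" for x
    using that D(3,4) sets.sets_into_space[OF PQm(1)] sets.sets_into_space[OF PQm(2)] by (intro s3) auto
  ultimately have sH: "s \<in> H" using pws by (intro pw_paste)
  have n: "(P - D) \<union> (Q - \<phi> ` D) \<in> null_sets M" using D(5,6) by (rule null_sets.Un)
  have 1: "x \<in> P \<longleftrightarrow> s x \<in> Q" if x: "x \<notin> (P - D) \<union> (Q - \<phi> ` D)" for x
  proof -
    consider "x \<in> D" | y where "x = \<phi> y" "y \<in> D" | "x \<notin> P" "x \<notin> Q" using x by auto
    then show ?thesis
    proof cases
      case 1 then show ?thesis using D(3,4) by (auto simp: s1)
    next
      case 2 then show ?thesis using D(3,4) PQ by (auto simp: s2)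
    next
      case 3
      then have "x \<notin> D" "x \<notin> \<phi> ` D" using D(3,4) by blast+
      then show ?thesis using 3 s3[of x] by simp
    qed
  qed
  have "sends s P Q" unfolding sends_def by (rule AE_I'[OF n]) (use 1 in auto)
  moreover have "AE x in M. x \<in> P \<longrightarrow> s x = \<phi> x" by (rule AE_I'[OF n]) (use s1 in auto)
  moreover have "s x = x" if "x \<notin> P \<union> Q" for x using that D(3,4) by (intro s3) auto
  ultimately show ?thesis using that sH ss by blast
qed


lemma piso_maps: assumes "piso \<phi> A B" shows "AE x in M. x \<in> A \<longrightarrow> \<phi> x \<in> B"
proof -
  obtain D where D: "D \<subseteq> A" "\<phi> ` D \<subseteq> B" "A - D \<in> null_sets M"
    using pisoD(3)[OF assms] by blast
  show ?thesis by (rule AE_I'[OF D(3)]) (use D in auto)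
qed

lemma piso_comp:
  assumes f: "piso \<phi> A B" and g: "piso \<psi> B C"
  shows "piso (\<lambda>x. \<psi> (\<phi> x)) A C"
proof -
  obtain D where D: "pw \<phi> D" "inj_on \<phi> D" "D \<subseteq> A" "\<phi> ` D \<subseteq> B" "A - D \<in> null_sets M" "B - \<phi> ` D \<in> null_sets M"
    using pisoD(3)[OF f] by blast
  obtain E where E: "pw \<psi> E" "inj_on \<psi> E" "E \<subseteq> B" "\<psi> ` E \<subseteq> C" "B - E \<in> null_sets M" "C - \<psi> ` E \<in> null_sets M"
    using pisoD(3)[OF g] by blast
  let ?D = "{x\<in>D. \<phi> x \<in> E}"
  have Dm: "?D \<in> sets M" by (rule pw_vimage[OF D(1) pw_sets[OF E(1)]])
  have pD: "pw \<phi> ?D" by (rule pw_sub[OF D(1) Dm]) auto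
  have pc: "pw (\<lambda>x. \<psi> (\<phi> x)) ?D" by (rule pw_comp[OF pD E(1)]) auto
  show ?thesis
  proof (rule pisoI[OF pisoD(1)[OF f] pisoD(2)[OF g] pc])
    show "inj_on (\<lambda>x. \<psi> (\<phi> x)) ?D"
    proof (rule inj_onI)
      fix x y assume x: "x \<in> ?D" and y: "y \<in> ?D" and "\<psi> (\<phi> x) = \<psi> (\<phi> y)"
      then have "\<phi> x = \<phi> y" using inj_onD[OF E(2)] by blast
      then show "x = y" using x y inj_onD[OF D(2)] by blast
    qed
    have "(A - D) \<union> {x\<in>D. \<phi> x \<in> B - E} \<in> null_sets M"
      using D(5) pw_null(2)[OF D(1) E(5)] by (rule null_sets.Un)
    then show "A - ?D \<in> null_sets M"
      by (rule null_sets_subset) (use D(4) Dm pisoD(1)[OF f] in auto)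
    have "(C - \<psi> ` E) \<union> \<psi> ` ((B - \<phi> ` D) \<inter> E) \<in> null_sets M"
      using E(6) pw_null(1)[OF E(1) D(6)] by (rule null_sets.Un)
    then show "C - (\<lambda>x. \<psi> (\<phi> x)) ` ?D \<in> null_sets M"
    proof (rule null_sets_subset)
      show "C - (\<lambda>x. \<psi> (\<phi> x)) ` ?D \<in> sets M" using pw_img[OF pc] pisoD(2)[OF g] by auto
      show "C - (\<lambda>x. \<psi> (\<phi> x)) ` ?D \<subseteq> (C - \<psi> ` E) \<union> \<psi> ` ((B - \<phi> ` D) \<inter> E)"
      proof
        fix c assume c: "c \<in> C - (\<lambda>x. \<psi> (\<phi> x)) ` ?D"
        show "c \<in> (C - \<psi> ` E) \<union> \<psi> ` ((B - \<phi> ` D) \<inter> E)"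
        proof (cases "c \<in> \<psi> ` E")
          case True
          then obtain e where e: "e \<in> E" "c = \<psi> e" by auto
          have "e \<notin> \<phi> ` D" using c e by auto
          then show ?thesis using e E(3) by auto
        qed (use c in auto)
      qed
    qed
  qed (use D E in auto)
qed

section \<open>Fixing and carrying sets modulo null sets\<close>

lemma fx_mono: "fx T B \<Longrightarrow> C \<subseteq> B \<Longrightarrow> fx T C"
  unfolding fx_def by (auto elim: eventually_mono)

lemma fx_comp: "fx S B \<Longrightarrow> fx T B \<Longrightarrow> fx (S \<circ> T) B"
  unfolding fx_def by (auto elim: eventually_elim2)

lemma fx_exact: "(\<And>x. x \<in> B \<Longrightarrow> T x = x) \<Longrightarrow> fx T B"
  unfolding fx_def by auto

text \<open>If \<open>T x\<close> lies outside \<open>A\<close>, then \<open>T\<close> fixes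
  \<open>T x\<close> too, and injectivity forces \<open>T x = x\<close>; so points of
  \<open>A\<close> stay in \<open>A\<close>.\<close>

lemma fx_sends:
  assumes T: "T \<in> H" and f: "fx T (space M - A)" shows "sends T A A"
proof -
  have 1: "AE x in M. x \<in> space M - A \<longrightarrow> T x = x" using f by (simp add: fx_def)
  show ?thesis unfolding sends_def
    using 1 AE_H[OF T 1] AE_space
  proof eventually_elim
    case (elim x)
    then show ?case using spaceH[OF T, of x] injH[OF T, of "T x" x] by auto
  qed
qed

text \<open>Agreement on \<open>P\<close> also controls points outside \<open>P\<close>: if
  \<open>w y\<close> lies in \<open>Q\<close>, then \<open>finv T (w y)\<close> lies in
  \<open>P\<close>, where \<open>w\<close> and \<open>T\<close> agree, and injectivity of
  \<open>w\<close> identifies this point with \<open>y\<close>.\<close>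

lemma sends_agree:
  assumes T: "T \<in> H" and w: "w \<in> H" and s: "sends T P Q" and e: "AE x in M. x \<in> P \<longrightarrow> w x = T x"
  shows "sends w P Q"
proof -
  have wt: "finv T \<circ> w \<in> H" using T w invc comp by auto
  show ?thesis unfolding sends_def
    using e AE_H[OF wt e] s[unfolded sends_def] AE_H[OF wt s[unfolded sends_def]]
  proof eventually_elim
    case (elim y)
    then show ?case using T injH[OF w, of "finv T (w y)" y] by auto
  qed
qed

lemma sends_inv:
  assumes "T \<in> H" "sends T P Q" shows "sends (finv T) Q P"
  using AE_H[OF invc[OF assms(1)] assms(2)[unfolded sends_def]] assms(1)
  unfolding sends_def by (auto elim: eventually_mono)

lemma sends_comp:
  assumes "T \<in> H" "sends T P Q" "sends S Q R" shows "sends (\<lambda>x. S (T x)) P R"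
  using AE_H[OF assms(1) assms(3)[unfolded sends_def]] assms(2)
  unfolding sends_def by (auto elim: eventually_elim2)

lemma sends_invol:
  assumes "s \<in> H" "\<And>x. s (s x) = x" "sends s P Q" shows "sends s Q P"
  using AE_H[OF assms(1) assms(3)[unfolded sends_def]] assms(2)
  unfolding sends_def by (auto elim: eventually_mono)

lemma finv_invol: "(\<And>x. s (s x) = x) \<Longrightarrow> finv s = s"
  by (rule inv_equality) auto

lemma multi_swap:
  fixes P Q :: "nat \<Rightarrow> 'a set"
  assumes P: "disjoint_family P" and Q: "disjoint_family Q" and PQ: "\<And>i j. P i \<inter> Q j = {}"
    and i: "\<And>i. \<exists>\<phi>. piso \<phi> (P i) (Q i)"
  obtains s where "s \<in> H" "\<And>x. s (s x) = x" "\<And>i. sends s (P i) (Q i)"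
    "sends s (\<Union>i. P i) (\<Union>i. Q i)" "\<And>x. x \<notin> (\<Union>i. P i) \<union> (\<Union>i. Q i) \<Longrightarrow> s x = x"
proof -
  obtain f where f: "\<And>i. piso (f i) (P i) (Q i)" using i by metis
  have g: "piso (glue P f) (\<Union>i. P i) (\<Union>i. Q i)" by (rule piso_glue[OF f P Q])
  have "(\<Union>i. P i) \<inter> (\<Union>i. Q i) = {}" using PQ by blast
  from piso_swap[OF g this] obtain s where s: "s \<in> H" "\<And>x. s (s x) = x"
    "\<And>x. x \<notin> (\<Union>i. P i) \<union> (\<Union>i. Q i) \<Longrightarrow> s x = x" "sends s (\<Union>i. P i) (\<Union>i. Q i)"
    "AE x in M. x \<in> (\<Union>i. P i) \<longrightarrow> s x = glue P f x" by blast
  have m: "AE x in M. \<forall>i. x \<in> P i \<longrightarrow> f i x \<in> Q i" using piso_maps[OF f] by (simp add: AE_all_countable)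
  \<comment> \<open>The isomorphisms handle points of \<open>P i\<close>. Conversely, the statement
    about the unions puts \<open>x\<close> into some \<open>P j\<close>, and disjointness of the
    targets forces \<open>j = i\<close>.\<close>
  have "sends s (P i) (Q i)" for i
    unfolding sends_def using s(5) m s(4)[unfolded sends_def]
  proof eventually_elim
    case (elim x)
    have *: "s x \<in> Q j" if "x \<in> P j" for j
      using elim that glue_eq[OF P that, of f] by auto
    show ?case
    proof
      assume "s x \<in> Q i"
      then obtain j where j: "x \<in> P j" using elim by blast
      have "j = i" using *[OF j] \<open>s x \<in> Q i\<close> disjoint_family_onD[OF Q, of j i] by auto
      then show "x \<in> P i" using j by simp
    qed (rule *)
  qed
  then show ?thesis using that s by blast
qed

section \<open>Swaps of sets of infinite measure and their conjugacy\<close>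

lemma swap_ex:
  assumes "P \<in> sets M" "Q \<in> sets M" "emeasure M P = \<infinity>" "emeasure M Q = \<infinity>" "P \<inter> Q = {}"
  obtains s where "s \<in> H" "\<And>x. s (s x) = x" "\<And>x. x \<notin> P \<union> Q \<Longrightarrow> s x = x" "sends s P Q"
  using piso_infinite[OF assms(1,3,2,4)] piso_swap[OF _ assms(5)] by metis

text \<open>The two conditions of infinite measure are what makes any two swaps in \<open>B\<close>
  conjugate inside \<open>B\<close>. The set \<open>Q\<close> is infinite as well, since
  \<open>s\<close> preserves measure.\<close>

definition is_swap :: "'a set \<Rightarrow> ('a \<Rightarrow> 'a) \<Rightarrow> 'a set \<Rightarrow> 'a set \<Rightarrow> bool" where
  "is_swap B s P Q \<longleftrightarrow> s \<in> H \<and> (\<forall>x. s (s x) = x) \<and> sends s P Q \<and> P \<in> sets M \<and> Q \<in> sets M \<and> P \<inter> Q = {} \<and>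
     P \<union> Q \<subseteq> B \<and> (\<forall>x. x \<notin> P \<union> Q \<longrightarrow> s x = x) \<and> emeasure M P = \<infinity> \<and> emeasure M (B - (P \<union> Q)) = \<infinity>"

text \<open>\<open>U\<close> is an arbitrary isomorphism from \<open>P\<close> to \<open>P'\<close>.
  On \<open>Q\<close> it is then forced to be \<open>t \<circ> U \<circ> s\<close>, the remainders
  of \<open>A\<close> can be matched because both are infinite, and off \<open>A\<close> it is the
  identity.\<close>

lemma is_swap_conj:
  assumes A: "A \<in> sets M" and s: "is_swap A s P Q" and t: "is_swap A t P' Q'"
  obtains U where "U \<in> H" "fx U (space M - A)" "AE x in M. t (U x) = U (s x)"
proof -
  have s': "s \<in> H" "\<And>x. s (s x) = x" "sends s P Q" "P \<in> sets M" "Q \<in> sets M" "P \<inter> Q = {}" "P \<union> Q \<subseteq> A"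
    "\<And>x. x \<notin> P \<union> Q \<Longrightarrow> s x = x" "emeasure M P = \<infinity>" "emeasure M (A - (P \<union> Q)) = \<infinity>"
    using s unfolding is_swap_def by blast+
  have t': "t \<in> H" "\<And>x. t (t x) = x" "sends t P' Q'" "P' \<in> sets M" "Q' \<in> sets M" "P' \<inter> Q' = {}" "P' \<union> Q' \<subseteq> A"
    "\<And>x. x \<notin> P' \<union> Q' \<Longrightarrow> t x = x" "emeasure M P' = \<infinity>" "emeasure M (A - (P' \<union> Q')) = \<infinity>"
    using t unfolding is_swap_def by blast+
  let ?R = "A - (P \<union> Q)" let ?R' = "A - (P' \<union> Q')"
  obtain \<phi> where \<phi>: "piso \<phi> P P'" using piso_infinite[OF s'(4,9) t'(4,9)] by auto
  obtain \<psi> where \<psi>: "piso \<psi> ?R ?R'" using piso_infinite[OF _ s'(10) _ t'(10)] A s' t' by auto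
  have sQP: "sends s Q P" by (rule sends_invol[OF s'(1,2,3)])
  have p2: "piso (\<lambda>x. t (\<phi> (s x))) Q Q'"
    by (rule piso_comp[OF piso_comp[OF piso_H[OF s'(1,5,4) sQP] \<phi>] piso_H[OF t'(1,4,5,3)]])
  have p3: "piso (\<lambda>x. x) (space M - A) (space M - A)" using A by (intro piso_id) auto
  define h where "h x = (if x \<in> P then \<phi> x else if x \<in> Q then t (\<phi> (s x)) else if x \<in> ?R then \<psi> x else x)" for x
  have "piso h (P \<union> (Q \<union> (?R \<union> (space M - A)))) (P' \<union> (Q' \<union> (?R' \<union> (space M - A))))"
    unfolding h_def[abs_def]
    by (intro piso_Un \<phi> p2 \<psi> p3) (use s'(6,7) t'(6,7) in auto)
  moreover have "P \<union> (Q \<union> (?R \<union> (space M - A))) = space M" "P' \<union> (Q' \<union> (?R' \<union> (space M - A))) = space M"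
    using s'(7) t'(7) sets.sets_into_space[OF A] by auto
  ultimately have "piso h (space M) (space M)" by simp
  then obtain U where U: "U \<in> H" "AE x in M. U x = h x" by (rule piso_realize)
  have "fx U (space M - A)" unfolding fx_def
    using U(2)
  proof eventually_elim
    case (elim x)
    then show ?case using subsetD[OF s'(7), of x] by (simp add: h_def)
  qed
  moreover have "AE x in M. t (U x) = U (s x)"
    using U(2) AE_H[OF s'(1) U(2)] s'(3)[unfolded sends_def] sQP[unfolded sends_def] piso_maps[OF \<psi>] AE_space
  proof eventually_elim
    case (elim x)
    consider "x \<in> P" | "x \<in> Q" "x \<notin> P" | "x \<in> ?R" | "x \<notin> A" "x \<notin> P" "x \<notin> Q" using s'(7) by blast
    then show ?case
    proof cases
      case 1
      then have "s x \<in> Q" using elim by simp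
      then have "s x \<notin> P" using s'(6) by auto
      then show ?thesis using 1 elim \<open>s x \<in> Q\<close> by (simp add: h_def s'(2))
    next
      case 2
      then have "s x \<in> P" using elim by simp
      then show ?thesis using 2 elim by (simp add: h_def t'(2))
    next
      case 3
      then have sx: "s x = x" using s'(8) by blast
      have "\<psi> x \<in> ?R'" using 3 elim(5) by blast
      then have "t (\<psi> x) = \<psi> x" using t'(8) by blast
      moreover have "U x = \<psi> x" using elim(1) 3 by (simp add: h_def)
      ultimately show ?thesis by (simp add: sx)
    next
      case 4
      then have sx: "s x = x" using s'(8) by blast
      have "U x = x" using elim(1) 4 by (simp add: h_def)
      moreover have "t x = x" by (rule t'(8)) (use 4 t'(7) in blast)
      ultimately show ?thesis by (simp add: sx)
    qed
  qed
  ultimately show ?thesis using that U(1) by blast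
qed

end

section \<open>Powers of a countably syndetic set\<close>

text \<open>By \<open>Vae\<close>, \<open>V\<close> is a union of classes modulo null sets. This
  lets \<open>cov\<close> ask for an exact factorisation: an error on a null set is absorbed by
  \<open>v\<close>.\<close>

locale syndetic = ergodic_full +
  fixes V :: "('a \<Rightarrow> 'a) set" and k :: "nat \<Rightarrow> 'a \<Rightarrow> 'a"
  assumes VH: "T \<in> V \<Longrightarrow> T \<in> H" and Vinv: "T \<in> V \<Longrightarrow> finv T \<in> V"
    and Vae: "T \<in> V \<Longrightarrow> S \<in> H \<Longrightarrow> AE x in M. S x = T x \<Longrightarrow> S \<in> V"
    and kH: "k n \<in> H" and cov: "T \<in> H \<Longrightarrow> \<exists>n. \<exists>v\<in>V. T = k n \<circ> v"
begin

text \<open>Level 0 holds all maps that are almost everywhere the identity, not the identity alone,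
  so that every level is closed under almost everywhere equality.\<close>

primrec vp :: "nat \<Rightarrow> ('a \<Rightarrow> 'a) set" where
  "vp 0 = {T \<in> H. AE x in M. T x = x}"
| "vp (Suc n) = {S \<circ> T |S T. S \<in> vp n \<and> T \<in> V}"

lemma vp_SucI: "S \<in> vp n \<Longrightarrow> T \<in> V \<Longrightarrow> S \<circ> T \<in> vp (Suc n)"
  unfolding vp.simps by blast

lemma vpH: "T \<in> vp n \<Longrightarrow> T \<in> H"
  by (induction n arbitrary: T) (auto intro: comp VH)

lemma finv_comp: "S \<in> H \<Longrightarrow> T \<in> H \<Longrightarrow> finv (S \<circ> T) = finv T \<circ> finv S"
  by (rule o_inv_distrib) (auto intro: bij)

text \<open>The last factor absorbs the change: \<open>S = R \<circ> (finv R \<circ> S)\<close>,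
  whose second factor agrees almost everywhere with the old one.\<close>

lemma vp_ae:
  assumes "T \<in> vp n" "S \<in> H" "AE x in M. S x = T x" shows "S \<in> vp n"
  using assms
proof (induction n arbitrary: T S)
  case 0
  have "AE x in M. S x = T x" "AE x in M. T x = x" using 0 by auto
  then have "AE x in M. S x = x" by eventually_elim simp
  then show ?case using 0 by simp
next
  case (Suc n)
  then obtain R v where R: "R \<in> vp n" "v \<in> V" "T = R \<circ> v" by auto
  have RH: "R \<in> H" using vpH R by auto
  have "finv R \<circ> S \<in> V"
  proof (rule Vae[OF R(2)])
    show "finv R \<circ> S \<in> H" using RH Suc.prems(2) comp invc by auto
    show "AE x in M. (finv R \<circ> S) x = v x" using Suc.prems(3)
      by eventually_elim (simp add: R(3) RH)
  qed
  moreover have "S = R \<circ> (finv R \<circ> S)" using RH by auto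
  ultimately show ?case using R(1) by auto
qed

lemma vp_1: "T \<in> V \<Longrightarrow> T \<in> vp 1"
  using vp_SucI[of id 0 T] one by simp

lemma vp_add: "S \<in> vp m \<Longrightarrow> T \<in> vp n \<Longrightarrow> S \<circ> T \<in> vp (m + n)"
proof (induction n arbitrary: T)
  case 0
  then have "AE x in M. T x = x" "T \<in> H" by auto
  then have "AE x in M. (S \<circ> T) x = S x" by (auto elim: eventually_mono)
  then have "S \<circ> T \<in> vp m" using vp_ae[OF 0(1) comp[OF vpH[OF 0(1)] \<open>T \<in> H\<close>]] by blast
  then show ?case by (simp only: add_0_right)
next
  case (Suc n)
  then obtain R v where R: "R \<in> vp n" "v \<in> V" "T = R \<circ> v" by auto
  have "S \<circ> R \<in> vp (m + n)" by (rule Suc.IH[OF Suc.prems(1) R(1)])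
  moreover have "S \<circ> T = (S \<circ> R) \<circ> v" using R by (simp add: comp_assoc)
  ultimately show ?case unfolding add_Suc_right using vp_SucI R(2) by metis
qed

lemma vp_inv: "T \<in> vp n \<Longrightarrow> finv T \<in> vp n"
proof (induction n arbitrary: T)
  case 0
  then show ?case using invc by (auto elim: eventually_mono) (smt (verit) AE_mp AE_I2 invL)
next
  case (Suc n)
  then obtain R v where R: "R \<in> vp n" "v \<in> V" "T = R \<circ> v" by auto
  have "finv T = finv v \<circ> finv R" using R finv_comp vpH VH by auto
  moreover have "finv v \<circ> finv R \<in> vp (1 + n)" using R Suc vp_1 Vinv by (intro vp_add) auto
  ultimately show ?case by (simp only: plus_1_eq_Suc)
qed

lemma vp_quot: "v \<in> V \<Longrightarrow> v' \<in> V \<Longrightarrow> finv v \<circ> v' \<in> vp 2"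
  using vp_add[OF vp_1[OF Vinv] vp_1] by (simp add: numeral_2_eq_2)

text \<open>The powers of \<open>V\<close> need not increase, because the identity may be missing
  from \<open>V\<close>; inserting \<open>finv v \<circ> v\<close> raises the exponent by 2.\<close>

lemma vp_even: "T \<in> vp n \<Longrightarrow> T \<in> vp (n + 2 * j)"
proof (induction j)
  case (Suc j)
  obtain v where v: "v \<in> V" using cov[OF one] by auto
  have "T \<circ> (finv v \<circ> v) \<in> vp (n + 2 * j + 2)" using Suc vp_quot[OF v v] by (intro vp_add) auto
  moreover have "T \<circ> (finv v \<circ> v) = T" using VH[OF v] by auto
  ultimately show ?case by (simp add: add.assoc)
qed auto

lemma vp_mono: "T \<in> vp m \<Longrightarrow> m \<le> n \<Longrightarrow> even (n - m) \<Longrightarrow> T \<in> vp n"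
  using vp_even[of T m "(n - m) div 2"] by auto

text \<open>Choose for each \<open>S\<close> a translate containing \<open>h S\<close>. By Cantor's
  theorem the choice of indices is not injective on sets of naturals, and for two elements of one
  translate \<open>k n\<close> cancels in the quotient.\<close>

lemma pigeonhole:
  assumes "\<And>S :: nat set. h S \<in> H"
  obtains S S' where "S \<noteq> S'" "finv (h S) \<circ> h S' \<in> vp 2"
proof -
  have "\<forall>S. \<exists>n. \<exists>v\<in>V. h S = k n \<circ> v" using cov assms by blast
  then obtain n v where nv: "\<And>S. v S \<in> V" "\<And>S. h S = k (n S) \<circ> v S" by metis
  have "\<not> inj n"
  proof
    assume "inj n"
    then have "range (inv_into UNIV n) = Pow UNIV" by (simp add: inj_imp_surj_inv)
    then show False using Cantors_theorem by blast
  qed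
  then obtain S S' where S: "S \<noteq> S'" "n S = n S'" by (auto simp: inj_def)
  have "finv (h S) \<circ> h S' = (finv (v S) \<circ> finv (k (n S))) \<circ> (k (n S') \<circ> v S')"
    using nv finv_comp kH VH by simp
  also have "\<dots> = finv (v S) \<circ> v S'" using S(2) kH by (auto simp: fun_eq_iff)
  finally show ?thesis using that[OF S(1)] vp_quot nv by simp
qed

text \<open>Suppose that for each n some \<open>T n\<close> supported in \<open>Z n\<close> is
  matched there by no element of \<open>k n \<circ> V\<close>. Gluing the \<open>T n\<close> over
  the disjoint \<open>Z n\<close> gives an element of the group, which lies in some translate, and
  that translate matches its own \<open>T n\<close>.\<close>

lemma ex_lift:
  obtains A where "A \<in> sets M" "emeasure M A = \<infinity>" "emeasure M (space M - A) = \<infinity>"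
    "\<And>T. T \<in> H \<Longrightarrow> fx T (space M - A) \<Longrightarrow> \<exists>w\<in>vp 2. AE x in M. x \<in> A \<longrightarrow> w x = T x"
proof -
  obtain Z :: "nat \<Rightarrow> 'a set" where Z: "\<And>n. Z n \<in> sets M" "disjoint_family Z" "(\<Union>n. Z n) = space M"
    "\<And>n. emeasure M (Z n) = \<infinity>" using split_infinite[OF sets.top inf] by blast
  have "\<exists>n. \<forall>T\<in>H. fx T (space M - Z n) \<longrightarrow> (\<exists>v\<in>V. AE x in M. x \<in> Z n \<longrightarrow> k n (v x) = T x)"
  proof (rule ccontr)
    assume "\<not> ?thesis"
    then have "\<forall>n. \<exists>T\<in>H. fx T (space M - Z n) \<and> \<not> (\<exists>v\<in>V. AE x in M. x \<in> Z n \<longrightarrow> k n (v x) = T x)"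
      by blast
    then obtain T where T: "\<And>n. T n \<in> H" "\<And>n. fx (T n) (space M - Z n)"
      "\<And>n. \<not> (\<exists>v\<in>V. AE x in M. x \<in> Z n \<longrightarrow> k n (v x) = T n x)" by metis
    have "piso (glue Z T) (\<Union>n. Z n) (\<Union>n. Z n)"
      by (rule piso_glue[OF _ Z(2,2)]) (rule piso_H[OF T(1) Z(1,1) fx_sends[OF T(1,2)]])
    then obtain S where S: "S \<in> H" "AE x in M. S x = glue Z T x" unfolding Z(3) by (rule piso_realize)
    then obtain n v where nv: "v \<in> V" "S = k n \<circ> v" using cov by blast
    have "AE x in M. x \<in> Z n \<longrightarrow> k n (v x) = T n x"
      using S(2) by eventually_elim (auto simp: nv(2) glue_eq[OF Z(2)])
    then show False using T(3) nv(1) by blast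
  qed
  then obtain n where n: "\<And>T. T \<in> H \<Longrightarrow> fx T (space M - Z n) \<Longrightarrow> \<exists>v\<in>V. AE x in M. x \<in> Z n \<longrightarrow> k n (v x) = T x"
    by blast
  show ?thesis
  proof (rule that[of "Z n"])
    have "emeasure M (Z (Suc n)) \<le> emeasure M (space M - Z n)"
      using Z(1) Z(3) disjoint_family_onD[OF Z(2), of "Suc n" n] by (intro emeasure_mono) auto
    then show "emeasure M (space M - Z n) = \<infinity>" using Z(4) by (simp add: top_unique)
    fix T assume T: "T \<in> H" "fx T (space M - Z n)"
    obtain v where v: "v \<in> V" "AE x in M. x \<in> Z n \<longrightarrow> k n (v x) = T x" using n[OF T] by auto
    have "fx id (space M - Z n)" by (rule fx_exact) simp
    \<comment> \<open>Lifting the identity as well gives \<open>u\<close> with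
      \<open>k n \<circ> u\<close> trivial on \<open>Z n\<close>. In \<open>finv u \<circ> v\<close>
      the unknown \<open>k n\<close> disappears, at the price of a second factor from
      \<open>V\<close>.\<close>
    from n[OF one this] obtain u where u: "u \<in> V" "AE x in M. x \<in> Z n \<longrightarrow> k n (u x) = x" by auto
    show "\<exists>w\<in>vp 2. AE x in M. x \<in> Z n \<longrightarrow> w x = T x"
    proof (rule bexI[OF _ vp_quot[OF u(1) v(1)]])
      show "AE x in M. x \<in> Z n \<longrightarrow> (finv u \<circ> v) x = T x"
        using v(2) AE_H[OF T(1) u(2)] fx_sends[OF T, unfolded sends_def]
      proof eventually_elim
        case (elim x)
        have uH: "u \<in> H" using VH u by auto
        show ?case
        proof
          assume "x \<in> Z n"
          then have "k n (v x) = k n (u (T x))" using elim by simp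
          then have "v x = u (T x)" using injH[OF kH] by simp
          then show "(finv u \<circ> v) x = T x" using uH by simp
        qed
      qed
    qed
  qed (use Z in auto)
qed

end

section \<open>Elements supported in a set on which everything lifts\<close>

locale lifted = syndetic +
  fixes A
  assumes Am: "A \<in> sets M" and Ainf: "emeasure M A = \<infinity>" and Acinf: "emeasure M (space M - A) = \<infinity>"
    and lift: "\<And>T. T \<in> H \<Longrightarrow> fx T (space M - A) \<Longrightarrow> \<exists>w\<in>vp 2. AE x in M. x \<in> A \<longrightarrow> w x = T x"
begin

definition GA :: "('a \<Rightarrow> 'a) set" where
  "GA = {T \<in> H. fx T (space M - A)}"

lemma GA_H: "T \<in> GA \<Longrightarrow> T \<in> H" by (simp add: GA_def)
lemma GA_sends: "T \<in> GA \<Longrightarrow> sends T A A" by (simp add: GA_def fx_sends)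
lemma GA_comp: "S \<in> GA \<Longrightarrow> T \<in> GA \<Longrightarrow> S \<circ> T \<in> GA" by (simp add: GA_def comp fx_comp del: o_apply)
text \<open>The behaviour of the lift \<open>w\<close> off \<open>A\<close> cancels:
  \<open>w\<close> preserves the complement of \<open>A\<close> and \<open>g\<close> is trivial
  there. So conjugating by \<open>w\<close> or by \<open>T\<close> gives the same map, and
  \<open>w\<close> and its inverse cost 2 each.\<close>

lemma conj_vp:
  assumes g: "g \<in> vp j" "g \<in> GA" and T: "T \<in> GA"
  shows "T \<circ> g \<circ> finv T \<in> vp (j + 4)"
proof -
  have TH: "T \<in> H" and gH: "g \<in> H" using T g GA_H by auto
  obtain w where w: "w \<in> vp 2" "AE x in M. x \<in> A \<longrightarrow> w x = T x" using lift T by (auto simp: GA_def)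
  have wH: "w \<in> H" using w vpH by auto
  have wA: "sends w A A" by (rule sends_agree[OF TH wH GA_sends[OF T] w(2)])
  have c: "w \<circ> g \<circ> finv w \<in> vp (2 + j + 2)" using w g by (intro vp_add vp_inv)
  have "AE x in M. x \<notin> A \<longrightarrow> T x = x" "AE x in M. x \<notin> A \<longrightarrow> g x = x"
    using T g AE_space by (auto simp: GA_def fx_def elim: eventually_elim2)
  note f = this
  have main: "AE y in M. T (g y) = w (g (finv w (T y)))"
    using f(1) f(2) AE_H[OF invc[OF wH] f(2)] w(2) AE_H[OF gH w(2)]
      AE_H[OF invc[OF wH] wA[unfolded sends_def]] GA_sends[OF g(2), unfolded sends_def]
  proof eventually_elim
    case (elim y)
    show ?case
    proof (cases "y \<in> A")
      case True
      then have "g y \<in> A" using elim(7) by blast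
      then have "w (g y) = T (g y)" using elim(5) by blast
      moreover have "finv w (T y) = y" using True elim(4) wH by (metis invL)
      ultimately show ?thesis by simp
    next
      case False
      then have "finv w y \<notin> A" using elim(6) wH by simp
      then have "g (finv w y) = finv w y" using elim(3) by blast
      then show ?thesis using False elim(1,2) wH by simp
    qed
  qed
  have "AE x in M. (T \<circ> g \<circ> finv T) x = (w \<circ> g \<circ> finv w) x"
    using AE_H[OF invc[OF TH] main] by eventually_elim (simp add: TH)
  moreover have "T \<circ> g \<circ> finv T \<in> H" using TH gH comp invc by blast
  moreover have "2 + j + 2 = j + 4" by simp
  ultimately show ?thesis using vp_ae[OF c] by metis
qed

text \<open>The involutions \<open>t S\<close> multiply like sets of naturals under symmetric
  difference. The quotient of two of them in one translate is hence \<open>t ?D\<close> with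
  \<open>?D\<close> nonempty, which is again a swap of infinite sets.\<close>

lemma ex_small_swap:
  obtains s P Q where "s \<in> vp 2" "is_swap A s P Q"
proof -
  obtain Z :: "nat \<Rightarrow> 'a set" where Z: "\<And>n. Z n \<in> sets M" "disjoint_family Z" "(\<Union>n. Z n) = A"
    "\<And>n. emeasure M (Z n) = \<infinity>" using split_infinite[OF Am Ainf] by blast
  \<comment> \<open>The indices start at 1: \<open>Z 0\<close> stays out of every swap and keeps the
    remainder of \<open>A\<close> infinite.\<close>
  define P where "P n = Z (2 * n + 1)" for n
  define Q where "Q n = Z (2 * n + 2)" for n
  have odd_even: "2 * i + 1 \<noteq> 2 * j + 2" for i j :: nat by presburger
  have dP: "disjoint_family P" and dQ: "disjoint_family Q"
    using Z(2) by (auto simp: disjoint_family_on_def P_def Q_def)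
  have PQ: "P i \<inter> Q j = {}" for i j
    using disjoint_family_onD[OF Z(2), of "2 * i + 1" "2 * j + 2"] odd_even by (simp add: P_def Q_def)
  have "\<exists>\<phi>. piso \<phi> (P i) (Q i)" for i unfolding P_def Q_def by (rule piso_infinite) (rule Z)+
  then obtain s where s: "s \<in> H" "\<And>x. s (s x) = x" "\<And>i. sends s (P i) (Q i)"
    using multi_swap[OF dP dQ PQ] by metis
  \<comment> \<open>Passing to this conull part of \<open>P n\<close> makes \<open>s\<close> carry
    it into \<open>Q n\<close> exactly, so that the identities for \<open>X\<close> and
    \<open>t\<close> hold at every point.\<close>
  define W where "W n = P n \<inter> s -` Q n" for n
  have Wm: "W n \<in> sets M" for n using Z(1) img'[OF s(1)] by (auto simp: W_def P_def Q_def)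
  have WP: "W n \<subseteq> P n" "s ` W n \<subseteq> Q n" for n by (auto simp: W_def)
  have Wi: "emeasure M (W n) = \<infinity>" for n
  proof -
    have "AE x in M. x \<in> P n \<longleftrightarrow> x \<in> W n"
      using s(3)[of n] unfolding sends_def by eventually_elim (auto simp: W_def)
    then have "emeasure M (P n) = emeasure M (W n)" using Z Wm by (intro emeasure_eq_AE) (auto simp: P_def)
    then show ?thesis using Z(4) by (simp add: P_def)
  qed
  define X where "X S = (\<Union>n\<in>S. W n \<union> s ` W n)" for S
  have Xm: "X S \<in> sets M" for S using Wm img[OF s(1)] by (auto simp: X_def)
  have sW: "s x \<in> W n \<longleftrightarrow> x \<in> s ` W n" for x n using s(2) by (metis imageE imageI)
  have sW': "s x \<in> s ` W n \<longleftrightarrow> x \<in> W n" for x n using injH[OF s(1)] by auto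
  have sX: "s x \<in> X S \<longleftrightarrow> x \<in> X S" for x S unfolding X_def by (auto simp: sW sW')
  have XI: "x \<in> X (S \<inter> S')" if "x \<in> X S" "x \<in> X S'" for x S S'
  proof -
    obtain m n where mn: "m \<in> S" "n \<in> S'" "x \<in> W m \<union> s ` W m" "x \<in> W n \<union> s ` W n"
      using \<open>x \<in> X S\<close> \<open>x \<in> X S'\<close> unfolding X_def by blast
    have "x \<in> P m \<union> Q m" "x \<in> P n \<union> Q n" using mn(3,4) WP[of m] WP[of n] by blast+
    then have "m = n" using PQ[of m n] PQ[of n m] disjoint_family_onD[OF dP, of m n] disjoint_family_onD[OF dQ, of m n]
      by blast
    then show ?thesis using mn unfolding X_def by blast
  qed
  have XU: "x \<in> X (S \<union> S') \<longleftrightarrow> x \<in> X S \<or> x \<in> X S'" for x S S' unfolding X_def by blast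
  have Xd: "x \<in> X (sym_diff S S') \<longleftrightarrow> (x \<in> X S \<longleftrightarrow> x \<notin> X S')" for x S S'
  proof -
    have e: "X {} = {}" by (simp add: X_def)
    have "x \<notin> X S'" if "x \<in> X (S - S')" using XI[OF that, of S'] e by (auto simp: Int_commute)
    moreover have "x \<notin> X S" if "x \<in> X (S' - S)" using XI[OF that, of S] e by (auto simp: Int_commute)
    moreover have "x \<in> X S \<longleftrightarrow> x \<in> X (S - S') \<or> x \<in> X (S \<inter> S')" using XU[of x "S - S'" "S \<inter> S'"] by (simp add: Un_Diff_Int)
    moreover have "x \<in> X S' \<longleftrightarrow> x \<in> X (S' - S) \<or> x \<in> X (S \<inter> S')" using XU[of x "S' - S" "S \<inter> S'"] by (simp add: Un_Diff_Int Int_commute)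
    ultimately show ?thesis using XU[of x "S - S'" "S' - S"] by blast
  qed
  define t where "t S x = (if x \<in> X S then s x else x)" for S x
  have tt: "t S (t S x) = x" for S x using s(2) sX by (auto simp: t_def)
  have tH: "t S \<in> H" for S
  proof (rule pw_paste)
    show "bij (t S)" by (rule o_bij[of "t S"]) (auto simp: tt)
    show "t S x = x" if "x \<notin> space M" for x using off[OF s(1) that] by (simp add: t_def)
    have "pw (t S) (X S)" by (rule pw_cong[OF pw_H[OF s(1) Xm]]) (simp add: t_def)
    moreover have "pw (t S) (space M - X S)" by (rule pw_cong[OF pw_H[OF one]]) (use Xm in \<open>auto simp: t_def\<close>)
    ultimately have "pw (t S) (X S \<union> (space M - X S))" by (rule pw_Un)
    moreover have "X S \<union> (space M - X S) = space M" using sets.sets_into_space[OF Xm[of S]] by auto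
    ultimately show "pw (t S) (space M)" by simp
  qed
  obtain S S' where S: "S \<noteq> S'" "finv (t S) \<circ> t S' \<in> vp 2" by (rule pigeonhole[OF tH])
  let ?D = "sym_diff S S'"
  have "finv (t S) \<circ> t S' = t ?D"
  proof
    fix x
    have "finv (t S) = t S" by (rule finv_invol) (rule tt)
    then show "(finv (t S) \<circ> t S') x = t ?D x"
      using Xd[of x S S'] sX s(2) by (auto simp: t_def simp del: Un_iff Diff_iff)
  qed
  then have v2: "t ?D \<in> vp 2" using S(2) by simp
  define P0 where "P0 = (\<Union>n\<in>?D. W n)"
  have P0m: "P0 \<in> sets M" using Wm by (auto simp: P0_def)
  have XD: "X ?D = P0 \<union> s ` P0" by (auto simp: X_def P0_def)
  have sQ: "s ` P0 \<subseteq> (\<Union>n. Q n)" using WP(2) unfolding P0_def by blast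
  have PP: "P0 \<subseteq> (\<Union>n. P n)" using WP(1) unfolding P0_def by blast
  have "is_swap A (t ?D) P0 (s ` P0)"
    unfolding is_swap_def
  proof (intro conjI allI impI)
    show "t ?D \<in> H" by (rule tH)
    show "t ?D (t ?D x) = x" for x by (rule tt)
    show "sends (t ?D) P0 (s ` P0)"
      unfolding sends_def
    proof (rule AE_I2)
      fix x
      show "x \<in> P0 \<longleftrightarrow> t ?D x \<in> s ` P0"
      proof
        assume "x \<in> P0"
        then have "t ?D x = s x" using XD by (simp add: t_def del: Un_iff Diff_iff) blast
        then show "t ?D x \<in> s ` P0" using \<open>x \<in> P0\<close> by simp
      next
        assume "t ?D x \<in> s ` P0"
        then obtain p where p: "p \<in> P0" "t ?D x = s p" by auto
        then have "t ?D p = s p" using XD by (simp add: t_def del: Un_iff Diff_iff) blast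
        then have "x = p" using p(2) injH[OF tH] by metis
        then show "x \<in> P0" using p by simp
      qed
    qed
    show "P0 \<in> sets M" by (rule P0m)
    show "s ` P0 \<in> sets M" by (rule img[OF s(1) P0m])
    show "P0 \<inter> s ` P0 = {}" using sQ PP PQ by blast
    show "P0 \<union> s ` P0 \<subseteq> A" using sQ PP Z(3) unfolding P_def Q_def by blast
    show "t ?D x = x" if "x \<notin> P0 \<union> s ` P0" for x using that XD by (simp add: t_def del: Un_iff Diff_iff)
    obtain n where n: "n \<in> ?D" using S(1) by blast
    have "emeasure M (W n) \<le> emeasure M P0" using n P0m by (intro emeasure_mono) (auto simp: P0_def)
    then show "emeasure M P0 = \<infinity>" using Wi by (simp add: top_unique)
    have "Z 0 \<inter> P n = {}" "Z 0 \<inter> Q n = {}" for n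
      using disjoint_family_onD[OF Z(2), of 0] by (auto simp: P_def Q_def)
    then have "Z 0 \<subseteq> A - (P0 \<union> s ` P0)" using sQ PP Z(3) by blast
    then have "emeasure M (Z 0) \<le> emeasure M (A - (P0 \<union> s ` P0))"
      using P0m img[OF s(1) P0m] Am by (intro emeasure_mono) auto
    then show "emeasure M (A - (P0 \<union> s ` P0)) = \<infinity>" using Z(4) by (simp add: top_unique)
  qed
  then show ?thesis using that v2 by blast
qed

lemma is_swap_GA: assumes "is_swap A s P Q" shows "s \<in> GA"
proof -
  have "s x = x" if "x \<in> space M - A" for x using assms that unfolding is_swap_def by blast
  then show ?thesis using assms by (auto simp: GA_def is_swap_def intro: fx_exact)
qed

text \<open>\<open>s\<close> is already conjugate inside \<open>A\<close> to one cheap swap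
  \<open>s0\<close>, so a further conjugation by \<open>a\<close> is just another conjugate of
  \<open>s0\<close>. One application of \<open>conj_vp\<close> suffices, and the cost is 2 + 4 for
  every conjugate.\<close>

lemma conj_swap_vp:
  assumes "is_swap A s P Q" "a \<in> GA"
  shows "a \<circ> s \<circ> finv a \<in> vp 6"
proof -
  obtain s0 P0 Q0 where s0: "s0 \<in> vp 2" "is_swap A s0 P0 Q0" by (rule ex_small_swap)
  obtain U where U: "U \<in> H" "fx U (space M - A)" "AE x in M. s (U x) = U (s0 x)"
    using is_swap_conj[OF Am s0(2) assms(1)] by blast
  have UG: "U \<in> GA" using U by (simp add: GA_def)
  have aH: "a \<in> H" using assms GA_H by auto
  have sH: "s \<in> H" using is_swap_GA[OF assms(1)] GA_H by auto
  have b: "a \<circ> U \<in> GA" using assms UG GA_comp by auto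
  have "(a \<circ> U) \<circ> s0 \<circ> finv (a \<circ> U) \<in> vp (2 + 4)"
    by (rule conj_vp[OF s0(1) is_swap_GA[OF s0(2)] b])
  moreover have "AE x in M. (a \<circ> s \<circ> finv a) x = ((a \<circ> U) \<circ> s0 \<circ> finv (a \<circ> U)) x"
    using AE_H[OF comp[OF invc[OF U(1)] invc[OF aH]] U(3)]
    by eventually_elim (simp add: finv_comp aH U(1))
  moreover have "a \<circ> s \<circ> finv a \<in> H" using aH sH comp invc by blast
  ultimately show ?thesis using vp_ae by fastforce
qed

lemma swap_vp: assumes "is_swap A s P Q" shows "s \<in> vp 6"
proof -
  have "id \<in> GA" using one by (auto simp: GA_def intro: fx_exact)
  from conj_swap_vp[OF assms this] show ?thesis by simp
qed


lemma emeasure_diff_inf: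
  assumes "E \<in> sets M" "F \<in> sets M" "emeasure M E = \<infinity>" "emeasure M F < \<infinity>"
  shows "emeasure M (E - F) = \<infinity>"
proof (rule ccontr)
  assume "emeasure M (E - F) \<noteq> \<infinity>"
  then have "emeasure M (E - F) + emeasure M F < \<infinity>" using assms(4) by (simp add: less_top)
  moreover have "emeasure M E \<le> emeasure M ((E - F) \<union> F)" using assms by (intro emeasure_mono) auto
  moreover have "emeasure M ((E - F) \<union> F) \<le> emeasure M (E - F) + emeasure M F"
    using assms by (intro emeasure_subadditive) auto
  ultimately show False using assms(3) by (metis leD le_less_trans)
qed

lemma emeasure_inf_mono: "emeasure M E = \<infinity> \<Longrightarrow> E \<subseteq> F \<Longrightarrow> F \<in> sets M \<Longrightarrow> emeasure M F = \<infinity>"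
  using emeasure_mono[of E F M] by (simp add: top_unique)

lemma is_swapI:
  assumes "s \<in> H" "\<And>x. s (s x) = x" "sends s P Q" "\<And>x. x \<notin> P \<union> Q \<Longrightarrow> s x = x"
    "P \<in> sets M" "Q \<in> sets M" "P \<inter> Q = {}" "P \<union> Q \<subseteq> B" "emeasure M P = \<infinity>"
    "B \<in> sets M" "E \<subseteq> B - (P \<union> Q)" "emeasure M E = \<infinity>"
  shows "is_swap B s P Q"
proof -
  have "emeasure M (B - (P \<union> Q)) = \<infinity>"
    by (rule emeasure_inf_mono[OF assms(12,11)]) (use assms(5,6,10) in auto)
  then show ?thesis using assms(1-9) unfolding is_swap_def by blast
qed

lemma emeasure_inf_Un:
  assumes "E \<in> sets M" "F \<in> sets M" "emeasure M (E \<union> F) = \<infinity>"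
  shows "emeasure M E = \<infinity> \<or> emeasure M F = \<infinity>"
  using emeasure_subadditive[OF assms(1,2)] assms(3) by (auto simp: top_unique)

lemma ex_sends:
  assumes "P \<in> sets M" "Q \<in> sets M" "emeasure M P = \<infinity>" "emeasure M Q = \<infinity>"
    "emeasure M (space M - P) = \<infinity>" "emeasure M (space M - Q) = \<infinity>"
  obtains T where "T \<in> H" "sends T P Q"
proof -
  obtain \<phi> where f: "piso \<phi> P Q" using piso_infinite[OF assms(1,3,2,4)] by auto
  obtain \<psi> where g: "piso \<psi> (space M - P) (space M - Q)"
    using piso_infinite[OF _ assms(5) _ assms(6)] assms by auto
  have "piso (\<lambda>x. if x \<in> P then \<phi> x else \<psi> x) (P \<union> (space M - P)) (Q \<union> (space M - Q))"
    by (rule piso_Un[OF f g]) auto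
  moreover have "P \<union> (space M - P) = space M" "Q \<union> (space M - Q) = space M"
    using assms sets.sets_into_space by auto
  ultimately have "piso (\<lambda>x. if x \<in> P then \<phi> x else \<psi> x) (space M) (space M)" by simp
  then obtain T where T: "T \<in> H" "AE x in M. T x = (if x \<in> P then \<phi> x else \<psi> x)"
    by (rule piso_realize)
  have "sends T P Q" unfolding sends_def
    using T(2) piso_maps[OF f] piso_maps[OF g] AE_space
  proof eventually_elim
    case (elim x)
    then show ?case by (cases "x \<in> P") simp_all
  qed
  then show ?thesis using that T by blast
qed

text \<open>\<open>D\<close> and its image under \<open>T\<close> may overlap, so in general no
  involution exchanging them copies \<open>T\<close> on \<open>D\<close>. A third set
  \<open>D'\<close> disjoint from both serves as a station: \<open>s2\<close> is taken to be
  \<open>T \<circ> s1\<close> on \<open>D'\<close>.\<close>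

lemma two_swaps:
  assumes T: "T \<in> H" and D: "D \<in> sets M" "D' \<in> sets M" and p: "piso \<psi> D D'"
    and dj: "D \<inter> D' = {}" "D' \<inter> T ` D = {}"
  obtains s1 s2 where "s1 \<in> H" "\<And>x. s1 (s1 x) = x" "sends s1 D D'" "\<And>x. x \<notin> D \<union> D' \<Longrightarrow> s1 x = x"
    "s2 \<in> H" "\<And>x. s2 (s2 x) = x" "sends s2 D' (T ` D)" "\<And>x. x \<notin> D' \<union> T ` D \<Longrightarrow> s2 x = x"
    "AE x in M. x \<in> D \<longrightarrow> s2 (s1 x) = T x"
proof -
  obtain s1 where s1: "s1 \<in> H" "\<And>x. s1 (s1 x) = x" "\<And>x. x \<notin> D \<union> D' \<Longrightarrow> s1 x = x" "sends s1 D D'"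
    by (rule piso_swap[OF p dj(1)]) blast
  have "piso (\<lambda>x. T (s1 x)) D' (T ` D)"
    by (rule piso_comp[OF piso_H[OF s1(1) D(2,1) sends_invol[OF s1(1,2,4)]]
      piso_H[OF T D(1) img[OF T D(1)] sends_id[OF T]]])
  then obtain s2 where s2: "s2 \<in> H" "\<And>x. s2 (s2 x) = x"
    "\<And>x. x \<notin> D' \<union> T ` D \<Longrightarrow> s2 x = x" "sends s2 D' (T ` D)" "AE x in M. x \<in> D' \<longrightarrow> s2 x = T (s1 x)"
    by (rule piso_swap[OF _ dj(2)]) blast
  have "AE x in M. x \<in> D \<longrightarrow> s2 (s1 x) = T x"
    using AE_H[OF s1(1) s2(5)] s1(4)[unfolded sends_def] by eventually_elim (simp add: s1(2))
  from that[OF s1(1,2,4,3) s2(1,2,4,3) this] show ?thesis by blast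
qed

end

context lifted
begin

text \<open>An Eilenberg swindle: \<open>T = a \<circ> u \<circ> a\<^sup>-\<^sup>1 \<circ> u\<^sup>-\<^sup>1\<close>, where the product \<open>u\<close> of two swaps shifts
  a sequence of disjoint sets \<open>E j\<close> and \<open>a\<close> acts on \<open>E j\<close> as the copy of \<open>T\<close> transported by \<open>u ^^ j\<close>.\<close>

lemma swindle:
  assumes T: "T \<in> H" and A0: "A0 \<in> sets M" "A0 \<subseteq> A" "emeasure M (A - A0) = \<infinity>"
    and f: "fx T (space M - A0)"
  shows "T \<in> vp 24"
proof -
  have "A - A0 \<in> sets M" using A0 Am by auto
  then obtain Z :: "nat \<Rightarrow> 'a set" where Z: "\<And>n. Z n \<in> sets M" "disjoint_family Z" "(\<Union>n. Z n) = A - A0"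
    "\<And>n. emeasure M (Z n) = \<infinity>" using split_infinite[OF _ A0(3)] by blast
  \<comment> \<open>\<open>Z 1\<close> makes \<open>E 0\<close> infinite even when \<open>A0\<close>
    is small. The \<open>O' j\<close> are stations through which the shift from \<open>E j\<close>
    to \<open>E (Suc j)\<close> splits into two involutions. \<open>Z 0\<close> meets none of these
    sets, so both swaps leave an infinite part of \<open>A\<close> alone.\<close>
  define E where "E j = (if j = 0 then A0 \<union> Z 1 else Z (2 * j + 1))" for j :: nat
  define O' where "O' j = Z (2 * j + 2)" for j :: nat
  have Em: "E j \<in> sets M" and Om: "O' j \<in> sets M" for j using Z A0 by (auto simp: E_def O'_def)
  have Ei: "emeasure M (E j) = \<infinity>" for j
  proof (rule emeasure_inf_mono[OF _ _ Em])
    show "emeasure M (Z (2 * j + 1)) = \<infinity>" by (rule Z)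
    show "Z (2 * j + 1) \<subseteq> E j" by (auto simp: E_def)
  qed
  have Oi: "emeasure M (O' j) = \<infinity>" for j by (simp add: O'_def Z)
  have ZA: "Z i \<inter> A0 = {}" "Z i \<subseteq> A" for i using Z(3) by blast+
  have Zd: "Z i \<inter> Z j = {}" if "i \<noteq> j" for i j using disjoint_family_onD[OF Z(2)] that by simp
  have oe: "2 * i + 1 \<noteq> 2 * j + 2" "0 \<noteq> 2 * i + 1" "0 \<noteq> 2 * i + 2" for i j :: nat by presburger+
  have EO: "E i \<inter> O' j = {}" for i j
    using Zd[OF oe(1), of i j] Zd[of 1 "2*j+2"] ZA(1)[of "2*j+2"] by (auto simp: E_def O'_def)
  have dE: "E i \<inter> E j = {}" if "i \<noteq> j" for i j
    using Zd[of "2*i+1" "2*j+1"] Zd[of 1 "2*j+1"] Zd[of "2*i+1" 1] ZA(1)[of "2*j+1"] ZA(1)[of "2*i+1"] that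
    unfolding E_def by (cases "i = 0"; cases "j = 0") auto
  have dO: "O' i \<inter> O' j = {}" if "i \<noteq> j" for i j using Zd[of "2*i+2" "2*j+2"] that by (simp add: O'_def)
  have EA: "E j \<subseteq> A" and OA: "O' j \<subseteq> A" for j using ZA(2) A0(2) by (auto simp: E_def O'_def)
  have Z0: "Z 0 \<inter> E j = {}" "Z 0 \<inter> O' j = {}" for j
    using Zd[OF oe(2), of j] Zd[OF oe(3), of j] Zd[of 0 1] ZA(1)[of 0] by (auto simp: E_def O'_def)
  have df: "disjoint_family E" "disjoint_family O'" "disjoint_family (\<lambda>i. E (Suc i))"
    using dE dO by (simp_all add: disjoint_family_on_def)
  obtain s1 where s1: "s1 \<in> H" "\<And>x. s1 (s1 x) = x" "\<And>i. sends s1 (E i) (O' i)"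
    "sends s1 (\<Union>i. E i) (\<Union>i. O' i)" "\<And>x. x \<notin> (\<Union>i. E i) \<union> (\<Union>i. O' i) \<Longrightarrow> s1 x = x"
    using multi_swap[OF df(1,2) EO piso_infinite[OF Em Ei Om Oi]] by blast
  have OE: "O' i \<inter> E (Suc j) = {}" for i j using EO by blast
  obtain s2 where s2: "s2 \<in> H" "\<And>x. s2 (s2 x) = x" "\<And>i. sends s2 (O' i) (E (Suc i))"
    "sends s2 (\<Union>i. O' i) (\<Union>i. E (Suc i))" "\<And>x. x \<notin> (\<Union>i. O' i) \<union> (\<Union>i. E (Suc i)) \<Longrightarrow> s2 x = x"
    using multi_swap[OF df(2,3) OE piso_infinite[OF Om Oi Em Ei]] by blast
  have UEm: "(\<Union>i. E i) \<in> sets M" "(\<Union>i. O' i) \<in> sets M" "(\<Union>i. E (Suc i)) \<in> sets M" using Em Om by auto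
  have UZ: "Z 0 \<subseteq> A - ((\<Union>i. E i) \<union> (\<Union>i. O' i))" "Z 0 \<subseteq> A - ((\<Union>i. O' i) \<union> (\<Union>i. E (Suc i)))"
    using Z0 ZA(2)[of 0] by blast+
  have UEi: "emeasure M (\<Union>i. E i) = \<infinity>" "emeasure M (\<Union>i. O' i) = \<infinity>"
    by (rule emeasure_inf_mono[OF Ei[of 0] _ UEm(1)], blast) (rule emeasure_inf_mono[OF Oi[of 0] _ UEm(2)], blast)
  have dU: "(\<Union>i. E i) \<inter> (\<Union>i. O' i) = {}" "(\<Union>i. O' i) \<inter> (\<Union>i. E (Suc i)) = {}"
    using EO by blast+
  have UA: "(\<Union>i. E i) \<union> (\<Union>i. O' i) \<subseteq> A" "(\<Union>i. O' i) \<union> (\<Union>i. E (Suc i)) \<subseteq> A"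
    using EA OA by blast+
  have sw1: "is_swap A s1 (\<Union>i. E i) (\<Union>i. O' i)"
    by (rule is_swapI[OF s1(1,2,4,5) UEm(1,2) dU(1) UA(1) UEi(1) Am UZ(1) Z(4)])
  have sw2: "is_swap A s2 (\<Union>i. O' i) (\<Union>i. E (Suc i))"
    by (rule is_swapI[OF s2(1,2,4,5) UEm(2,3) dU(2) UA(2) UEi(2) Am UZ(2) Z(4)])
  define u where "u x = s2 (s1 x)" for x
  have u_comp: "u = s2 \<circ> s1" by (auto simp: u_def)
  have uH: "u \<in> H" unfolding u_comp by (rule comp[OF s2(1) s1(1)])
  have uE: "sends u (E j) (E (Suc j))" for j
    using sends_comp[OF s1(1) s1(3) s2(3)] by (simp add: u_def[abs_def])
  define g where "g = rec_nat T (\<lambda>_ h x. u (h (finv u x)))"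
  have g0: "g 0 = T" and gS: "g (Suc j) = (\<lambda>x. u (g j (finv u x)))" for j by (auto simp: g_def)
  have gH: "g j \<in> H" for j
  proof (induction j)
    case (Suc j)
    have "u \<circ> g j \<circ> finv u \<in> H" using uH Suc comp invc by blast
    then show ?case by (simp add: gS comp_def)
  qed (simp add: g0 T)
  have gE: "sends (g j) (E j) (E j)" for j
  proof (induction j)
    case 0
    have "fx T (space M - E 0)" by (rule fx_mono[OF f]) (auto simp: E_def)
    then show ?case unfolding g0 by (rule fx_sends[OF T])
  next
    case (Suc j)
    have "sends (\<lambda>x. g j (finv u x)) (E (Suc j)) (E j)"
      by (rule sends_comp[OF invc[OF uH] sends_inv[OF uH uE] Suc])
    from sends_comp[OF _ this uE] show ?case
      using comp[OF gH[of j] invc[OF uH]] by (simp add: gS comp_def)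
  qed
  define F where "F j = (case j of 0 \<Rightarrow> space M - (\<Union>i. E i) | Suc i \<Rightarrow> E i)" for j
  define h where "h j = (case j of 0 \<Rightarrow> (\<lambda>x. x) | Suc i \<Rightarrow> g i)" for j
  have Fs: "F 0 = space M - (\<Union>i. E i)" "\<And>i. F (Suc i) = E i" "h 0 = (\<lambda>x. x)" "\<And>i. h (Suc i) = g i"
    by (auto simp: F_def h_def)
  have F0: "F 0 \<inter> E i = {}" for i unfolding Fs by blast
  have dF: "disjoint_family F"
    unfolding disjoint_family_on_def
  proof (intro ballI impI)
    fix m n :: nat assume "m \<noteq> n"
    then show "F m \<inter> F n = {}" using F0 dE by (cases m; cases n) (auto simp: Fs(2))
  qed
  have UF: "(\<Union>j. F j) = space M"
  proof (intro equalityI subsetI)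
    fix x assume "x \<in> (\<Union>j. F j)"
    then obtain j where "x \<in> F j" by auto
    then show "x \<in> space M" using sets.sets_into_space[OF Em] by (cases j) (auto simp: Fs)
  next
    fix x assume "x \<in> space M"
    then have "x \<in> F 0 \<or> (\<exists>i. x \<in> F (Suc i))" by (auto simp: Fs)
    then show "x \<in> (\<Union>j. F j)" by blast
  qed
  have "piso (h j) (F j) (F j)" for j
  proof (cases j)
    case 0
    then show ?thesis using UEm(1) by (simp add: Fs piso_id)
  next
    case (Suc i)
    then show ?thesis using piso_H[OF gH Em Em gE] by (simp add: Fs)
  qed
  from piso_glue[OF this dF dF] obtain a where a: "a \<in> H" "AE x in M. a x = glue F h x"
    unfolding UF by (rule piso_realize)
  have gl: "glue F h x = g i x" if "x \<in> E i" for x i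
    using glue_eq[OF dF, of x "Suc i" h] that by (simp add: Fs)
  have gl0: "glue F h x = x" if "x \<in> space M" "x \<notin> (\<Union>i. E i)" for x
    using glue_eq[OF dF, of x 0 h] that by (simp add: Fs)
  have "AE x in M. x \<in> space M - A \<longrightarrow> a x = x"
    using a(2)
  proof eventually_elim
    case (elim x)
    have "x \<notin> (\<Union>i. E i)" if "x \<notin> A" using that EA by blast
    then show ?case using elim gl0[of x] by simp
  qed
  then have aG: "a \<in> GA" using a(1) by (simp add: GA_def fx_def)
  have T0: "AE x in M. x \<in> space M - E 0 \<longrightarrow> T x = x"
    using fx_mono[OF f, of "space M - E 0"] by (auto simp: fx_def E_def)
  have uE': "AE x in M. \<forall>j. x \<in> E j \<longleftrightarrow> u x \<in> E (Suc j)"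
    using uE by (simp add: AE_all_countable sends_def)
  have gE': "AE x in M. \<forall>j. x \<in> E j \<longleftrightarrow> g j x \<in> E j"
    using gE by (simp add: AE_all_countable sends_def)
  have uaH: "u \<circ> a \<in> H" using uH a comp by blast
  \<comment> \<open>On \<open>E j\<close> both sides agree because
    \<open>g (Suc j) \<circ> u = u \<circ> g j\<close>, and \<open>T\<close> is trivial off
    \<open>E 0\<close>. A point outside all \<open>E i\<close> is fixed by \<open>a\<close>; if
    \<open>u\<close> sends it into some \<open>E i\<close>, then this is \<open>E 0\<close>, where
    \<open>a\<close> acts as \<open>T\<close>.\<close>
  have main: "AE x in M. a (u x) = T (u (a x))"
    using a(2) AE_H[OF uH a(2)] uE' AE_H[OF a(1) uE'] gE' AE_H[OF uaH T0] AE_H[OF uH T0] AE_space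
  proof eventually_elim
    case (elim x)
    have sp: "u x \<in> space M" "u (a x) \<in> space M" using elim(8) spaceH[OF uH] spaceH[OF a(1)] by auto
    show ?case
    proof (cases "x \<in> (\<Union>i. E i)")
      case True
      then obtain j where j: "x \<in> E j" by auto
      have ax: "a x = g j x" using elim(1) gl[OF j] by simp
      then have "a x \<in> E j" using elim(5) j by simp
      then have "u (a x) \<in> E (Suc j)" using elim(4) by blast
      then have "u (a x) \<notin> E 0" using dE[of 0 "Suc j"] by blast
      then have "T (u (a x)) = u (a x)" using elim(6) sp by simp
      moreover have "u x \<in> E (Suc j)" using elim(3) j by blast
      then have "a (u x) = g (Suc j) (u x)" using elim(2) gl by simp
      ultimately show ?thesis using ax by (simp add: gS uH)
    next
      case False
      then have ax: "a x = x" using elim(1,8) gl0 by simp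
      show ?thesis
      proof (cases "u x \<in> (\<Union>i. E i)")
        case True
        then obtain j where j: "u x \<in> E j" by auto
        then have "j = 0" using False elim(3) by (cases j) auto
        then have "a (u x) = T (u x)" using elim(2) gl[OF j] by (simp add: g0)
        then show ?thesis by (simp add: ax)
      next
        case F': False
        then have "a (u x) = u x" using elim(2) gl0[OF sp(1)] by simp
        moreover have "T (u x) = u x" using elim(7) F' sp(1) by blast
        ultimately show ?thesis by (simp add: ax)
      qed
    qed
  qed
  have i1: "finv s1 = s1" and i2: "finv s2 = s2" using finv_invol s1(2) s2(2) by blast+
  \<comment> \<open>With \<open>u = s2 \<circ> s1\<close> the commutator expands into two conjugated
    swaps and two plain ones, each of cost 6.\<close>
  have c: "(a \<circ> s2 \<circ> finv a) \<circ> (a \<circ> s1 \<circ> finv a) \<circ> s1 \<circ> s2 \<in> vp (6 + 6 + 6 + 6)"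
    by (rule vp_add[OF vp_add[OF vp_add[OF conj_swap_vp[OF sw2 aG] conj_swap_vp[OF sw1 aG]]
      swap_vp[OF sw1]] swap_vp[OF sw2]])
  have fu: "finv u x = s1 (s2 x)" for x
    by (rule inv_eqI[OF uH]) (simp add: u_def s1(2) s2(2))
  have "AE x in M. T x = ((a \<circ> s2 \<circ> finv a) \<circ> (a \<circ> s1 \<circ> finv a) \<circ> s1 \<circ> s2) x"
    using AE_H[OF comp[OF invc[OF a(1)] invc[OF uH]] main]
  proof eventually_elim
    case (elim x)
    have "T (u (a (finv a (finv u x)))) = T x" using a(1) uH by simp
    then show ?case using elim a(1) by (simp add: u_def fu)
  qed
  from vp_ae[OF c T this] show ?thesis by simp
qed

text \<open>Let \<open>h S\<close> carry the complement of \<open>A\<close> to \<open>D S\<close>,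
  and put \<open>w = finv (h S) \<circ> h S'\<close>. Almost every \<open>x\<close> is outside
  \<open>A\<close> exactly if \<open>h S x\<close> lies in \<open>D S\<close>, and outside the
  translate of \<open>A\<close> exactly if \<open>h S x\<close> lies in \<open>D S'\<close>. The
  missed set therefore corresponds to the intersection of \<open>D S\<close> and
  \<open>D S'\<close>, which has finite measure, while points that \<open>h S\<close> sends into
  \<open>Z 1\<close> lie in both \<open>A\<close> and its translate.\<close>

lemma ex_translate:
  obtains w where "w \<in> vp 2" "emeasure M (space M - (A \<union> w ` A)) < \<infinity>" "emeasure M (A \<inter> w ` A) = \<infinity>"
proof -
  obtain Z :: "nat \<Rightarrow> 'a set" where Z: "\<And>n. Z n \<in> sets M" "disjoint_family Z" "(\<Union>n. Z n) = space M"
    "\<And>n. emeasure M (Z n) = \<infinity>" using split_infinite[OF sets.top inf] by blast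
  obtain Y :: "nat \<Rightarrow> 'a set" where Y: "\<And>n. Y n \<in> sets M" "disjoint_family Y" "\<And>n. Y n \<subseteq> Z 0"
    "\<And>n. 1 \<le> emeasure M (Y n)" "\<And>n. emeasure M (Y n) < \<infinity>" using ex_blocks[OF Z(1,4)] by metis
  \<comment> \<open>\<open>c S n\<close> codes n together with the part of \<open>S\<close> below n.
    If d belongs to exactly one of two sets, they share only codes with n at most d, so their
    infinite code sets are almost disjoint.\<close>
  define c where "c S n = prod_encode (n, set_encode (S \<inter> {..<n}))" for S and n :: nat
  define D where "D S = (\<Union>i\<in>range (c S). Y i)" for S
  have "inj (c S)" for S by (auto simp: inj_def c_def)
  then have "infinite (range (c S))" for S using range_inj_infinite by blast
  then have Di: "emeasure M (D S) = \<infinity>" for S unfolding D_def by (rule emeasure_UN_blocks[OF _ Y(1,2,4)])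
  have Dm: "D S \<in> sets M" for S using Y by (auto simp: D_def)
  have D0: "D S \<subseteq> Z 0" for S using Y(3) by (auto simp: D_def)
  have Z1: "Z 1 \<inter> D S = {}" for S using D0 disjoint_family_onD[OF Z(2), of 1 0] by blast
  have "Z 1 \<subseteq> space M - D S" for S using Z1 sets.sets_into_space[OF Z(1)] by blast
  then have Dc: "emeasure M (space M - D S) = \<infinity>" for S
    using Dm by (intro emeasure_inf_mono[OF Z(4)]) auto
  have fin: "emeasure M (D S \<inter> D S') < \<infinity>" if "S \<noteq> S'" for S S'
  proof -
    obtain d where d: "d \<in> S \<longleftrightarrow> d \<notin> S'" using \<open>S \<noteq> S'\<close> by blast
    have "D S \<inter> D S' \<subseteq> (\<Union>n\<in>{..d}. Y (c S n))"
    proof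
      fix x assume "x \<in> D S \<inter> D S'"
      then obtain m n where mn: "x \<in> Y (c S m)" "x \<in> Y (c S' n)" unfolding D_def by blast
      then have "c S m = c S' n" using disjoint_family_onD[OF Y(2), of "c S m" "c S' n"] by blast
      then have "m = n" and e: "S \<inter> {..<m} = S' \<inter> {..<m}"
        by (auto simp: c_def prod_encode_eq set_encode_eq)
      have "m \<le> d"
      proof (rule ccontr)
        assume "\<not> m \<le> d"
        then have "d \<in> S \<inter> {..<m} \<longleftrightarrow> d \<in> S" "d \<in> S' \<inter> {..<m} \<longleftrightarrow> d \<in> S'" by auto
        then show False using e d by metis
      qed
      then show "x \<in> (\<Union>n\<in>{..d}. Y (c S n))" using mn(1) by blast
    qed
    then have "emeasure M (D S \<inter> D S') \<le> emeasure M (\<Union>n\<in>{..d}. Y (c S n))" using Y by (intro emeasure_mono) auto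
    also have "\<dots> \<le> (\<Sum>n\<in>{..d}. emeasure M (Y (c S n)))" using Y by (intro emeasure_subadditive_finite) auto
    also have "\<dots> < \<infinity>" using Y(5) by simp
    finally show ?thesis .
  qed
  have "\<exists>T\<in>H. sends T (space M - A) (D S)" for S
  proof -
    have e: "space M - (space M - A) = A" using sets.sets_into_space[OF Am] by auto
    show ?thesis
      by (rule ex_sends[of "space M - A" "D S"]) (use e Am Dm Di Dc Ainf Acinf in auto)
  qed
  then obtain h where h: "\<And>S. h S \<in> H" "\<And>S. sends (h S) (space M - A) (D S)" by metis
  obtain S S' where S: "S \<noteq> S'" "finv (h S) \<circ> h S' \<in> vp 2" by (rule pigeonhole[OF h(1)])
  define w where "w = finv (h S) \<circ> h S'"
  have wv: "w \<in> vp 2" using S by (simp add: w_def)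
  have wH: "w \<in> H" using vpH wv by auto
  have wA: "x \<in> w ` A \<longleftrightarrow> finv w x \<in> A" for x
    unfolding vimage_inv[OF wH, symmetric] by simp
  \<comment> \<open>This moves both conditions, being in \<open>A\<close> and being in its
    translate, to the same point \<open>h S x\<close>.\<close>
  have hw: "h S' (finv w x) = h S x" for x
  proof -
    have "w (finv w x) = x" using wH by simp
    then have "finv (h S) (h S' (finv w x)) = x" by (simp add: w_def)
    then show ?thesis using h(1) by (metis invR)
  qed
  have AE1: "AE x in M. x \<in> space M - A \<longleftrightarrow> h S x \<in> D S" using h(2) by (simp add: sends_def)
  have "AE x in M. x \<in> space M - A \<longleftrightarrow> h S' x \<in> D S'" using h(2) by (simp add: sends_def)
  from AE_H[OF invc[OF wH] this] have AE2: "AE x in M. finv w x \<in> space M - A \<longleftrightarrow> h S x \<in> D S'"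
    by (simp add: hw)
  have wAm: "w ` A \<in> sets M" using img[OF wH Am] .
  show ?thesis
  proof (rule that[OF wv])
    have "AE x in M. x \<in> space M - (A \<union> w ` A) \<longrightarrow> x \<in> h S -` (D S \<inter> D S')"
      using AE1 AE2 AE_space by eventually_elim (simp add: wA spaceH[OF invc[OF wH]])
    then have "emeasure M (space M - (A \<union> w ` A)) \<le> emeasure M (h S -` (D S \<inter> D S'))"
      using img'[OF h(1)] Dm by (intro emeasure_mono_AE) auto
    also have "\<dots> < \<infinity>" using emi'[OF h(1) sets.Int[OF Dm Dm]] fin[OF S(1)] by (simp only:)
    finally show "emeasure M (space M - (A \<union> w ` A)) < \<infinity>" .
    have "AE x in M. x \<in> h S -` Z 1 \<longrightarrow> x \<in> A \<inter> w ` A"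
      using AE1 AE2 AE_space
    proof eventually_elim
      case (elim x)
      show ?case
      proof
        assume "x \<in> h S -` Z 1"
        then have "h S x \<notin> D S" "h S x \<notin> D S'" using Z1 by blast+
        then show "x \<in> A \<inter> w ` A" using elim wA spaceH[OF invc[OF wH], of x] by blast
      qed
    qed
    then have "emeasure M (h S -` Z 1) \<le> emeasure M (A \<inter> w ` A)"
      using Am wAm by (intro emeasure_mono_AE) auto
    then show "emeasure M (A \<inter> w ` A) = \<infinity>" using emi'[OF h(1) Z(1)] Z(4) by (simp add: top_unique)
  qed
qed

end

section \<open>Elements fixing the remainder of finite measure\<close>

locale translated = lifted +
  fixes w
  assumes wv: "w \<in> vp 2" and Cf: "emeasure M (space M - (A \<union> w ` A)) < \<infinity>"
    and Ri: "emeasure M (A \<inter> w ` A) = \<infinity>"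
begin

definition B where "B = w ` A"
definition C where "C = space M - (A \<union> B)"
definition R where "R = A \<inter> B"

lemma wH: "w \<in> H" using wv vpH by auto
lemma Bm: "B \<in> sets M" unfolding B_def by (rule img[OF wH Am])
lemma Cm: "C \<in> sets M" unfolding C_def using Am Bm by auto
lemma Rm: "R \<in> sets M" unfolding R_def using Am Bm by auto
lemma Cfin: "emeasure M C < \<infinity>" using Cf by (simp add: C_def B_def)
lemma Rinf: "emeasure M R = \<infinity>" using Ri by (simp add: R_def B_def)

text \<open>Conjugation by \<open>w\<close> exchanges swaps in \<open>A\<close> with swaps in
  \<open>B\<close>; \<open>w\<close> and its inverse add 2 each to the 6.\<close>

lemma swapB_vp:
  assumes "is_swap B s P Q" shows "s \<in> vp 10"
proof -
  have s: "s \<in> H" "\<And>x. s (s x) = x" "sends s P Q" "P \<in> sets M" "Q \<in> sets M" "P \<inter> Q = {}" "P \<union> Q \<subseteq> B"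
    "\<And>x. x \<notin> P \<union> Q \<Longrightarrow> s x = x" "emeasure M P = \<infinity>" "emeasure M (B - (P \<union> Q)) = \<infinity>"
    using assms unfolding is_swap_def by blast+
  define t where "t x = finv w (s (w x))" for x
  have tc: "t = finv w \<circ> s \<circ> w" by (auto simp: t_def)
  have im: "finv w ` X = w -` X" for X by (rule image_inv[OF wH])
  have BA: "w -` B = A" using injH[OF wH] by (auto simp: B_def)
  have sw: "sends w (w -` X) X" for X unfolding sends_def by simp
  have sm: "w -` X \<in> sets M" "emeasure M (w -` X) = emeasure M X" if "X \<in> sets M" for X
    using img'[OF wH that] emi'[OF wH that] by auto
  have ws: "(\<lambda>x. s (w x)) \<in> H" using comp[OF s(1) wH] by (simp add: comp_def)
  have "is_swap A t (w -` P) (w -` Q)"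
  proof (rule is_swapI)
    show "t \<in> H" unfolding tc using comp invc s(1) wH by blast
    show "t (t x) = x" for x by (simp add: t_def wH s(2))
    show "sends t (w -` P) (w -` Q)" unfolding t_def[abs_def]
      by (rule sends_comp[OF ws sends_comp[OF wH sw s(3)] sends_inv[OF wH sw]])
    show "t x = x" if "x \<notin> w -` P \<union> w -` Q" for x using that s(8)[of "w x"] by (simp add: t_def wH)
    show "w -` P \<union> w -` Q \<subseteq> A" using s(7) BA by blast
    show "w -` (B - (P \<union> Q)) \<subseteq> A - (w -` P \<union> w -` Q)" using BA by auto
    show "emeasure M (w -` (B - (P \<union> Q))) = \<infinity>" using sm(2)[of "B - (P \<union> Q)"] s(4,5,10) Bm by auto
    show "emeasure M (w -` P) = \<infinity>" using sm s by auto
  qed (use s(4,5,6) sm Am in auto)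
  then have "w \<circ> t \<circ> finv w \<in> vp (2 + 6 + 2)" by (intro vp_add wv vp_inv swap_vp)
  moreover have "w \<circ> t \<circ> finv w = s" by (auto simp: t_def wH)
  ultimately show ?thesis by simp
qed

text \<open>Conjugating by a swap of \<open>B - A\<close> with half of \<open>D\<close> moves the support of \<open>T\<close> into \<open>A\<close>, away from the other half.\<close>

lemma fix_inf_vp:
  assumes T: "T \<in> H" and fC: "fx T C" and D: "D \<in> sets M" "D \<subseteq> R" "emeasure M D = \<infinity>" and fD: "fx T D"
  shows "T \<in> vp 44"
proof -
  obtain Z :: "nat \<Rightarrow> 'a set" where Z: "\<And>n. Z n \<in> sets M" "disjoint_family Z" "(\<Union>n. Z n) = D"
    "\<And>n. emeasure M (Z n) = \<infinity>" using split_infinite[OF D(1,3)] by blast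
  have ZD: "Z n \<subseteq> D" for n using Z(3) by blast
  have Z01: "Z 0 \<inter> Z 1 = {}" using disjoint_family_onD[OF Z(2), of 0 1] by simp
  let ?Q = "B - A"
  have Qm: "?Q \<in> sets M" using Am Bm by auto
  \<comment> \<open>The complement of \<open>A\<close> is infinite, and all of it except the set
    \<open>C\<close> of finite measure lies in \<open>B\<close>.\<close>
  have "emeasure M ((space M - A) - C) = \<infinity>" using emeasure_diff_inf[OF _ Cm Acinf Cfin] Am by auto
  moreover have "(space M - A) - C \<subseteq> ?Q" by (auto simp: C_def)
  ultimately have Qi: "emeasure M ?Q = \<infinity>" using Qm by (rule emeasure_inf_mono)
  have QZ: "?Q \<inter> Z 0 = {}" using ZD[of 0] D(2) by (auto simp: R_def)
  obtain s where s: "s \<in> H" "\<And>x. s (s x) = x" "\<And>x. x \<notin> ?Q \<union> Z 0 \<Longrightarrow> s x = x" "sends s ?Q (Z 0)"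
    using swap_ex[OF Qm Z(1) Qi Z(4) QZ] by blast
  have RAB: "R \<subseteq> A" "R \<subseteq> B" by (auto simp: R_def)
  have "is_swap B s ?Q (Z 0)"
    by (rule is_swapI[where E="Z 1"]) (use s Qm Z(1,4) QZ Qi Bm ZD[of 0] ZD[of 1] D(2) RAB Z01 in auto)
  then have sv: "s \<in> vp 10" by (rule swapB_vp)
  define t where "t = s \<circ> T \<circ> s"
  have tH: "t \<in> H" unfolding t_def using s(1) T comp by blast
  have f: "AE x in M. x \<in> C \<longrightarrow> T x = x" "AE x in M. x \<in> D \<longrightarrow> T x = x"
    using fC fD by (simp_all add: fx_def)
  have "fx t (space M - (A - Z 1))" unfolding fx_def
    using f AE_H[OF s(1) f(2)] s(4)[unfolded sends_def]
  proof eventually_elim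
    case (elim x)
    show ?case
    proof
      assume x: "x \<in> space M - (A - Z 1)"
      consider "x \<in> ?Q" | "x \<in> C" | "x \<in> Z 1" using x by (auto simp: C_def)
      then show "t x = x"
      proof cases
        case 1
        then have "s x \<in> D" using elim(4) ZD by blast
        then show ?thesis using elim(3) s(2) by (simp add: t_def)
      next
        case 2
        then have "x \<notin> ?Q \<union> Z 0" using ZD[of 0] D(2) RAB by (auto simp: C_def)
        then have sx: "s x = x" by (rule s(3))
        then show ?thesis using elim(1) 2 by (simp add: t_def)
      next
        case 3
        then have "x \<notin> ?Q \<union> Z 0" using ZD[of 1] Z01 D(2) RAB by blast
        then have sx: "s x = x" by (rule s(3))
        moreover have "T x = x" using elim(2) 3 ZD[of 1] by blast
        ultimately show ?thesis by (simp add: t_def)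
      qed
    qed
  qed
  moreover have "emeasure M (A - (A - Z 1)) = \<infinity>"
    by (rule emeasure_inf_mono[OF Z(4)[of 1]]) (use ZD[of 1] D(2) RAB Am Z(1) in auto)
  ultimately have "t \<in> vp 24" using Am Z(1) by (intro swindle[OF tH]) auto
  then have "s \<circ> t \<circ> s \<in> vp (10 + 24 + 10)" using sv by (intro vp_add)
  moreover have "s \<circ> t \<circ> s = T" by (auto simp: t_def s(2))
  ultimately show ?thesis by simp
qed

text \<open>Of three disjoint sets, some \<open>Z i\<close> satisfies that \<open>Y - (Z i \<union> T ` Z i)\<close> is infinite: a point lies in at
  most one \<open>Z i\<close> and at most one \<open>T ` Z i\<close>.\<close>

lemma fixC_vp_aux:
  assumes T: "T \<in> H" and fC: "fx T C" and Y: "Y \<in> sets M" "C \<inter> Y = {}" "R \<subseteq> Y"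
    and sv: "\<And>s P Q. is_swap Y s P Q \<Longrightarrow> s \<in> vp 10"
    and i: "emeasure M (R \<inter> T -` Y) = \<infinity>"
  shows "T \<in> vp 64"
proof -
  have D0m: "R \<inter> T -` Y \<in> sets M" using Rm img'[OF T Y(1)] by auto
  obtain Z :: "nat \<Rightarrow> 'a set" where Z: "\<And>n. Z n \<in> sets M" "disjoint_family Z" "(\<Union>n. Z n) = R \<inter> T -` Y"
    "\<And>n. emeasure M (Z n) = \<infinity>" using split_infinite[OF D0m i] by blast
  have ZR: "Z n \<subseteq> R" "T ` Z n \<subseteq> Y" for n using Z(3) by blast+
  have ZT: "T ` Z n \<in> sets M" for n by (rule img[OF T Z(1)])
  let ?N = "\<lambda>i. Y - (Z i \<union> T ` Z i)"
  have Nm: "?N i \<in> sets M" for i using Y Z(1) ZT by auto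
  have Zd: "Z i \<inter> Z j = {}" "T ` Z i \<inter> T ` Z j = {}" if "i \<noteq> j" for i j
  proof -
    show "Z i \<inter> Z j = {}" using disjoint_family_onD[OF Z(2)] that by simp
    then show "T ` Z i \<inter> T ` Z j = {}" using injH[OF T] by auto
  qed
  have "R \<inter> T -` Y \<subseteq> ?N 0 \<union> (?N 1 \<union> ?N 2)"
  proof
    fix x assume "x \<in> R \<inter> T -` Y"
    then have xY: "x \<in> Y" using Y(3) by blast
    have z: "\<not> (x \<in> Z i \<and> x \<in> Z j)" "\<not> (x \<in> T ` Z i \<and> x \<in> T ` Z j)" if "i \<noteq> j" for i j
      using Zd[OF that] by blast+
    show "x \<in> ?N 0 \<union> (?N 1 \<union> ?N 2)"
    proof (rule ccontr)
      assume "x \<notin> ?N 0 \<union> (?N 1 \<union> ?N 2)"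
      then have "x \<in> Z i \<or> x \<in> T ` Z i" if "i = 0 \<or> i = 1 \<or> i = 2" for i using xY that by blast
      from this[of 0] this[of 1] this[of 2] show False
        using z[of 0 1] z[of 0 2] z[of 1 2] by (simp del: image_iff) blast
    qed
  qed
  then have "emeasure M (?N 0 \<union> (?N 1 \<union> ?N 2)) = \<infinity>" using Nm by (intro emeasure_inf_mono[OF i]) auto
  then have "\<exists>i. emeasure M (?N i) = \<infinity>"
    using emeasure_inf_Un[of "?N 0" "?N 1 \<union> ?N 2"] emeasure_inf_Un[of "?N 1" "?N 2"] Nm by blast
  then obtain i where Ni: "emeasure M (?N i) = \<infinity>" by blast
  \<comment> \<open>\<open>W 0\<close> becomes the station between \<open>Z i\<close> and its image
    under \<open>T\<close>; \<open>W 1\<close> stays unmoved, so that both swaps leave an infinite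
    part of \<open>Y\<close>.\<close>
  obtain W :: "nat \<Rightarrow> 'a set" where W: "\<And>n. W n \<in> sets M" "disjoint_family W" "(\<Union>n. W n) = ?N i"
    "\<And>n. emeasure M (W n) = \<infinity>" using split_infinite[OF Nm Ni] by blast
  have WN: "W n \<subseteq> ?N i" for n using W(3) by blast
  have W01: "W 0 \<inter> W 1 = {}" using disjoint_family_onD[OF W(2), of 0 1] by simp
  obtain \<psi> where \<psi>: "piso \<psi> (Z i) (W 0)" using piso_infinite[OF Z(1,4) W(1,4)] by blast
  have dj: "Z i \<inter> W 0 = {}" "W 0 \<inter> T ` Z i = {}" using WN[of 0] by blast+
  obtain s1 s2 where s1: "s1 \<in> H" "\<And>x. s1 (s1 x) = x" "sends s1 (Z i) (W 0)" "\<And>x. x \<notin> Z i \<union> W 0 \<Longrightarrow> s1 x = x"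
    and s2: "s2 \<in> H" "\<And>x. s2 (s2 x) = x" "sends s2 (W 0) (T ` Z i)" "\<And>x. x \<notin> W 0 \<union> T ` Z i \<Longrightarrow> s2 x = x"
    and ss: "AE x in M. x \<in> Z i \<longrightarrow> s2 (s1 x) = T x"
    by (rule two_swaps[OF T Z(1) W(1) \<psi> dj]) blast
  have sub: "Z i \<union> W 0 \<subseteq> Y" "W 0 \<union> T ` Z i \<subseteq> Y" using ZR[of i] WN[of 0] Y(3) by blast+
  have W1: "W 1 \<subseteq> Y - (Z i \<union> W 0)" "W 1 \<subseteq> Y - (W 0 \<union> T ` Z i)" using WN[of 1] W01 by blast+
  have v1: "s1 \<in> vp 10"
    by (rule sv[OF is_swapI[OF s1(1,2,3,4) Z(1) W(1) dj(1) sub(1) Z(4) Y(1) W1(1) W(4)]])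
  have v2: "s2 \<in> vp 10"
    by (rule sv[OF is_swapI[OF s2(1,2,3,4) W(1) ZT dj(2) sub(2) W(4) Y(1) W1(2) W(4)]])
  \<comment> \<open>Undoing \<open>T\<close> on \<open>Z i\<close> yields a map that fixes an
    infinite part of \<open>R\<close>. Both swaps live in \<open>Y\<close>, which is disjoint from
    \<open>C\<close>, so \<open>C\<close> stays fixed and \<open>fix_inf_vp\<close> applies.\<close>
  define t where "t = s1 \<circ> s2 \<circ> T"
  have tH: "t \<in> H" unfolding t_def using s1(1) s2(1) T comp by blast
  have "fx t (Z i)" unfolding fx_def
    using ss
  proof eventually_elim
    case (elim x)
    show ?case
    proof
      assume "x \<in> Z i"
      then have "T x = s2 (s1 x)" using elim by simp
      then show "t x = x" by (simp add: t_def s1(2) s2(2))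
    qed
  qed
  moreover have "fx t C" unfolding fx_def
    using fC[unfolded fx_def]
  proof eventually_elim
    case (elim x)
    show ?case
    proof
      assume x: "x \<in> C"
      then have "x \<notin> Y" using Y(2) by blast
      then have "s2 x = x" "s1 x = x" using s1(4) s2(4) sub by blast+
      then show "t x = x" using elim x by (simp add: t_def)
    qed
  qed
  ultimately have "t \<in> vp 44" using fix_inf_vp[OF tH _ Z(1) ZR(1) Z(4)] by blast
  then have "s2 \<circ> s1 \<circ> t \<in> vp (10 + 10 + 44)" using v1 v2 by (intro vp_add)
  moreover have "s2 \<circ> s1 \<circ> t = T" by (auto simp: t_def s1(2) s2(2))
  ultimately show ?thesis by simp
qed

text \<open>Since \<open>T\<close> fixes \<open>C\<close>, it preserves \<open>A \<union> B\<close>,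
  so it sends an infinite part of \<open>R\<close> into \<open>A\<close> or into \<open>B\<close>.
  In either set the two correcting swaps cost at most 10: those in \<open>A\<close> have cost 6,
  which has the same parity.\<close>

lemma fixC_vp:
  assumes T: "T \<in> H" and fC: "fx T C" shows "T \<in> vp 64"
proof -
  have CC: "space M - (A \<union> B) = C" by (simp add: C_def)
  have "sends T (A \<union> B) (A \<union> B)" by (rule fx_sends[OF T]) (simp add: CC fC)
  then have "AE x in M. x \<in> R \<longrightarrow> x \<in> R \<inter> T -` A \<union> R \<inter> T -` B"
    unfolding sends_def by eventually_elim (auto simp: R_def)
  then have "emeasure M R \<le> emeasure M (R \<inter> T -` A \<union> R \<inter> T -` B)"
    using Rm img'[OF T] Am Bm by (intro emeasure_mono_AE) auto
  then have "emeasure M (R \<inter> T -` A \<union> R \<inter> T -` B) = \<infinity>" using Rinf by (simp add: top_unique)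
  then consider "emeasure M (R \<inter> T -` A) = \<infinity>" | "emeasure M (R \<inter> T -` B) = \<infinity>"
    using emeasure_inf_Un[of "R \<inter> T -` A" "R \<inter> T -` B"] Rm img'[OF T] Am Bm by blast
  then show ?thesis
  proof cases
    case 1
    show ?thesis
      by (rule fixC_vp_aux[OF T fC Am _ _ _ 1])
        (auto simp: C_def R_def dest: swap_vp intro: vp_mono)
  next
    case 2
    show ?thesis
      by (rule fixC_vp_aux[OF T fC Bm _ _ swapB_vp 2]) (auto simp: C_def R_def)
  qed
qed

section \<open>Elements of small support and elements close to the identity\<close>

definition supp :: "('a \<Rightarrow> 'a) \<Rightarrow> 'a set" where
  "supp T = {x \<in> space M. T x \<noteq> x}"

lemma supp_sets: "T \<in> H \<Longrightarrow> supp T \<in> sets M"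
  using neq[of T id] one by (simp add: supp_def)

text \<open>Otherwise pick \<open>T n\<close> of summable supports violating the claim; a single \<open>g\<close> moves each \<open>supp (T n)\<close>
  off \<open>k n ` C\<close>, because almost every point lies in finitely many supports. Writing \<open>g = k n \<circ> v\<close>
  gives a \<open>v \<in> V\<close> conjugating \<open>T n\<close> into the stabilizer of \<open>C\<close>.\<close>

lemma small_vp:
  "\<exists>n::nat. \<forall>T\<in>H. emeasure M (supp T) < ennreal ((1/2)^n) \<longrightarrow> T \<in> vp 46"
proof (rule ccontr)
  assume "\<not> ?thesis"
  then have "\<forall>n. \<exists>T\<in>H. emeasure M (supp T) < ennreal ((1/2)^n) \<and> T \<notin> vp 46" by blast
  then obtain T where T: "\<And>n. T n \<in> H" "\<And>n. emeasure M (supp (T n)) < ennreal ((1/2)^n)"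
    "\<And>n::nat. T n \<notin> vp 46" by metis
  define E where "E n = supp (T n)" for n
  have Em: "E n \<in> sets M" for n using supp_sets T by (simp add: E_def)
  have Ele: "emeasure M (E n) \<le> ennreal ((1/2)^n)" for n using T(2)[of n] by (simp add: E_def)
  have Ef: "emeasure M (E n) < \<infinity>" for n by (rule le_less_trans[OF Ele]) simp
  have su: "summable (\<lambda>n. measure M (E n))"
    by (rule summable_comparison_test'[OF summable_geometric[of "1/2::real"], of 0])
      (use Ele in \<open>auto simp: measure_def intro!: enn2real_leI\<close>)
  have fin: "AE x in M. finite {n. x \<in> E n}"
  proof -
    have "AE x in M. eventually (\<lambda>n. x \<in> space M - E n) sequentially"
      by (rule borel_cantelli_AE1[OF Em _ su]) (use Ef in simp)
    then show ?thesis
    proof eventually_elim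
      case (elim x)
      then obtain N where N: "\<And>n. n \<ge> N \<Longrightarrow> x \<notin> E n" by (auto simp: eventually_sequentially)
      have "{n. x \<in> E n} \<subseteq> {..<N}" using N not_less by blast
      then show ?case using finite_subset by blast
    qed
  qed
  have UE: "emeasure M (\<Union>n. E n) < \<infinity>"
  proof -
    have "emeasure M (\<Union>n. E n) \<le> (\<Sum>n. emeasure M (E n))"
      using Em by (intro emeasure_subadditive_countably) auto
    also have "\<dots> \<le> (\<Sum>n. ennreal ((1/2)^n))" by (intro suminf_le Ele) auto
    also have "\<dots> = ennreal (\<Sum>n. (1/2)^n)" by (intro suminf_ennreal2) (auto intro: summable_geometric)
    also have "\<dots> < \<infinity>" by simp
    finally show ?thesis .
  qed
  obtain Z :: "nat \<Rightarrow> 'a set" where Z: "\<And>n. Z n \<in> sets M" "disjoint_family Z" "(\<Union>n. Z n) = space M"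
    "\<And>n. emeasure M (Z n) = \<infinity>" using split_infinite[OF sets.top inf] by blast
  \<comment> \<open>Points are sorted by the exact finite set of supports containing them. The code
    \<open>Suc i\<close> excludes the empty set, so only points of some \<open>E n\<close> are
    collected.\<close>
  define D where "D i = {x\<in>space M. {n. x \<in> E n} = set_decode (Suc i)}" for i
  define L where "L i = (\<Union>n\<in>set_decode (Suc i). k n ` C)" for i
  \<comment> \<open>A point of \<open>D i\<close> lies in finitely many supports, so it has to avoid
    finitely many translates of \<open>C\<close>. Their union \<open>L i\<close> has finite measure
    and leaves the target infinite.\<close>
  define W where "W i = Z (Suc i) - L i" for i
  have kC: "k n ` C \<in> sets M" "emeasure M (k n ` C) = emeasure M C" for n
    using img[OF kH Cm] emi[OF kH Cm] by auto
  have Lm: "L i \<in> sets M" for i using kC by (auto simp: L_def)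
  have "emeasure M (L i) \<le> (\<Sum>n\<in>set_decode (Suc i). emeasure M (k n ` C))" for i
    unfolding L_def using kC by (intro emeasure_subadditive_finite) auto
  moreover have "(\<Sum>n\<in>set_decode (Suc i). emeasure M (k n ` C)) < \<infinity>" for i
    using kC(2) Cfin by (simp add: ennreal_mult_less_top of_nat_less_top)
  ultimately have Lf: "emeasure M (L i) < \<infinity>" for i by (metis le_less_trans)
  have Wm: "W i \<in> sets M" for i using Z Lm by (auto simp: W_def)
  have Wi: "emeasure M (W i) = \<infinity>" for i
    unfolding W_def by (rule emeasure_diff_inf[OF Z(1) Lm Z(4) Lf])
  have Dm: "D i \<in> sets M" for i
  proof -
    have "D i = {x\<in>space M. \<forall>n. x \<in> E n \<longleftrightarrow> n \<in> set_decode (Suc i)}" by (auto simp: D_def)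
    moreover have "{x\<in>space M. x \<in> E n \<longleftrightarrow> n \<in> set_decode (Suc i)} \<in> sets M" for n
      using Em[of n] by (cases "n \<in> set_decode (Suc i)") (auto simp: set_diff_eq[symmetric] intro: sets.sets_Collect)
    ultimately show ?thesis by (simp add: sets.sets_Collect_countable_All)
  qed
  have ne: "set_decode (Suc i) \<noteq> {}" for i by (metis set_decode_inverse set_encode_empty nat.distinct(1))
  have DE: "D i \<subseteq> (\<Union>n. E n)" for i using ne[of i] by (auto simp: D_def)
  have Df: "emeasure M (D i) < \<infinity>" for i
    by (rule le_less_trans[OF emeasure_mono[OF DE] UE]) (use Em in auto)
  have dD: "disjoint_family D"
    unfolding disjoint_family_on_def
  proof (intro ballI impI)
    fix m n :: nat assume "m \<noteq> n"
    then have "set_decode (Suc m) \<noteq> set_decode (Suc n)" by (metis set_decode_inverse nat.inject)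
    then show "D m \<inter> D n = {}" by (auto simp: D_def)
  qed
  have dW: "disjoint_family W"
    unfolding disjoint_family_on_def
  proof (intro ballI impI)
    fix m n :: nat assume "m \<noteq> n"
    then show "W m \<inter> W n = {}" using disjoint_family_onD[OF Z(2), of "Suc m" "Suc n"] by (auto simp: W_def)
  qed
  have "\<forall>i. \<exists>\<phi> X. pinj \<phi> X (D i) (W i) \<and> D i - X \<in> null_sets M"
    using ex_pinj_finite[OF Dm Wm Df Wi] by blast
  then obtain f X where fX: "\<And>i. pinj (f i) (X i) (D i) (W i)" "\<And>i. D i - X i \<in> null_sets M" by metis
  let ?f = "glue D f" let ?X = "\<Union>i. X i"
  have X: "\<And>i. pw (f i) (X i)" "\<And>i. inj_on (f i) (X i)" "\<And>i. X i \<subseteq> D i" "\<And>i. f i ` X i \<subseteq> W i"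
    using fX(1) unfolding pinj_def by blast+
  note gi = inj_on_glue[OF dD dW X(3,4,2)]
  have pX: "pw ?f ?X" by (rule pw_glue[OF dD X(1,3)])
  have Xm: "?X \<in> sets M" "?f ` ?X \<in> sets M" using pw_sets[OF pX] pw_img[OF pX] .
  have "?X \<subseteq> (\<Union>n. E n)" using X(3) DE by blast
  then have Xf: "emeasure M ?X < \<infinity>"
    by (rule le_less_trans[OF emeasure_mono UE]) (use Em in auto)
  have Xf': "emeasure M (?f ` ?X) < \<infinity>" using pw_emeasure[OF pX gi(1)] Xf by simp
  have p1: "piso ?f ?X (?f ` ?X)" by (rule pisoI[OF Xm pX gi(1)]) auto
  \<comment> \<open>Domain and range of the injection have finite measure, so their complements are
    infinite and can be matched; this completes the injection to an element of the group.\<close>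
  obtain \<psi> where p2: "piso \<psi> (space M - ?X) (space M - ?f ` ?X)"
    using piso_infinite[of "space M - ?X" "space M - ?f ` ?X"] Xm
      emeasure_diff_inf[OF sets.top Xm(1) inf Xf] emeasure_diff_inf[OF sets.top Xm(2) inf Xf'] by auto
  have "piso (\<lambda>x. if x \<in> ?X then ?f x else \<psi> x) (?X \<union> (space M - ?X)) (?f ` ?X \<union> (space M - ?f ` ?X))"
    by (rule piso_Un[OF p1 p2]) auto
  moreover have "?X \<union> (space M - ?X) = space M" "?f ` ?X \<union> (space M - ?f ` ?X) = space M"
    using sets.sets_into_space[OF Xm(1)] sets.sets_into_space[OF Xm(2)] by blast+
  ultimately have "piso (\<lambda>x. if x \<in> ?X then ?f x else \<psi> x) (space M) (space M)" by simp
  then obtain g where g: "g \<in> H" "AE x in M. g x = (if x \<in> ?X then ?f x else \<psi> x)"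
    by (rule piso_realize)
  have nX: "AE x in M. \<forall>i. x \<in> D i \<longrightarrow> x \<in> X i"
    unfolding AE_all_countable
  proof
    fix i show "AE x in M. x \<in> D i \<longrightarrow> x \<in> X i" by (rule AE_I'[OF fX(2)[of i]]) auto
  qed
  have off: "AE x in M. \<forall>n. x \<in> E n \<longrightarrow> g x \<notin> k n ` C"
    using g(2) nX fin AE_space
  proof eventually_elim
    case (elim x)
    show ?case
    proof (intro allI impI)
      fix n assume n: "x \<in> E n"
      let ?S = "{n. x \<in> E n}"
      have "?S = set_decode (set_encode ?S)" using elim(3) by simp
      moreover have "set_encode ?S \<noteq> 0" using n elim(3) by (metis calculation mem_Collect_eq set_decode_zero empty_iff)
      then obtain i where i: "set_encode ?S = Suc i" using not0_implies_Suc by blast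
      ultimately have xD: "x \<in> D i" using elim(4) by (simp add: D_def)
      then have xX: "x \<in> X i" using elim(2) by blast
      then have "g x = f i x" using elim(1) glue_eq[OF dD xD] by auto
      then have "g x \<in> W i" using X(4) xX by auto
      moreover have "n \<in> set_decode (Suc i)" using xD n by (auto simp: D_def)
      ultimately show "g x \<notin> k n ` C" by (auto simp: W_def L_def)
    qed
  qed
  obtain n v where v: "v \<in> V" "g = k n \<circ> v" using cov[OF g(1)] by blast
  have vH: "v \<in> H" using VH v by auto
  have vC: "AE x in M. x \<in> E n \<longrightarrow> v x \<notin> C"
    using off by eventually_elim (auto simp: v(2))
  \<comment> \<open>The support of \<open>t\<close> is the image of \<open>E n\<close> under
    \<open>v\<close>. It avoids \<open>C\<close> up to a null set and has finite measure, so
    \<open>t\<close> fixes \<open>C\<close> and an infinite part of \<open>R\<close>. Conjugating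
    back costs 1 + 44 + 1.\<close>
  define t where "t = v \<circ> T n \<circ> finv v"
  have tH: "t \<in> H" unfolding t_def using vH T(1) comp invc by blast
  have "fx t C" unfolding fx_def
    using AE_H[OF invc[OF vH] vC] AE_space
  proof eventually_elim
    case (elim x)
    show ?case
    proof
      assume "x \<in> C"
      then have "finv v x \<notin> E n" using elim vH by auto
      then have "T n (finv v x) = finv v x" using elim(2) spaceH[OF invc[OF vH]] by (simp add: E_def supp_def)
      then show "t x = x" using vH by (simp add: t_def)
    qed
  qed
  moreover have vE: "v ` E n \<in> sets M" "emeasure M (v ` E n) < \<infinity>"
    using img[OF vH Em] emi[OF vH Em] Ef by auto
  then have "emeasure M (R - v ` E n) = \<infinity>" by (intro emeasure_diff_inf[OF Rm _ Rinf])
  moreover have "fx t (R - v ` E n)"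
  proof (rule fx_exact)
    fix x assume x: "x \<in> R - v ` E n"
    then have "finv v x \<notin> E n" using vimage_inv[OF vH, of "E n"] by blast
    moreover have "x \<in> space M" using x sets.sets_into_space[OF Rm] by auto
    ultimately have "T n (finv v x) = finv v x" using spaceH[OF invc[OF vH]] by (simp add: E_def supp_def)
    then show "t x = x" using vH by (simp add: t_def)
  qed
  ultimately have "t \<in> vp 44" using Rm vE by (intro fix_inf_vp[OF tH, of "R - v ` E n"]) auto
  then have "finv v \<circ> t \<circ> v \<in> vp (1 + 44 + 1)" by (intro vp_add vp_1 Vinv v(1))
  moreover have "finv v \<circ> t \<circ> v = T n" using vH by (auto simp: t_def)
  ultimately show False using T(3)[of n] by simp
qed

text \<open>\<open>T = T\<^sub>1 \<circ> T\<^sub>2\<close> where \<open>T\<^sub>1\<close> agrees with \<open>T\<close> on \<open>C \<inter> supp T\<close> and has small support, so that \<open>T\<^sub>2\<close> fixes \<open>C\<close>.\<close>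

lemma nbhd_vp:
  obtains \<epsilon> :: real where "\<epsilon> > 0"
    "\<And>T. T \<in> H \<Longrightarrow> emeasure M {x\<in>C. T x \<noteq> x} < ennreal \<epsilon> \<Longrightarrow> T \<in> vp 110"
proof -
  obtain n :: nat where n: "\<And>T. T \<in> H \<Longrightarrow> emeasure M (supp T) < ennreal ((1/2)^n) \<Longrightarrow> T \<in> vp 46"
    using small_vp by blast
  \<comment> \<open>One third, because the correcting map will be supported in three sets of the
    same measure: \<open>E\<close>, its station \<open>F\<close>, and the image of \<open>E\<close>
    under \<open>T\<close>.\<close>
  define \<epsilon> :: real where "\<epsilon> = (1/2)^n / 3"
  have e0: "\<epsilon> > 0" by (simp add: \<epsilon>_def)
  have "T \<in> vp 110" if T: "T \<in> H" and small: "emeasure M {x\<in>C. T x \<noteq> x} < ennreal \<epsilon>" for T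
  proof -
    define E where "E = C \<inter> supp T"
    have CS: "C \<subseteq> space M" by (auto simp: C_def)
    have E_eq: "E = {x\<in>C. T x \<noteq> x}" using CS by (auto simp: E_def supp_def)
    have Em: "E \<in> sets M" using Cm supp_sets[OF T] by (auto simp: E_def)
    have Es: "emeasure M E < ennreal \<epsilon>" using small E_eq by simp
    then have Ef: "emeasure M E < \<infinity>" by (metis ennreal_less_top infinity_ennreal_def less_trans)
    have TEm: "T ` E \<in> sets M" "emeasure M (T ` E) = emeasure M E" using img[OF T Em] emi[OF T Em] by auto
    have "C \<union> T ` E \<in> sets M" using Cm TEm by auto
    moreover have "emeasure M (C \<union> T ` E) < \<infinity>"
      using emeasure_subadditive[OF Cm TEm(1)] Cfin Ef TEm(2)
      by (metis ennreal_add_eq_top infinity_ennreal_def le_less_trans less_top)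
    ultimately have Gi: "emeasure M (space M - (C \<union> T ` E)) = \<infinity>"
      using emeasure_diff_inf[OF sets.top _ inf] by blast
    have Gm: "space M - (C \<union> T ` E) \<in> sets M" using Cm TEm by auto
    \<comment> \<open>The station avoids \<open>C\<close>, so that the correction moves no point of
      \<open>C\<close> beyond \<open>E\<close> and the image of \<open>E\<close>.\<close>
    obtain \<psi> X where p: "pinj \<psi> X E (space M - (C \<union> T ` E))" "E - X \<in> null_sets M"
      using ex_pinj_finite[OF Em Gm Ef Gi] by blast
    define F where "F = \<psi> ` X"
    have pX: "pw \<psi> X" "inj_on \<psi> X" "X \<subseteq> E" and FG: "F \<subseteq> space M - (C \<union> T ` E)"
      using p(1) by (auto simp: pinj_def F_def)
    have Fm: "F \<in> sets M" using pw_img[OF pX(1)] by (simp add: F_def)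
    have pEF: "piso \<psi> E F"
      by (rule pisoI[OF Em Fm pX]) (use p(2) in \<open>auto simp: F_def\<close>)
    have dj: "E \<inter> F = {}" "F \<inter> T ` E = {}" using FG by (auto simp: E_def)
    obtain s1 s2 where s1: "s1 \<in> H" "\<And>x. s1 (s1 x) = x" "sends s1 E F" "\<And>x. x \<notin> E \<union> F \<Longrightarrow> s1 x = x"
      and s2: "s2 \<in> H" "\<And>x. s2 (s2 x) = x" "sends s2 F (T ` E)" "\<And>x. x \<notin> F \<union> T ` E \<Longrightarrow> s2 x = x"
      and ss: "AE x in M. x \<in> E \<longrightarrow> s2 (s1 x) = T x"
      by (rule two_swaps[OF T Em Fm pEF dj]) blast
    have c: "s2 \<circ> s1 \<in> H" using s1 s2 comp by blast
    have "supp (s2 \<circ> s1) \<subseteq> E \<union> F \<union> T ` E"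
    proof
      fix x assume x: "x \<in> supp (s2 \<circ> s1)"
      show "x \<in> E \<union> F \<union> T ` E"
      proof (rule ccontr)
        assume "x \<notin> E \<union> F \<union> T ` E"
        then have "s1 x = x" "s2 x = x" using s1(4)[of x] s2(4)[of x] by blast+
        then show False using x by (simp add: supp_def)
      qed
    qed
    then have "emeasure M (supp (s2 \<circ> s1)) \<le> emeasure M (E \<union> F \<union> T ` E)"
      using Em Fm TEm by (intro emeasure_mono) auto
    also have "\<dots> \<le> emeasure M (E \<union> F) + emeasure M (T ` E)"
      using Em Fm TEm by (intro emeasure_subadditive) auto
    also have "\<dots> \<le> (emeasure M E + emeasure M F) + emeasure M (T ` E)"
      using Em Fm by (intro add_right_mono emeasure_subadditive) auto
    also have "\<dots> = emeasure M E + emeasure M E + emeasure M E"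
      using piso_emeasure[OF pEF] TEm(2) by simp
    also have "\<dots> < ennreal \<epsilon> + ennreal \<epsilon> + ennreal \<epsilon>"
      using Es by (intro add_strict_mono)
    also have "\<dots> = ennreal ((1/2)^n)" using e0 by (simp add: \<epsilon>_def flip: ennreal_plus)
    finally have v1: "s2 \<circ> s1 \<in> vp 46" using n[OF c] by blast
    define t where "t = s1 \<circ> s2 \<circ> T"
    have tH: "t \<in> H" unfolding t_def using s1(1) s2(1) T comp by blast
    have "fx t C" unfolding fx_def
      using ss
    proof eventually_elim
      case (elim x)
      show ?case
      proof
        assume x: "x \<in> C"
        show "t x = x"
        proof (cases "x \<in> E")
          case True
          then have "T x = s2 (s1 x)" using elim by simp
          then show ?thesis by (simp add: t_def s1(2) s2(2))
        next
          case False
          then have Tx: "T x = x" using x E_eq by blast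
          \<comment> \<open>A point fixed by \<open>T\<close> cannot be the image of a moved point:
            \<open>T (T y) = T y\<close> would give \<open>T y = y\<close>.\<close>
          have "x \<notin> T ` E" 
          proof
            assume "x \<in> T ` E"
            then obtain y where y: "y \<in> E" "x = T y" by auto
            then have "T x \<noteq> x" using injH[OF T, of "T y" y] by (auto simp: E_eq)
            then show False using Tx by simp
          qed
          moreover have "x \<notin> F" using x FG by blast
          ultimately have "s1 x = x" "s2 x = x" using s1(4)[of x] s2(4)[of x] False by blast+
          then show ?thesis by (simp add: t_def Tx)
        qed
      qed
    qed
    then have "t \<in> vp 64" by (rule fixC_vp[OF tH])
    then have "(s2 \<circ> s1) \<circ> t \<in> vp (46 + 64)" using v1 by (intro vp_add)
    moreover have "(s2 \<circ> s1) \<circ> t = T" by (auto simp: t_def s1(2) s2(2))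
    ultimately show ?thesis by simp
  qed
  then show ?thesis using that e0 by blast
qed

end

theorem (in syndetic) nbhd:
  obtains C and \<epsilon> :: real where "C \<in> sets M" "emeasure M C < \<infinity>" "\<epsilon> > 0"
    "\<And>T. T \<in> H \<Longrightarrow> emeasure M {x\<in>C. T x \<noteq> x} < ennreal \<epsilon> \<Longrightarrow> T \<in> vp 114"
proof -
  obtain A where A: "A \<in> sets M" "emeasure M A = \<infinity>" "emeasure M (space M - A) = \<infinity>"
    "\<And>T. T \<in> H \<Longrightarrow> fx T (space M - A) \<Longrightarrow> \<exists>w\<in>vp 2. AE x in M. x \<in> A \<longrightarrow> w x = T x"
    by (rule ex_lift) blast
  interpret lifted M H V k A by unfold_locales (use A in blast)+
  obtain w where w: "w \<in> vp 2" "emeasure M (space M - (A \<union> w ` A)) < \<infinity>" "emeasure M (A \<inter> w ` A) = \<infinity>"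
    by (rule ex_translate)
  interpret translated M H V k A w by unfold_locales (use w in blast)+
  obtain \<epsilon> :: real where e: "\<epsilon> > 0"
    "\<And>T. T \<in> H \<Longrightarrow> emeasure M {x\<in>C. T x \<noteq> x} < ennreal \<epsilon> \<Longrightarrow> T \<in> vp 110"
    by (rule nbhd_vp) blast
  \<comment> \<open>The difference 114 - 110 is even, so two pairs \<open>finv v \<circ> v\<close>
    fill it.\<close>
  have "T \<in> vp 114" if "T \<in> H" "emeasure M {x\<in>C. T x \<noteq> x} < ennreal \<epsilon>" for T
    using vp_mono[OF e(2)[OF that], of 114] by simp
  then show ?thesis using that[OF Cm Cfin e(1)] by blast
qed

section \<open>Full groups as groups of bijections\<close>

text \<open>Extensional maps are constant off the space and hence in general no bijections of the
  type. Here they are replaced by maps that are the identity there; \<open>restrict\<close> and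
  \<open>extend\<close> pass between the two forms.\<close>

definition mp_maps :: "'a measure \<Rightarrow> ('a \<Rightarrow> 'a) set" where
  "mp_maps M = {T. bij T \<and> (\<forall>x. x \<notin> space M \<longrightarrow> T x = x) \<and> restrict T (space M) \<in> mp_bij M}"

definition cls :: "'a measure \<Rightarrow> ('a \<Rightarrow> 'a) \<Rightarrow> ('a \<Rightarrow> 'a) set" where
  "cls M T = ae_rel M `` {restrict T (space M)}"

definition extend :: "'a measure \<Rightarrow> ('a \<Rightarrow> 'a) \<Rightarrow> 'a \<Rightarrow> 'a" where
  "extend M T x = (if x \<in> space M then T x else x)"

text \<open>The full preimage of \<open>G\<close> under \<open>cls\<close>, so a bijection almost
  everywhere equal to a member is a member.\<close>

definition pull :: "'a measure \<Rightarrow> ('a \<Rightarrow> 'a) set set \<Rightarrow> ('a \<Rightarrow> 'a) set" where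
  "pull M G = {T \<in> mp_maps M. cls M T \<in> G}"

lemma space_iff:
  assumes "bij T" "\<And>x. x \<notin> space M \<Longrightarrow> T x = x"
  shows "T x \<in> space M \<longleftrightarrow> x \<in> space M"
  using assms(2)[of x] assms(2)[of "T x"] injD[OF bij_is_inj[OF assms(1)], of "T x" x] by metis

lemma bij_space:
  assumes "bij T" "\<And>x. x \<notin> space M \<Longrightarrow> T x = x"
  shows "bij_betw T (space M) (space M)"
proof (rule bij_betw_imageI)
  show "inj_on T (space M)" by (rule inj_on_subset[OF bij_is_inj[OF assms(1)]]) simp
  show "T ` space M = space M"
  proof (intro equalityI subsetI)
    fix y assume y: "y \<in> space M"
    obtain x where "y = T x" using bij_is_surj[OF assms(1)] by (auto simp: surj_def)
    then show "y \<in> T ` space M" using y space_iff[of T M x, OF assms] by auto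
  qed (use space_iff[of T M, OF assms] in auto)
qed

lemma restrict_mp_bij_iff:
  assumes "bij T" "\<And>x. x \<notin> space M \<Longrightarrow> T x = x"
  shows "restrict T (space M) \<in> mp_bij M \<longleftrightarrow>
    (\<forall>A\<in>sets M. T ` A \<in> sets M \<and> T -` A \<in> sets M \<and> emeasure M (T ` A) = emeasure M A \<and> emeasure M (T -` A) = emeasure M A)"
proof -
  have b: "bij_betw T (space M) (space M)" by (rule bij_space[OF assms])
  have "restrict T (space M) \<in> Bij (space M)"
    using b by (auto simp: Bij_def bij_betw_def inj_on_def)
  moreover have "restrict T (space M) ` A = T ` A" "restrict T (space M) -` A \<inter> space M = T -` A"
    if "A \<in> sets M" for A
  proof -
    have A: "A \<subseteq> space M" using sets.sets_into_space[OF that] .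
    then show "restrict T (space M) ` A = T ` A" by (intro image_cong) auto
    have "x \<in> space M" if "T x \<in> A" for x
      using subsetD[OF A that] space_iff[of T M x, OF assms] by simp
    then show "restrict T (space M) -` A \<inter> space M = T -` A" by auto
  qed
  ultimately show ?thesis unfolding mp_bij_def by auto
qed

lemma mp_mapsD:
  assumes "T \<in> mp_maps M"
  shows "bij T" "\<And>x. x \<notin> space M \<Longrightarrow> T x = x" "restrict T (space M) \<in> mp_bij M"
    "\<And>A. A \<in> sets M \<Longrightarrow> T ` A \<in> sets M" "\<And>A. A \<in> sets M \<Longrightarrow> T -` A \<in> sets M"
    "\<And>A. A \<in> sets M \<Longrightarrow> emeasure M (T ` A) = emeasure M A"
    "\<And>A. A \<in> sets M \<Longrightarrow> emeasure M (T -` A) = emeasure M A"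
    "\<And>x. T x \<in> space M \<longleftrightarrow> x \<in> space M"
proof -
  show 1: "bij T" "\<And>x. x \<notin> space M \<Longrightarrow> T x = x" and 2: "restrict T (space M) \<in> mp_bij M"
    using assms by (auto simp: mp_maps_def)
  show "T x \<in> space M \<longleftrightarrow> x \<in> space M" for x
    by (rule space_iff[OF 1])
qed (use assms restrict_mp_bij_iff[of T M] in \<open>auto simp: mp_maps_def\<close>)

lemma restrict_comp:
  assumes "T \<in> mp_maps M"
  shows "restrict (S \<circ> T) (space M) = compose (space M) (restrict S (space M)) (restrict T (space M))"
  using mp_mapsD(8)[OF assms] by (auto simp: compose_def fun_eq_iff)

lemma mp_maps_comp: "S \<in> mp_maps M \<Longrightarrow> T \<in> mp_maps M \<Longrightarrow> S \<circ> T \<in> mp_maps M"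
  using restrict_comp[of T M S] mp_bij_compose[of "restrict S (space M)" M "restrict T (space M)"]
  by (auto simp: mp_maps_def bij_comp)

lemma mp_maps_inv:
  assumes "T \<in> mp_maps M" shows "finv T \<in> mp_maps M"
proof -
  note b = mp_mapsD(1)[OF assms]
  have 1: "bij (finv T)" using b by (rule bij_imp_bij_inv)
  have 2: "finv T x = x" if "x \<notin> space M" for x
    using mp_mapsD(2)[OF assms that] bij_is_inj[OF b] by (metis inv_f_f)
  have im: "finv T ` A = T -` A" "finv T -` A = T ` A" for A
    using bij_vimage_eq_inv_image[OF b, of A] bij_vimage_eq_inv_image[OF 1, of A] inv_inv_eq[OF b] by simp_all
  have "restrict (finv T) (space M) \<in> mp_bij M"
    by (rule iffD2[OF restrict_mp_bij_iff[OF 1 2]]) (use mp_mapsD(4-7)[OF assms] im in simp_all)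
  then show ?thesis using 1 2 by (simp add: mp_maps_def)
qed

lemma mp_maps_id: "id \<in> mp_maps M"
  using mp_bij_id[of M] bij_id by (simp add: mp_maps_def id_def)

lemma cls_eq_iff:
  assumes "S \<in> mp_maps M" "T \<in> mp_maps M"
  shows "cls M S = cls M T \<longleftrightarrow> (AE x in M. S x = T x)"
proof -
  have "cls M S = cls M T \<longleftrightarrow> (restrict S (space M), restrict T (space M)) \<in> ae_rel M"
    unfolding cls_def by (rule eq_equiv_class_iff[OF equiv_ae_rel mp_mapsD(3)[OF assms(1)] mp_mapsD(3)[OF assms(2)]])
  also have "\<dots> \<longleftrightarrow> (AE x in M. restrict S (space M) x = restrict T (space M) x)"
    using mp_mapsD(3)[OF assms(1)] mp_mapsD(3)[OF assms(2)] by (simp add: ae_rel_def)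
  also have "\<dots> \<longleftrightarrow> (AE x in M. S x = T x)"
    by (rule AE_cong) simp
  finally show ?thesis .
qed

lemma cls_carrier: "T \<in> mp_maps M \<Longrightarrow> cls M T \<in> carrier (Aut M)"
  unfolding cls_def Aut_def by (simp add: quotientI mp_mapsD(3))

lemma cls_comp: "S \<in> mp_maps M \<Longrightarrow> T \<in> mp_maps M \<Longrightarrow> cls M (S \<circ> T) = cls M S \<otimes>\<^bsub>Aut M\<^esub> cls M T"
  unfolding cls_def by (simp add: restrict_comp Aut_mult mp_mapsD(3))

lemma cls_id: "cls M id = \<one>\<^bsub>Aut M\<^esub>"
  by (simp add: cls_def Aut_def id_def)

lemma cls_inv:
  assumes "T \<in> mp_maps M" shows "cls M (finv T) = inv\<^bsub>Aut M\<^esub> (cls M T)"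
proof -
  interpret group "Aut M" by (rule group_Aut)
  have "finv T \<circ> T = id" using mp_mapsD(1)[OF assms] by (simp add: bij_is_inj)
  then have "cls M (finv T) \<otimes>\<^bsub>Aut M\<^esub> cls M T = \<one>\<^bsub>Aut M\<^esub>"
    using cls_comp[OF mp_maps_inv[OF assms] assms] cls_id[of M] by simp
  then show ?thesis using inv_equality cls_carrier assms mp_maps_inv by metis
qed

text \<open>Every class comes from an honest bijection, which makes \<open>cls\<close> surjective
  onto the group and lets statements about classes be lifted.\<close>

lemma extend_rep:
  assumes "P \<in> carrier (Aut M)"
  shows "extend M (rep P) \<in> mp_maps M" "cls M (extend M (rep P)) = P"
proof -
  obtain T where T: "T \<in> mp_bij M" "P = ae_rel M `` {T}"
    using assms by (auto simp: Aut_def quotient_def)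
  have "T \<in> P" using T equiv_class_self[OF equiv_ae_rel] by blast
  then have r: "rep P \<in> P" unfolding rep_def by (rule someI[of "\<lambda>T. T \<in> P"])
  then have rm: "rep P \<in> mp_bij M" using T by (auto simp: ae_rel_def)
  have rP: "P = ae_rel M `` {rep P}" using r T equiv_class_eq[OF equiv_ae_rel] by blast
  have bb: "bij_betw (rep P) (space M) (space M)" and ex: "rep P \<in> extensional (space M)"
    using mp_bijD(1,3)[OF rm] by (auto simp: Bij_def)
  have re: "restrict (extend M (rep P)) (space M) = rep P"
    using ex by (auto simp: extend_def fun_eq_iff extensional_def)
  have sp: "rep P x \<in> space M" if "x \<in> space M" for x using bb that by (auto simp: bij_betw_def)
  have "bij (extend M (rep P))"
  proof (rule bijI)
    show "inj (extend M (rep P))"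
    proof (rule injI)
      fix x y assume e: "extend M (rep P) x = extend M (rep P) y"
      have "x \<in> space M \<longleftrightarrow> y \<in> space M" using e sp[of x] sp[of y] by (auto simp: extend_def split: if_splits)
      then show "x = y" using e bb by (cases "x \<in> space M") (auto simp: extend_def bij_betw_def inj_on_def)
    qed
    show "surj (extend M (rep P))"
      unfolding surj_def
    proof
      fix y
      show "\<exists>x. y = extend M (rep P) x"
      proof (cases "y \<in> space M")
        case True
        then obtain x where "x \<in> space M" "y = rep P x" using bb by (auto simp: bij_betw_def)
        then show ?thesis by (auto simp: extend_def intro!: exI[of _ x])
      qed (auto simp: extend_def intro!: exI[of _ y])
    qed
  qed
  then show "extend M (rep P) \<in> mp_maps M"
    using rm by (simp add: mp_maps_def re) (simp add: extend_def)
  show "cls M (extend M (rep P)) = P" unfolding cls_def re using rP ..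
qed

lemma rep_cls:
  assumes "T \<in> mp_maps M" shows "AE x in M. rep (cls M T) x = T x"
proof -
  have "AE x in M. extend M (rep (cls M T)) x = T x"
    using cls_eq_iff[OF extend_rep(1)[OF cls_carrier[OF assms]] assms] extend_rep(2)[OF cls_carrier[OF assms]] by simp
  then show ?thesis using AE_space by eventually_elim (simp add: extend_def)
qed

section \<open>Transfer between full groups and their preimages\<close>

lemma mp_group_pull:
  assumes M: "standard_borel M" "sigma_finite_measure M" and G: "subgroup G (Aut M)"
  shows "mp_group M (pull M G)"
proof -
  interpret G: subgroup G "Aut M" by (rule G)
  show ?thesis
  proof (unfold_locales)
    have I: "T \<in> mp_maps M" if "T \<in> pull M G" for T using that by (simp add: pull_def)
    show "\<exists>A. countable A \<and> A \<subseteq> sets M \<and> \<Union> A = space M \<and> (\<forall>a\<in>A. emeasure M a \<noteq> \<infinity>)"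
      using sigma_finite_measure.sigma_finite_countable[OF M(2)] .
    fix S T assume T: "T \<in> pull M G"
    show "bij T" by (rule mp_mapsD(1)[OF I[OF T]])
    show "T x = x" if "x \<notin> space M" for x by (rule mp_mapsD(2)[OF I[OF T] that])
    show "T ` A \<in> sets M" "emeasure M (T ` A) = emeasure M A" if "A \<in> sets M" for A
      using mp_mapsD(4,6)[OF I[OF T] that] .
    show "finv T \<in> pull M G"
      using T mp_maps_inv cls_inv[OF I[OF T]] G.m_inv_closed by (auto simp: pull_def)
    assume S: "S \<in> pull M G"
    show "S \<circ> T \<in> pull M G"
      using T S mp_maps_comp cls_comp[OF I[OF S] I[OF T]] G.m_closed by (auto simp: pull_def simp del: o_apply)
    have "{x\<in>space M. restrict S (space M) x \<noteq> restrict T (space M) x} \<in> sets M"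
      by (intro sets_neq[OF M(1)] mp_bijD(4) mp_mapsD(3) I S T)
    moreover have "{x\<in>space M. restrict S (space M) x \<noteq> restrict T (space M) x} = {x\<in>space M. S x \<noteq> T x}" by auto
    ultimately show "{x\<in>space M. S x \<noteq> T x} \<in> sets M" by simp
  next
    show "id \<in> pull M G" using mp_maps_id cls_id[of M] G.one_closed by (auto simp: pull_def)
  qed
qed

text \<open>Pasting has two gaps to bridge: the given pieces may overlap, and the bijection
  \<open>T\<close> is not yet known to be measurable and measure preserving. The lemmas on piecewise
  maps supply the latter.\<close>

lemma ergodic_full_pull:
  assumes M: "standard_sigma_finite_space M" and G: "full_group M G" and e: "ergodic M G"
  shows "ergodic_full M (pull M G)"
proof -
  have M': "standard_borel M" "sigma_finite_measure M" "emeasure M (space M) = \<infinity>"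
    using M by (auto simp: standard_sigma_finite_space_def)
  have G': "subgroup G (Aut M)" using G by (simp add: full_group_def)
  interpret mp_group M "pull M G" by (rule mp_group_pull[OF M'(1,2) G'])
  have I: "T \<in> mp_maps M" if "T \<in> pull M G" for T using that by (simp add: pull_def)
  show ?thesis
  proof unfold_locales
    show "emeasure M (space M) = \<infinity>" by (rule M')
  next
    fix T and K :: "('a set \<times> ('a \<Rightarrow> 'a)) set"
    assume T: "bij T" "\<And>x. x \<notin> space M \<Longrightarrow> T x = x" and cK: "countable K"
      and K: "\<And>C S. (C, S) \<in> K \<Longrightarrow> C \<in> sets M \<and> S \<in> pull M G \<and> (\<forall>x\<in>C. T x = S x)"
      and cov: "space M \<subseteq> (\<Union>p\<in>K. fst p)"
    have K': "fst p \<in> sets M" "snd p \<in> pull M G" "\<And>x. x \<in> fst p \<Longrightarrow> T x = snd p x" if "p \<in> K" for p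
      using K[of "fst p" "snd p"] that by auto
    have "(\<Union>p\<in>K. fst p) = space M" using cov K'(1) sets.sets_into_space by blast
    then have pwT: "pw T (space M)" by (intro pwI[OF cK, of _ fst snd]) (use K' in auto)
    have Tm: "T ` A \<in> sets M" "emeasure M (T ` A) = emeasure M A" "T -` A \<in> sets M" if A: "A \<in> sets M" for A
    proof -
      have As: "A \<subseteq> space M" by (rule sets.sets_into_space[OF A])
      have pA: "pw T A" by (rule pw_sub[OF pwT A As])
      show "T ` A \<in> sets M" by (rule pw_img[OF pA])
      show "emeasure M (T ` A) = emeasure M A"
        by (rule pw_emeasure[OF pA]) (rule inj_on_subset[OF bij_is_inj[OF T(1)]], simp)
      have "x \<in> space M" if "T x \<in> A" for x
        using subsetD[OF As that] space_iff[of T M x, OF T] by simp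
      then have "T -` A = {x\<in>space M. T x \<in> A}" by auto
      then show "T -` A \<in> sets M" using pw_vimage[OF pwT A] by simp
    qed
    have "emeasure M (T -` A) = emeasure M A" if A: "A \<in> sets M" for A
      using Tm(2)[OF Tm(3)[OF A]] bij_is_surj[OF T(1)] by (simp add: surj_image_vimage_eq)
    then have TM: "T \<in> mp_maps M" using T Tm restrict_mp_bij_iff[OF T] by (simp add: mp_maps_def)
    \<comment> \<open>Infinite measure of the space excludes an empty cover, so the pieces can be
      enumerated by the naturals and then made disjoint, as \<open>full_group\<close>
      demands.\<close>
    have "K \<noteq> {}" using cov M'(3) by (auto simp: subset_empty)
    define p where "p = from_nat_into K"
    have pK: "p n \<in> K" for n using \<open>K \<noteq> {}\<close> by (simp add: p_def from_nat_into)
    have rp: "range p = K" using \<open>K \<noteq> {}\<close> cK by (simp add: p_def range_from_nat_into)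
    define A where "A = disjointed (\<lambda>n. fst (p n))"
    define \<theta> where "\<theta> n = cls M (snd (p n))" for n
    have "range (\<lambda>n. fst (p n)) \<subseteq> sets M" using K'(1)[OF pK] by blast
    from sets.range_disjointed_sets[OF this] have Am: "range A \<subseteq> sets M" by (simp add: A_def)
    have dA: "disjoint_family A" unfolding A_def by (rule disjoint_family_disjointed)
    have "(\<Union>n. A n) = (\<Union>n. fst (p n))" unfolding A_def by (rule UN_disjointed_eq)
    also have "\<dots> = (\<Union>q\<in>K. fst q)" unfolding rp[symmetric] by simp
    finally have UA: "(\<Union>n. A n) = space M" using \<open>(\<Union>p\<in>K. fst p) = space M\<close> by simp
    have "\<theta> n \<in> G \<and> (AE x in M. x \<in> A n \<longrightarrow> rep (cls M T) x = rep (\<theta> n) x)" for n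
    proof
      show "\<theta> n \<in> G" using K'(2)[OF pK] by (simp add: \<theta>_def pull_def)
      show "AE x in M. x \<in> A n \<longrightarrow> rep (cls M T) x = rep (\<theta> n) x"
        using rep_cls[OF TM] rep_cls[OF I[OF K'(2)[OF pK[of n]]]]
      proof eventually_elim
        case (elim x)
        have "T x = snd (p n) x" if "x \<in> A n"
          using that disjointed_subset[of "\<lambda>n. fst (p n)" n] by (intro K'(3)[OF pK]) (auto simp: A_def)
        then show ?case using elim by (simp add: \<theta>_def)
      qed
    qed
    then have "cls M T \<in> G"
      using G cls_carrier[OF TM] Am dA UA unfolding full_group_def by blast
    then show "T \<in> pull M G" using TM by (simp add: pull_def)
  next
    fix A assume A: "A \<in> sets M" and inv: "\<And>T. T \<in> pull M G \<Longrightarrow> sym_diff (T ` A) A \<in> null_sets M"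
    have "emeasure M (sym_diff (rep P ` A) A) = 0" if P: "P \<in> G" for P
    proof -
      have Pc: "P \<in> carrier (Aut M)" using subgroup.subset[OF G'] P by auto
      have "extend M (rep P) \<in> pull M G" using extend_rep[OF Pc] P by (simp add: pull_def)
      moreover have "extend M (rep P) ` A = rep P ` A"
        using sets.sets_into_space[OF A] by (intro image_cong) (auto simp: extend_def)
      ultimately show ?thesis using inv by (metis null_setsD1)
    qed
    then show "A \<in> null_sets M \<or> space M - A \<in> null_sets M"
      using e A unfolding ergodic_def by blast
  qed
qed

lemma ex_nbhd:
  assumes M: "standard_sigma_finite_space M" and G: "full_group M G" and e: "ergodic M G"
    and V: "symmetric_subset (Aut M\<lparr>carrier := G\<rparr>) V" "countably_syndetic (Aut M\<lparr>carrier := G\<rparr>) V"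
  shows "contains_open_nbhd (subtopology (uniform_topology M) G) \<one>\<^bsub>Aut M\<^esub>
                (set_power (Aut M\<lparr>carrier := G\<rparr>) V 114)"
proof -
  let ?G = "Aut M\<lparr>carrier := G\<rparr>"
  have G': "subgroup G (Aut M)" using G by (simp add: full_group_def)
  interpret A: group "Aut M" by (rule group_Aut)
  have GA: "G \<subseteq> carrier (Aut M)" by (rule subgroup.subset[OF G'])
  interpret ergodic_full M "pull M G" by (rule ergodic_full_pull[OF M G e])
  have I: "T \<in> mp_maps M" if "T \<in> pull M G" for T using that by (simp add: pull_def)
  have VG: "V \<subseteq> G" using V(1) by (simp add: symmetric_subset_def)
  have Vi: "inv\<^bsub>Aut M\<^esub> v \<in> V" if "v \<in> V" for v
  proof -
    have "inv\<^bsub>?G\<^esub> v \<in> set_inv\<^bsub>?G\<^esub> V" using that by (auto simp: SET_INV_def)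
    then have "inv\<^bsub>?G\<^esub> v \<in> V" using V(1) by (simp add: symmetric_subset_def)
    then show ?thesis using A.m_inv_consistent[OF G'] that VG by auto
  qed
  obtain g :: "nat \<Rightarrow> _" where g: "range g \<subseteq> G" "(\<Union>n. g n <#\<^bsub>?G\<^esub> V) = G"
    using V(2) by (auto simp: countably_syndetic_def)
  define k where "k n = extend M (rep (g n))" for n
  have gA: "g n \<in> carrier (Aut M)" for n using g(1) GA by auto
  have k: "k n \<in> pull M G" "cls M (k n) = g n" for n
    using extend_rep[OF gA] g(1) by (auto simp: k_def pull_def)
  \<comment> \<open>The bijections whose class lies in \<open>V\<close> are closed under almost
    everywhere equality by construction. A factorisation of classes becomes exact by choosing
    \<open>finv (k n) \<circ> T\<close> as the second factor.\<close>
  interpret syndetic M "pull M G" "{T \<in> pull M G. cls M T \<in> V}" k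
  proof unfold_locales
    fix T assume "T \<in> {T \<in> pull M G. cls M T \<in> V}"
    then have T: "T \<in> pull M G" "cls M T \<in> V" by auto
    show "T \<in> pull M G" by (rule T)
    show "finv T \<in> {T \<in> pull M G. cls M T \<in> V}"
      using T invc cls_inv[OF I[OF T(1)]] Vi by auto
    fix S assume S: "S \<in> pull M G" "AE x in M. S x = T x"
    then show "S \<in> {T \<in> pull M G. cls M T \<in> V}" using T cls_eq_iff[OF I[OF S(1)] I[OF T(1)]] by auto
  next
    show "k n \<in> pull M G" for n by (rule k)
    fix T assume T: "T \<in> pull M G"
    then have "cls M T \<in> (\<Union>n. g n <#\<^bsub>?G\<^esub> V)" using g(2) by (simp add: pull_def)
    then obtain n v where v: "v \<in> V" "cls M T = g n \<otimes>\<^bsub>Aut M\<^esub> v" by (auto simp: l_coset_def)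
    have vA: "v \<in> carrier (Aut M)" using v VG GA by auto
    have kT: "finv (k n) \<circ> T \<in> pull M G" using comp invc k T by blast
    have "cls M (finv (k n) \<circ> T) = inv\<^bsub>Aut M\<^esub> (g n) \<otimes>\<^bsub>Aut M\<^esub> (g n \<otimes>\<^bsub>Aut M\<^esub> v)"
      using cls_comp[OF I[OF invc[OF k(1)]] I[OF T]] cls_inv[OF I[OF k(1)]] k(2) v(2) by simp
    also have "\<dots> = v" using A.inv_solve_left' gA vA by (simp add: A.m_assoc[symmetric])
    finally have "finv (k n) \<circ> T \<in> {T \<in> pull M G. cls M T \<in> V}" using kT v(1) by simp
    moreover have "T = k n \<circ> (finv (k n) \<circ> T)" using k(1) by auto
    ultimately show "\<exists>n. \<exists>v\<in>{T \<in> pull M G. cls M T \<in> V}. T = k n \<circ> v" by blast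
  qed
  obtain C and \<epsilon> :: real where C: "C \<in> sets M" "emeasure M C < \<infinity>" "\<epsilon> > 0"
    and vp114: "\<And>T. T \<in> pull M G \<Longrightarrow> emeasure M {x\<in>C. T x \<noteq> x} < ennreal \<epsilon> \<Longrightarrow> T \<in> vp 114"
    by (rule nbhd) blast
  have pow: "cls M T \<in> set_power ?G V n" if "T \<in> vp n" for T n
    using that
  proof (induction n arbitrary: T)
    case 0
    then have "T \<in> pull M G" "AE x in M. T x = id x" by auto
    then show ?case using cls_eq_iff[OF I mp_maps_id] cls_id[of M] by simp
  next
    case (Suc n)
    then obtain R v where R: "R \<in> vp n" "v \<in> pull M G" "cls M v \<in> V" "T = R \<circ> v" by auto
    have "cls M T = cls M R \<otimes>\<^bsub>Aut M\<^esub> cls M v" using R cls_comp I vpH by blast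
    then show ?case using Suc.IH[OF R(1)] R(3) by (auto simp: set_mult_def)
  qed
  let ?U = "{S \<in> carrier (Aut M). unif_dist M C \<one>\<^bsub>Aut M\<^esub> S < \<epsilon>}"
  have "openin (uniform_topology M) ?U"
    unfolding uniform_topology_def openin_topology_generated_by_iff
    by (rule generate_topology_on.Basis) (use C in auto)
  then have "openin (subtopology (uniform_topology M) G) (?U \<inter> G)"
    by (auto simp: openin_subtopology)
  moreover have "\<one>\<^bsub>Aut M\<^esub> \<in> ?U \<inter> G"
    using C(3) subgroup.one_closed[OF G'] by (simp add: unif_dist_def)
  moreover have "?U \<inter> G \<subseteq> set_power ?G V 114"
  proof
    fix P assume P: "P \<in> ?U \<inter> G"
    then have Pc: "P \<in> carrier (Aut M)" by auto
    define T where "T = extend M (rep P)"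
    have T: "T \<in> pull M G" "cls M T = P" using extend_rep[OF Pc] P by (auto simp: T_def pull_def)
    have ms: "{x\<in>C. T x \<noteq> x} \<in> sets M"
    proof -
      have "{x\<in>C. T x \<noteq> x} = C \<inter> {x\<in>space M. T x \<noteq> id x}" using sets.sets_into_space[OF C(1)] by auto
      then show ?thesis using neq[OF T(1) one] C(1) by auto
    qed
    \<comment> \<open>The chosen representative of the unit class is the identity only almost
      everywhere, so the set measured by \<open>unif_dist\<close> is compared with
      \<open>{x\<in>C. T x \<noteq> x}\<close> modulo null sets.\<close>
    have "AE x in M. rep \<one>\<^bsub>Aut M\<^esub> x = x" using rep_cls[OF mp_maps_id, of M] by (simp add: cls_id)
    then have ae: "AE x in M. x \<in> {x\<in>C. rep \<one>\<^bsub>Aut M\<^esub> x \<noteq> rep P x} \<longleftrightarrow> x \<in> {x\<in>C. T x \<noteq> x}"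
      using AE_space by eventually_elim (auto simp: T_def extend_def)
    have ms': "{x\<in>C. rep \<one>\<^bsub>Aut M\<^esub> x \<noteq> rep P x} \<in> sets M"
    proof -
      have o: "\<one>\<^bsub>Aut M\<^esub> \<in> G" by (rule subgroup.one_closed[OF G'])
      then have oc: "\<one>\<^bsub>Aut M\<^esub> \<in> carrier (Aut M)" using GA by auto
      have "extend M (rep \<one>\<^bsub>Aut M\<^esub>) \<in> pull M G" using extend_rep[OF oc] o by (auto simp: pull_def)
      from neq[OF this T(1)] have "C \<inter> {x\<in>space M. extend M (rep \<one>\<^bsub>Aut M\<^esub>) x \<noteq> T x} \<in> sets M"
        using C(1) by auto
      moreover have "C \<inter> {x\<in>space M. extend M (rep \<one>\<^bsub>Aut M\<^esub>) x \<noteq> T x} = {x\<in>C. rep \<one>\<^bsub>Aut M\<^esub> x \<noteq> rep P x}"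
        using sets.sets_into_space[OF C(1)] by (auto simp: T_def extend_def)
      ultimately show ?thesis by simp
    qed
    have "measure M {x\<in>C. T x \<noteq> x} = unif_dist M C \<one>\<^bsub>Aut M\<^esub> P"
      unfolding unif_dist_def using ae ms ms' by (intro measure_eq_AE[symmetric]) auto
    then have lt: "measure M {x\<in>C. T x \<noteq> x} < \<epsilon>" using P by simp
    \<comment> \<open>Finite measure of \<open>C\<close> ensures that the real number
      \<open>measure\<close> is the true measure and not the default 0 of an infinite one.\<close>
    have "emeasure M {x\<in>C. T x \<noteq> x} \<le> emeasure M C" using C(1) by (intro emeasure_mono) auto
    then have "emeasure M {x\<in>C. T x \<noteq> x} \<noteq> \<infinity>" using C(2) by auto
    then have "emeasure M {x\<in>C. T x \<noteq> x} = ennreal (measure M {x\<in>C. T x \<noteq> x})"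
      by (simp add: emeasure_eq_ennreal_measure)
    then have "emeasure M {x\<in>C. T x \<noteq> x} < ennreal \<epsilon>" using lt C(3) by (simp add: ennreal_lessI)
    from pow[OF vp114[OF T(1) this]] show "P \<in> set_power ?G V 114" using T(2) by simp
  qed
  ultimately show ?thesis unfolding contains_open_nbhd_def by blast
qed

section \<open>The uniform topology\<close>

definition unif_ball :: "'a measure \<Rightarrow> 'a set \<Rightarrow> ('a \<Rightarrow> 'a) set \<Rightarrow> real \<Rightarrow> ('a \<Rightarrow> 'a) set set" where
  "unif_ball M C P \<epsilon> = {S \<in> carrier (Aut M). unif_dist M C P S < \<epsilon>}"

locale std_space =
  fixes M :: "'a measure"
  assumes borel: "standard_borel M" and sfin: "sigma_finite_measure M"
begin

sublocale mp: mp_group M "mp_maps M"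
proof -
  have "pull M (carrier (Aut M)) = mp_maps M" by (auto simp: pull_def cls_carrier)
  then show "mp_group M (mp_maps M)"
    using mp_group_pull[OF borel sfin group.subgroup_self[OF group_Aut]] by simp
qed

definition dis :: "'a set \<Rightarrow> ('a \<Rightarrow> 'a) \<Rightarrow> ('a \<Rightarrow> 'a) \<Rightarrow> 'a set" where
  "dis C S T = {x\<in>C. S x \<noteq> T x}"

lemma dis_sets:
  assumes "S \<in> mp_maps M" "T \<in> mp_maps M" "C \<in> sets M" shows "dis C S T \<in> sets M"
proof -
  have "dis C S T = C \<inter> {x\<in>space M. S x \<noteq> T x}" using sets.sets_into_space[OF assms(3)] by (auto simp: dis_def)
  then show ?thesis using mp.neq[OF assms(1,2)] assms(3) by auto
qed

lemma dis_fm: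
  assumes "S \<in> mp_maps M" "T \<in> mp_maps M" "C \<in> sets M" "emeasure M C < \<infinity>"
  shows "dis C S T \<in> fmeasurable M"
proof (rule fmeasurableI[OF dis_sets[OF assms(1-3)]])
  have "emeasure M (dis C S T) \<le> emeasure M C" using assms(3) by (intro emeasure_mono) (auto simp: dis_def)
  then show "emeasure M (dis C S T) < \<infinity>" using assms(4) by (rule le_less_trans)
qed

text \<open>Frees distances from the chosen representatives: any bijections in the two classes may
  be used to compute them.\<close>

lemma unif_dist_cls:
  assumes "S \<in> mp_maps M" "T \<in> mp_maps M" "C \<in> sets M"
  shows "unif_dist M C (cls M S) (cls M T) = measure M (dis C S T)"
proof -
  let ?S = "extend M (rep (cls M S))" let ?T = "extend M (rep (cls M T))"
  have "unif_dist M C (cls M S) (cls M T) = measure M (dis C ?S ?T)"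
    unfolding unif_dist_def dis_def using sets.sets_into_space[OF assms(3)]
    by (intro arg_cong[of _ _ "measure M"]) (auto simp: extend_def)
  also have "\<dots> = measure M (dis C S T)"
  proof (rule measure_eq_AE)
    show "AE x in M. x \<in> dis C ?S ?T \<longleftrightarrow> x \<in> dis C S T"
      using rep_cls[OF assms(1)] rep_cls[OF assms(2)] AE_space
      by eventually_elim (simp add: dis_def extend_def)
  qed (use assms dis_sets extend_rep(1) cls_carrier in blast)+
  finally show ?thesis .
qed

lemma unif_dist_self: "unif_dist M C P P = 0" by (simp add: unif_dist_def)

lemma carrier_cls: "P \<in> carrier (Aut M) \<Longrightarrow> \<exists>T\<in>mp_maps M. P = cls M T"
  using extend_rep by metis

lemma unif_triangle:
  assumes "P \<in> carrier (Aut M)" "Q \<in> carrier (Aut M)" "R \<in> carrier (Aut M)" "C \<in> sets M" "emeasure M C < \<infinity>"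
  shows "unif_dist M C P R \<le> unif_dist M C P Q + unif_dist M C Q R"
proof -
  obtain S T U where s: "S \<in> mp_maps M" "T \<in> mp_maps M" "U \<in> mp_maps M"
    "P = cls M S" "Q = cls M T" "R = cls M U" using assms(1-3) carrier_cls by metis
  have "measure M (dis C S U) \<le> measure M (dis C S T \<union> dis C T U)"
    using s assms by (intro measure_mono_fmeasurable fmeasurable.Un dis_fm dis_sets) (auto simp: dis_def)
  also have "\<dots> \<le> measure M (dis C S T) + measure M (dis C T U)"
    using s assms by (intro measure_Un_le dis_sets)
  finally show ?thesis using s assms by (simp add: unif_dist_cls)
qed

lemma unif_mono:
  assumes "P \<in> carrier (Aut M)" "Q \<in> carrier (Aut M)" "C \<in> sets M" "D \<in> sets M" "emeasure M D < \<infinity>" "C \<subseteq> D"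
  shows "unif_dist M C P Q \<le> unif_dist M D P Q"
proof -
  obtain S T where s: "S \<in> mp_maps M" "T \<in> mp_maps M"
    "P = cls M S" "Q = cls M T" using assms(1-2) carrier_cls by metis
  have "measure M (dis C S T) \<le> measure M (dis D S T)"
    using s assms by (intro measure_mono_fmeasurable dis_fm dis_sets) (auto simp: dis_def)
  then show ?thesis using s assms by (simp add: unif_dist_cls)
qed

lemma open_ball:
  assumes "C \<in> sets M" "emeasure M C < \<infinity>" "P \<in> carrier (Aut M)" "\<epsilon> > 0"
  shows "openin (uniform_topology M) (unif_ball M C P \<epsilon>)"
  unfolding uniform_topology_def openin_topology_generated_by_iff unif_ball_def
  by (rule generate_topology_on.Basis) (use assms in auto)

lemma in_ball: "P \<in> carrier (Aut M) \<Longrightarrow> \<epsilon> > 0 \<Longrightarrow> P \<in> unif_ball M C P \<epsilon>"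
  by (simp add: unif_ball_def unif_dist_self)

text \<open>The balls for all \<open>C\<close> form a neighbourhood base: intersections are handled
  by uniting the sets \<open>C\<close> and taking the smaller radius, and a ball is recentred at one
  of its points by the triangle inequality.\<close>

lemma open_contains_ball:
  assumes "openin (uniform_topology M) W" "P \<in> W"
  shows "\<exists>C \<epsilon>. C \<in> sets M \<and> emeasure M C < \<infinity> \<and> \<epsilon> > 0 \<and> unif_ball M C P \<epsilon> \<subseteq> W"
proof -
  have "W \<subseteq> carrier (Aut M) \<and> (\<forall>P\<in>W. \<exists>C \<epsilon>. C \<in> sets M \<and> emeasure M C < \<infinity> \<and> \<epsilon> > 0 \<and> unif_ball M C P \<epsilon> \<subseteq> W)"
    using openin_topology_generated_by[OF assms(1)[unfolded uniform_topology_def]]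
  proof (induction rule: generate_topology_on.induct)
    case Empty
    then show ?case by simp
  next
    case (Int U W)
    show ?case
    proof (intro conjI ballI)
      show "U \<inter> W \<subseteq> carrier (Aut M)" using Int by blast
      fix P assume P: "P \<in> U \<inter> W"
      obtain C \<epsilon> where C: "C \<in> sets M" "emeasure M C < \<infinity>" "\<epsilon> > 0" "unif_ball M C P \<epsilon> \<subseteq> U" using Int P by blast
      obtain D \<delta> where D: "D \<in> sets M" "emeasure M D < \<infinity>" "\<delta> > 0" "unif_ball M D P \<delta> \<subseteq> W" using Int P by blast
      have CD: "C \<union> D \<in> sets M" using C D by auto
      have "emeasure M (C \<union> D) \<le> emeasure M C + emeasure M D" using C D by (intro emeasure_subadditive)
      also have "\<dots> < \<infinity>" using C D by simp
      finally have fin: "emeasure M (C \<union> D) < \<infinity>" .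
      have Pc: "P \<in> carrier (Aut M)" using P Int by blast
      have "unif_ball M (C \<union> D) P (min \<epsilon> \<delta>) \<subseteq> unif_ball M C P \<epsilon> \<inter> unif_ball M D P \<delta>"
      proof
        fix S assume S: "S \<in> unif_ball M (C \<union> D) P (min \<epsilon> \<delta>)"
        then have Sc: "S \<in> carrier (Aut M)" by (simp add: unif_ball_def)
        have "unif_dist M C P S \<le> unif_dist M (C \<union> D) P S" "unif_dist M D P S \<le> unif_dist M (C \<union> D) P S"
          by (rule unif_mono[OF Pc Sc _ CD fin]; use C D in auto)+
        then show "S \<in> unif_ball M C P \<epsilon> \<inter> unif_ball M D P \<delta>" using S by (simp add: unif_ball_def)
      qed
      then have "unif_ball M (C \<union> D) P (min \<epsilon> \<delta>) \<subseteq> U \<inter> W" using C(4) D(4) by blast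
      moreover have "min \<epsilon> \<delta> > 0" using C(3) D(3) by simp
      ultimately show "\<exists>C \<epsilon>. C \<in> sets M \<and> emeasure M C < \<infinity> \<and> \<epsilon> > 0 \<and> unif_ball M C P \<epsilon> \<subseteq> U \<inter> W"
        using CD fin by (intro exI[where x="C \<union> D"] exI[where x="min \<epsilon> \<delta>"] conjI)
    qed
  next
    case (UN K)
    show ?case
    proof (intro conjI ballI)
      show "\<Union>K \<subseteq> carrier (Aut M)" using UN by blast
      fix P assume "P \<in> \<Union>K"
      then obtain U where U: "U \<in> K" "P \<in> U" by auto
      from bspec[OF conjunct2[OF UN.IH[OF U(1)]] U(2)] obtain C \<epsilon> where
        C: "C \<in> sets M" "emeasure M C < \<infinity>" "\<epsilon> > 0" "unif_ball M C P \<epsilon> \<subseteq> U" by (elim exE conjE)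
      have "unif_ball M C P \<epsilon> \<subseteq> \<Union>K" using C(4) U(1) by blast
      with C(1-3) show "\<exists>C \<epsilon>. C \<in> sets M \<and> emeasure M C < \<infinity> \<and> \<epsilon> > 0 \<and> unif_ball M C P \<epsilon> \<subseteq> \<Union>K"
        by (intro exI[where x=C] exI[where x=\<epsilon>] conjI)
    qed
  next
    case (Basis U)
    then obtain C T \<epsilon> where U: "U = unif_ball M C T \<epsilon>" "C \<in> sets M" "emeasure M C < \<infinity>" "T \<in> carrier (Aut M)"
      unfolding unif_ball_def by blast
    show ?case
    proof (intro conjI ballI)
      show "U \<subseteq> carrier (Aut M)" by (auto simp: U unif_ball_def)
      fix P assume P: "P \<in> U"
      then have Pc: "P \<in> carrier (Aut M)" and lt: "unif_dist M C T P < \<epsilon>" by (auto simp: U unif_ball_def)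
      have "unif_ball M C P (\<epsilon> - unif_dist M C T P) \<subseteq> U"
      proof
        fix S assume "S \<in> unif_ball M C P (\<epsilon> - unif_dist M C T P)"
        then have "S \<in> carrier (Aut M)" "unif_dist M C P S < \<epsilon> - unif_dist M C T P" by (auto simp: unif_ball_def)
        then show "S \<in> U" using unif_triangle[OF U(4) Pc _ U(2,3), of S] by (simp add: U unif_ball_def)
      qed
      then show "\<exists>C \<epsilon>. C \<in> sets M \<and> emeasure M C < \<infinity> \<and> \<epsilon> > 0 \<and> unif_ball M C P \<epsilon> \<subseteq> U"
        using U(2,3) lt by (intro exI[of _ C] exI[of _ "\<epsilon> - unif_dist M C T P"]) simp
    qed
  qed
  then show ?thesis using assms(2) by blast
qed

lemma topspace_uniform: "topspace (uniform_topology M) = carrier (Aut M)"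
proof
  show "topspace (uniform_topology M) \<subseteq> carrier (Aut M)"
    unfolding uniform_topology_def topology_generated_by_topspace by blast
  \<comment> \<open>Over the empty set all distances vanish, so a single ball is the whole
    group.\<close>
  have "unif_ball M {} \<one>\<^bsub>Aut M\<^esub> 1 = carrier (Aut M)" by (auto simp: unif_ball_def unif_dist_def)
  moreover have "\<one>\<^bsub>Aut M\<^esub> \<in> carrier (Aut M)" using group.is_monoid[OF group_Aut] by (rule monoid.one_closed)
  ultimately have "openin (uniform_topology M) (carrier (Aut M))"
    using open_ball[of "{}" "\<one>\<^bsub>Aut M\<^esub>" 1] by simp
  then show "carrier (Aut M) \<subseteq> topspace (uniform_topology M)" by (rule openin_subset)
qed

text \<open>\<open>X \<circ> Y\<close> and \<open>X' \<circ> Y'\<close> differ at \<open>x\<close>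
  only if \<open>Y\<close> and \<open>Y'\<close> differ at \<open>x\<close>, or \<open>X\<close> and
  \<open>X'\<close> differ at \<open>Y x\<close>. The moved set depends on \<open>Y\<close> but not
  on \<open>Y'\<close>, so it stays fixed while the second pair varies; this is what continuity at a
  point asks for.\<close>

lemma unif_dist_mult:
  assumes m: "X \<in> mp_maps M" "X' \<in> mp_maps M" "Y \<in> mp_maps M" "Y' \<in> mp_maps M" and C: "C \<in> sets M" "emeasure M C < \<infinity>"
  shows "unif_dist M C (cls M (X \<circ> Y)) (cls M (X' \<circ> Y')) \<le>
    unif_dist M (Y ` C) (cls M X) (cls M X') + unif_dist M C (cls M Y) (cls M Y')"
proof -
  have YC: "Y ` C \<in> sets M" "emeasure M (Y ` C) < \<infinity>" using mp.img[OF m(3) C(1)] mp.emi[OF m(3) C(1)] C(2) by auto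
  have d: "dis (Y ` C) X X' \<in> fmeasurable M" "dis C Y Y' \<in> fmeasurable M"
    using dis_fm m YC C by auto
  have vi: "Y -` dis (Y ` C) X X' \<in> sets M" "emeasure M (Y -` dis (Y ` C) X X') = emeasure M (dis (Y ` C) X X')"
    using mp.img'[OF m(3)] mp.emi'[OF m(3)] d(1) by auto
  have vf: "Y -` dis (Y ` C) X X' \<in> fmeasurable M"
    using vi d(1) by (auto simp: fmeasurable_def)
  have "dis C (X \<circ> Y) (X' \<circ> Y') \<subseteq> Y -` dis (Y ` C) X X' \<union> dis C Y Y'"
    by (auto simp: dis_def)
  then have "measure M (dis C (X \<circ> Y) (X' \<circ> Y')) \<le> measure M (Y -` dis (Y ` C) X X' \<union> dis C Y Y')"
    using m C vf d by (intro measure_mono_fmeasurable dis_sets mp_maps_comp fmeasurable.Un)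
  also have "\<dots> \<le> measure M (Y -` dis (Y ` C) X X') + measure M (dis C Y Y')"
    using vi d by (intro measure_Un_le) auto
  also have "measure M (Y -` dis (Y ` C) X X') = measure M (dis (Y ` C) X X')"
    using vi(2) by (simp add: measure_def)
  finally show ?thesis
    using m C YC unif_dist_cls mp_maps_comp by metis
qed

text \<open>At \<open>c = X b\<close> the inverses differ exactly if \<open>X b\<close> and
  \<open>X' b\<close> differ, so \<open>X\<close> carries one disagreement set onto the other. The
  set on the right depends on \<open>X\<close> alone, so it is fixed while \<open>X'\<close>
  varies.\<close>

lemma unif_dist_inv:
  assumes m: "X \<in> mp_maps M" "X' \<in> mp_maps M" and C: "C \<in> sets M"
  shows "unif_dist M C (cls M (finv X)) (cls M (finv X')) = unif_dist M (X -` C) (cls M X) (cls M X')"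
proof -
  have "dis C (finv X) (finv X') = X ` dis (X -` C) X X'"
  proof (rule Set.set_eqI)
    fix c
    obtain b where b: "c = X b" using mp.invR[OF m(1)] by metis
    have "b = finv X' (X b) \<longleftrightarrow> X b = X' b" using mp.invL[OF m(2)] mp.invR[OF m(2)] by metis
    then show "c \<in> dis C (finv X) (finv X') \<longleftrightarrow> c \<in> X ` dis (X -` C) X X'"
      unfolding b inj_image_mem_iff[OF bij_is_inj[OF mp.bij[OF m(1)]]] using m(1) by (auto simp: dis_def)
  qed
  moreover have "dis (X -` C) X X' \<in> sets M" by (rule dis_sets[OF m mp.img'[OF m(1) C]])
  ultimately have "measure M (dis C (finv X) (finv X')) = measure M (dis (X -` C) X X')"
    using mp.emi[OF m(1)] by (simp add: measure_def)
  then show ?thesis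
    using unif_dist_cls[OF mp_maps_inv[OF m(1)] mp_maps_inv[OF m(2)] C] unif_dist_cls[OF m mp.img'[OF m(1) C]] by simp
qed

lemma topological_group_sub:
  assumes G: "subgroup G (Aut M)"
  shows "topological_group (Aut M\<lparr>carrier := G\<rparr>) (subtopology (uniform_topology M) G)"
proof -
  let ?G = "Aut M\<lparr>carrier := G\<rparr>" let ?t = "subtopology (uniform_topology M) G"
  interpret A: group "Aut M" by (rule group_Aut)
  interpret S: subgroup G "Aut M" by (rule G)
  have GA: "G \<subseteq> carrier (Aut M)" by (rule S.subset)
  have top: "topspace ?t = G" using GA by (auto simp: topspace_uniform)
  have oB: "openin ?t (unif_ball M C P \<epsilon> \<inter> G)" if "C \<in> sets M" "emeasure M C < \<infinity>" "P \<in> G" "\<epsilon> > 0" for C P \<epsilon>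
    using open_ball[of C P \<epsilon>] that GA by (auto simp: openin_subtopology)
  have opE: "\<exists>C \<epsilon>. C \<in> sets M \<and> emeasure M C < \<infinity> \<and> \<epsilon> > 0 \<and> unif_ball M C P \<epsilon> \<inter> G \<subseteq> W"
    if oW: "openin ?t W" and "P \<in> W" for W P
  proof -
    obtain U where U: "openin (uniform_topology M) U" "W = U \<inter> G"
      using oW[unfolded openin_subtopology] by (elim exE conjE)
    then have "P \<in> U" using \<open>P \<in> W\<close> by blast
    from open_contains_ball[OF U(1) this] obtain C \<epsilon> where
      C: "C \<in> sets M" "emeasure M C < \<infinity>" "\<epsilon> > 0" "unif_ball M C P \<epsilon> \<subseteq> U" by (elim exE conjE)
    have "unif_ball M C P \<epsilon> \<inter> G \<subseteq> W" using U(2) C(4) by blast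
    with C(1-3) show ?thesis by (intro exI[where x=C] exI[where x=\<epsilon>] conjI)
  qed
  have mult: "continuous_map (prod_topology ?t ?t) ?t (\<lambda>(x, y). x \<otimes>\<^bsub>?G\<^esub> y)"
    unfolding continuous_map_def
  proof (intro conjI allI impI)
    show "(\<lambda>(x, y). x \<otimes>\<^bsub>?G\<^esub> y) \<in> topspace (prod_topology ?t ?t) \<rightarrow> topspace ?t"
      using S.m_closed by (auto simp: topspace_prod_topology top topspace_uniform)
    fix W assume W: "openin ?t W"
    let ?I = "{z \<in> topspace (prod_topology ?t ?t). (case z of (x, y) \<Rightarrow> x \<otimes>\<^bsub>?G\<^esub> y) \<in> W}"
    show "openin (prod_topology ?t ?t) ?I"
    proof (subst openin_subopen, intro ballI)
      fix z assume z: "z \<in> ?I"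
      obtain x y where xy: "z = (x, y)" by (cases z)
      have G2: "x \<in> G" "y \<in> G" "x \<otimes>\<^bsub>Aut M\<^esub> y \<in> W" using z by (auto simp: xy topspace_prod_topology top topspace_uniform)
      obtain C \<epsilon> where C: "C \<in> sets M" "emeasure M C < \<infinity>" "\<epsilon> > 0" "unif_ball M C (x \<otimes>\<^bsub>Aut M\<^esub> y) \<epsilon> \<inter> G \<subseteq> W"
        using opE[OF W G2(3)] by blast
      obtain X where X: "X \<in> mp_maps M" "x = cls M X" using carrier_cls GA G2 by blast
      obtain Y where Y: "Y \<in> mp_maps M" "y = cls M Y" using carrier_cls GA G2 by blast
      have YC: "Y ` C \<in> sets M" "emeasure M (Y ` C) < \<infinity>" using mp.img[OF Y(1) C(1)] mp.emi[OF Y(1) C(1)] C(2) by auto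
      \<comment> \<open>The two balls are read off from \<open>unif_dist_mult\<close>: the first
        factor is tested on the image of \<open>C\<close> under \<open>Y\<close>, the second on
        \<open>C\<close> itself, and each contributes half of the radius.\<close>
      let ?T = "(unif_ball M (Y ` C) x (\<epsilon>/2) \<inter> G) \<times> (unif_ball M C y (\<epsilon>/2) \<inter> G)"
      have "openin (prod_topology ?t ?t) ?T"
        unfolding openin_prod_Times_iff using oB[OF YC G2(1), of "\<epsilon>/2"] oB[OF C(1,2) G2(2), of "\<epsilon>/2"] C(3) by simp
      moreover have "z \<in> ?T" using in_ball G2 GA C(3) by (auto simp: xy)
      moreover have "?T \<subseteq> ?I"
      proof
        fix q assume q: "q \<in> ?T"
        obtain x' y' where q': "q = (x', y')" by (cases q)
        have G3: "x' \<in> G" "y' \<in> G" "unif_dist M (Y ` C) x x' < \<epsilon>/2" "unif_dist M C y y' < \<epsilon>/2"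
          using q by (auto simp: q' unif_ball_def)
        obtain X' where X': "X' \<in> mp_maps M" "x' = cls M X'" using carrier_cls GA G3 by blast
        obtain Y' where Y': "Y' \<in> mp_maps M" "y' = cls M Y'" using carrier_cls GA G3 by blast
        have "unif_dist M C (x \<otimes>\<^bsub>Aut M\<^esub> y) (x' \<otimes>\<^bsub>Aut M\<^esub> y') < \<epsilon>"
        proof -
          have e: "x \<otimes>\<^bsub>Aut M\<^esub> y = cls M (X \<circ> Y)" "x' \<otimes>\<^bsub>Aut M\<^esub> y' = cls M (X' \<circ> Y')"
            using cls_comp[OF X(1) Y(1)] cls_comp[OF X'(1) Y'(1)] X(2) Y(2) X'(2) Y'(2) by simp_all
          show ?thesis unfolding e
            using unif_dist_mult[OF X(1) X'(1) Y(1) Y'(1) C(1,2)] G3(3,4)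
            unfolding X(2)[symmetric] Y(2)[symmetric] X'(2)[symmetric] Y'(2)[symmetric] by linarith
        qed
        moreover have "x' \<otimes>\<^bsub>Aut M\<^esub> y' \<in> G" using G3 S.m_closed by blast
        ultimately have "x' \<otimes>\<^bsub>Aut M\<^esub> y' \<in> unif_ball M C (x \<otimes>\<^bsub>Aut M\<^esub> y) \<epsilon> \<inter> G"
          using GA by (simp add: unif_ball_def subset_iff)
        then have "x' \<otimes>\<^bsub>Aut M\<^esub> y' \<in> W" using C(4) by blast
        then show "q \<in> ?I" using G3(1,2) by (simp add: q' top del: topspace_subtopology)
      qed
      ultimately show "\<exists>T. openin (prod_topology ?t ?t) T \<and> z \<in> T \<and> T \<subseteq> ?I" by blast
    qed
  qed
  have inve: "inv\<^bsub>?G\<^esub> x = inv\<^bsub>Aut M\<^esub> x" if "x \<in> G" for x by (rule A.m_inv_consistent[OF G that])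
  have inv: "continuous_map ?t ?t (\<lambda>x. inv\<^bsub>?G\<^esub> x)"
    unfolding continuous_map_def
  proof (intro conjI allI impI)
    show "(\<lambda>x. inv\<^bsub>?G\<^esub> x) \<in> topspace ?t \<rightarrow> topspace ?t"
      unfolding top using S.m_inv_closed inve by auto
    fix W assume W: "openin ?t W"
    let ?I = "{x \<in> topspace ?t. inv\<^bsub>?G\<^esub> x \<in> W}"
    show "openin ?t ?I"
    proof (subst openin_subopen, intro ballI)
      fix x assume "x \<in> ?I"
      then have x: "x \<in> G" "inv\<^bsub>Aut M\<^esub> x \<in> W" unfolding top using inve by auto
      obtain C \<epsilon> where C: "C \<in> sets M" "emeasure M C < \<infinity>" "\<epsilon> > 0" "unif_ball M C (inv\<^bsub>Aut M\<^esub> x) \<epsilon> \<inter> G \<subseteq> W"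
        using opE[OF W x(2)] by blast
      obtain X where X: "X \<in> mp_maps M" "x = cls M X" using carrier_cls GA x by blast
      have XC: "X -` C \<in> sets M" "emeasure M (X -` C) < \<infinity>" using mp.img'[OF X(1) C(1)] mp.emi'[OF X(1) C(1)] C(2) by auto
      let ?T = "unif_ball M (X -` C) x \<epsilon> \<inter> G"
      have "openin ?t ?T" by (rule oB[OF XC x(1) C(3)])
      moreover have "x \<in> ?T" using in_ball x GA C(3) by auto
      moreover have "?T \<subseteq> ?I"
      proof
        fix x' assume "x' \<in> ?T"
        then have x': "x' \<in> G" "unif_dist M (X -` C) x x' < \<epsilon>" by (auto simp: unif_ball_def)
        obtain X' where X': "X' \<in> mp_maps M" "x' = cls M X'" using carrier_cls GA x' by blast
        have "unif_dist M C (inv\<^bsub>Aut M\<^esub> x) (inv\<^bsub>Aut M\<^esub> x') < \<epsilon>"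
        proof -
          have e: "inv\<^bsub>Aut M\<^esub> x = cls M (finv X)" "inv\<^bsub>Aut M\<^esub> x' = cls M (finv X')"
            using cls_inv[OF X(1)] cls_inv[OF X'(1)] X(2) X'(2) by simp_all
          show ?thesis unfolding e
            using unif_dist_inv[OF X(1) X'(1) C(1)] x'(2)
            unfolding X(2)[symmetric] X'(2)[symmetric] by linarith
        qed
        moreover have "inv\<^bsub>Aut M\<^esub> x' \<in> G" using x' S.m_inv_closed by blast
        ultimately have "inv\<^bsub>Aut M\<^esub> x' \<in> W" using C(4) GA by (auto simp: unif_ball_def)
        then show "x' \<in> ?I" unfolding top using x' inve by simp
      qed
      ultimately show "\<exists>T. openin ?t T \<and> x \<in> T \<and> T \<subseteq> ?I" by blast
    qed
  qed
  show ?thesis unfolding topological_group_def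
    using S.subgroup_is_group[OF group_Aut] top mult inv by simp
qed

end

theorem theorem6p17:
  fixes M :: "'a measure" and G :: "('a \<Rightarrow> 'a) set set"
  assumes "standard_sigma_finite_space M"
    and "full_group M G"
    and "ergodic M G"
  shows "(\<forall>V. symmetric_subset (Aut M\<lparr>carrier := G\<rparr>) V \<and>
              countably_syndetic (Aut M\<lparr>carrier := G\<rparr>) V \<longrightarrow>
              contains_open_nbhd (subtopology (uniform_topology M) G) \<one>\<^bsub>Aut M\<^esub>
                (set_power (Aut M\<lparr>carrier := G\<rparr>) V 114))
       \<and> Steinhaus 114 (Aut M\<lparr>carrier := G\<rparr>) (subtopology (uniform_topology M) G)"
proof -
  interpret std_space M
    using assms(1) by unfold_locales (auto simp: standard_sigma_finite_space_def sigma_finite_measure_def)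
  have "subgroup G (Aut M)" using assms(2) by (simp add: full_group_def)
  from topological_group_sub[OF this] show ?thesis
    unfolding Steinhaus_def using ex_nbhd[OF assms] by simp
qed

end
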